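(* Let $1<p<\infty$, let $\Omega$ be a domain in $\mathbb{R}^N$ and let $V\in L^\infty_{\mathrm{loc}}(\Omega)$, $V\ge 0$. Put $\mathcal{Q}_V(u):=\int_\Omega|\nabla u|^p\,dx-\int_\Omega V|u|^p\,dx$. Suppose that there exists $\widetilde W\in\mathcal{C}(\Omega)$, $\widetilde W>0$, such that $$\mathcal{Q}_V(u)\ge\int_\Omega\widetilde W|u|^p\,dx\quad\text{for all }u\in\mathcal{D}(\Omega).$$ Then for each $f\in\mathcal{D}'(\Omega)$ satisfying $$\sup\{\langle f,u\rangle : u\in\mathcal{D}(\Omega),\ \mathcal{Q}_V(u)=1\}<+\infty$$ there exists a solution $u\in W^{1,p}_{\mathrm{loc}}(\Omega)$ to $$-\Delta_p u-V(x)|u|^{p-2}u=f(x)\quad\text{in }\mathcal{D}'(\Omega).$$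
   Context: $\mathcal{D}(\Omega)$ is the space of (real-valued) test functions on $\Omega$ and $\mathcal{D}'(\Omega)$ the space of distributions. $\Delta_p u:=\operatorname{div}(|\nabla u|^{p-2}\nabla u)$. A solution in $\mathcal{D}'(\Omega)$ means that $\int_\Omega|\nabla u|^{p-2}\nabla u\cdot\nabla\zeta\,dx-\int_\Omega V|u|^{p-2}u\,\zeta\,dx=\langle f,\zeta\rangle$ for all $\zeta\in\mathcal{D}(\Omega)$. *)

theory Defs
  imports "HOL-Analysis.Analysis"
begin

definition partial_deriv :: "'n::finite \<Rightarrow> (real^'n \<Rightarrow> real) \<Rightarrow> real^'n \<Rightarrow> real" where
  "partial_deriv i u = (\<lambda>x. frechet_derivative u (at x) (axis i 1))"

definition iter_partial :: "'n::finite list \<Rightarrow> (real^'n \<Rightarrow> real) \<Rightarrow> real^'n \<Rightarrow> real" where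
  "iter_partial js u = foldr partial_deriv js u"

definition grad :: "(real^'n::finite \<Rightarrow> real) \<Rightarrow> real^'n \<Rightarrow> real^'n" where
  "grad u x = (\<chi> i. partial_deriv i u x)"

text \<open>Differentiability of every iterated partial derivative also gives its continuity, so the
  following is the usual class \<open>C\<^sup>\<infinity>\<close>.\<close>

definition smooth :: "(real^'n::finite \<Rightarrow> real) \<Rightarrow> bool" where
  "smooth u \<longleftrightarrow> (\<forall>js. iter_partial js u differentiable_on UNIV)"

text \<open>Test functions on \<open>\<Omega>\<close> are functions on the whole space, extended by zero outside \<open>\<Omega>\<close>.\<close>

definition test_functions :: "(real^'n::finite) set \<Rightarrow> (real^'n \<Rightarrow> real) set" where
  "test_functions \<Omega> =
     {u. smooth u \<and> compact (closure {x. u x \<noteq> 0}) \<and> closure {x. u x \<noteq> 0} \<subseteq> \<Omega>}"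

text \<open>A distribution is a linear functional on the test functions that is continuous for the
  inductive limit topology, that is, on every compact \<open>K \<subseteq> \<Omega>\<close> it is bounded by
  finitely many of the derivative seminorms. Its values off the test functions are irrelevant.
  Multi-indices are represented by lists of directions.\<close>

definition distributions :: "(real^'n::finite) set \<Rightarrow> ((real^'n \<Rightarrow> real) \<Rightarrow> real) set" where
  "distributions \<Omega> =
     {f. (\<forall>u\<in>test_functions \<Omega>. \<forall>v\<in>test_functions \<Omega>. \<forall>a b.
            f (\<lambda>x. a * u x + b * v x) = a * f u + b * f v) \<and>
         (\<forall>K. compact K \<and> K \<subseteq> \<Omega> \<longrightarrow>
            (\<exists>C m. \<forall>u\<in>test_functions \<Omega>. closure {x. u x \<noteq> 0} \<subseteq> K \<longrightarrow>
               \<bar>f u\<bar> \<le> C * (\<Sum>js | length js \<le> m. SUP x. \<bar>iter_partial js u x\<bar>)))}"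

definition Lp_loc :: "(real^'n::finite) set \<Rightarrow> real \<Rightarrow> (real^'n \<Rightarrow> 'b::euclidean_space) set" where
  "Lp_loc \<Omega> p =
     {u. u \<in> borel_measurable (lebesgue_on \<Omega>) \<and>
         (\<forall>K. compact K \<and> K \<subseteq> \<Omega> \<longrightarrow> integrable (lebesgue_on K) (\<lambda>x. norm (u x) powr p))}"

definition Linf_loc :: "(real^'n::finite) set \<Rightarrow> (real^'n \<Rightarrow> real) set" where
  "Linf_loc \<Omega> =
     {v. v \<in> borel_measurable (lebesgue_on \<Omega>) \<and>
         (\<forall>K. compact K \<and> K \<subseteq> \<Omega> \<longrightarrow> (\<exists>C. AE x in lebesgue_on K. \<bar>v x\<bar> \<le> C))}"

definition has_weak_gradient ::
    "(real^'n::finite) set \<Rightarrow> (real^'n \<Rightarrow> real) \<Rightarrow> (real^'n \<Rightarrow> real^'n) \<Rightarrow> bool" where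
  "has_weak_gradient \<Omega> u g \<longleftrightarrow>
     u \<in> Lp_loc \<Omega> 1 \<and> g \<in> Lp_loc \<Omega> 1 \<and>
     (\<forall>\<phi>\<in>test_functions \<Omega>. \<forall>i.
        (LINT x|lebesgue_on \<Omega>. u x * partial_deriv i \<phi> x)
          = - (LINT x|lebesgue_on \<Omega>. g x $ i * \<phi> x))"

definition W1p_loc :: "(real^'n::finite) set \<Rightarrow> real \<Rightarrow> (real^'n \<Rightarrow> real) set" where
  "W1p_loc \<Omega> p = {u. u \<in> Lp_loc \<Omega> p \<and> (\<exists>g. has_weak_gradient \<Omega> u g \<and> g \<in> Lp_loc \<Omega> p)}"

text \<open>Only used for test functions \<open>u\<close>, hence with the classical gradient.\<close>

definition Q_form ::
    "(real^'n::finite) set \<Rightarrow> real \<Rightarrow> (real^'n \<Rightarrow> real) \<Rightarrow> (real^'n \<Rightarrow> real) \<Rightarrow> real" where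
  "Q_form \<Omega> p V u =
     (LINT x|lebesgue_on \<Omega>. norm (grad u x) powr p) - (LINT x|lebesgue_on \<Omega>. V x * \<bar>u x\<bar> powr p)"

text \<open>\<open>u\<close> solves \<open>-\<Delta>\<^sub>p u - V |u|\<^sup>p\<^sup>-\<^sup>2 u = f\<close> in the sense of distributions. The weak gradient \<open>g\<close>
  is unique almost everywhere, so it does not matter which representative is taken. Since
  \<open>0 powr a = 0\<close>, the field \<open>|\<nabla>u|\<^sup>p\<^sup>-\<^sup>2 \<nabla>u\<close> vanishes where \<open>\<nabla>u\<close> does, also for \<open>p < 2\<close>.\<close>

definition distributional_solution ::
    "(real^'n::finite) set \<Rightarrow> real \<Rightarrow> (real^'n \<Rightarrow> real) \<Rightarrow> ((real^'n \<Rightarrow> real) \<Rightarrow> real)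
      \<Rightarrow> (real^'n \<Rightarrow> real) \<Rightarrow> bool" where
  "distributional_solution \<Omega> p V f u \<longleftrightarrow>
     (\<exists>g. has_weak_gradient \<Omega> u g \<and>
        (\<forall>\<zeta>\<in>test_functions \<Omega>.
           (LINT x|lebesgue_on \<Omega>. norm (g x) powr (p - 2) * (g x \<bullet> grad \<zeta> x))
             - (LINT x|lebesgue_on \<Omega>. V x * \<bar>u x\<bar> powr (p - 2) * u x * \<zeta> x) = f \<zeta>))"

end

(* Minimize J(u) = Q(u) - p f(u) over the test functions themselves. By homogeneity the hypothesis on
   f reads f(u) <= C Q(u)^(1/p), so J is bounded below and Q, hence the weighted L^p norm, is bounded
   along a minimizing sequence phi_n. For a cutoff function eta, convexity of |.|^p makes the
   competitors (1 - eta) phi_n cheaper in gradient energy where eta > 0, which yields local bounds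
   for the gradients; thus a subsequence is Cauchy in L^p_loc (Rellich). The pair of competitors
   phi_m - eta (phi_m - phi_n)/2, phi_n + eta (phi_m - phi_n)/2 has the same sum as phi_m, phi_n, so f
   cancels, and strict convexity forces the gradients to be Cauchy in L^p_loc as well. Hence phi_n
   converges strongly in W^(1,p)_loc, and J(phi_n + h zeta) >= inf J passes to the limit in n and
   then, divided by h, to the limit h -> 0. *)

theory Submission
  imports Defs "HOL-Complex_Analysis.Great_Picard"
begin

section \<open>Convexity and monotonicity inequalities for powers of norms\<close>

text \<open>In general Q is neither convex nor the p-th power of a norm, so no reflexive space is at
  hand in which to minimize by weak compactness; and weak convergence of gradients would not carry
  |grad u|^(p-2) grad u to the limit. Hence strong local convergence is the target. The functional f
  is defined on test functions only and is bounded by Q^(1/p), thus by gradient energy and not by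
  L^p norms. In the gradient bound, f(\<eta> \<phi>) grows like the power 1/p < 1 of the very energy
  being estimated and can be absorbed. In the Cauchy estimate the gradient differences are not yet
  known to be small, so f cannot be estimated at all; this is why two competitors with a fixed sum
  are used. The potential term has the wrong convexity, but it contains no gradients and becomes
  small by the L^p_loc convergence already obtained. The limit u need not have finite energy: only
  differences of energies, with integrands vanishing off a compact set, are passed to the limit. The
  factor p in J cancels the one produced by differentiating the p-th power.\<close>

text \<open>Convexity on the open half-line extends to the endpoint 0 because s^p \<le> s for s in
  [0,1].\<close>

lemma powr_convex_combination:
  fixes x y t p :: real
  assumes "1 \<le> p" "0 \<le> x" "0 \<le> y" "0 \<le> t" "t \<le> 1"
  shows "((1 - t) * x + t * y) powr p \<le> (1 - t) * x powr p + t * y powr p"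
proof -
  have scale: "(s * z) powr p \<le> s * z powr p" if "0 \<le> s" "s \<le> 1" "0 \<le> z" for s z :: real
  proof -
    have "s powr p \<le> s powr 1"
      using that \<open>1 \<le> p\<close> by (intro powr_mono') auto
    then show ?thesis
      using that by (simp add: powr_mult mult_right_mono)
  qed
  consider "x = 0" | "y = 0" | "0 < x" "0 < y"
    using assms by linarith
  then show ?thesis
  proof cases
    case 3
    then show ?thesis
      using convex_onD[OF powr_convex[OF \<open>1 \<le> p\<close>], of t x y] assms by simp
  qed (use assms scale[of t y] scale[of "1 - t" x] in auto)
qed

text \<open>The supporting line of a convex function. Taking \<open>a\<close> to be a mean and
  integrating in \<open>x\<close> gives Jensen's inequality.\<close>

lemma powr_tangent_le:
  fixes x a p :: real
  assumes "1 < p" "0 \<le> x" "0 \<le> a"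
  shows "a powr p + p * a powr (p - 1) * (x - a) \<le> x powr p"
proof -
  consider "a = 0" | "x = 0" "0 < a" | "0 < x" "0 < a"
    using assms by linarith
  then show ?thesis
  proof cases
    case 2
    have "a powr p \<le> p * (a powr (p - 1) * a)"
      using assms 2 by (simp flip: powr_mult_base' add: powr_minus powr_diff)
    then show ?thesis
      using 2 by (simp add: mult.assoc)
  next
    case 3
    have "(\<lambda>z. z powr p) x - a powr p \<ge> (p * a powr (p - 1)) * (x - a)"
    proof (rule convex_on_imp_above_tangent[OF powr_convex])
      show "((\<lambda>z. z powr p) has_field_derivative p * a powr (p - 1)) (at a within {0<..})"
        using 3 by (auto intro!: derivative_eq_intros simp: has_field_derivative_at_within)
    qed (use 3 assms in \<open>auto simp: interior_open\<close>)
    then show ?thesis by simp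
  qed (use assms in auto)
qed

lemma norm_powr_convex_combination:
  fixes a b :: "'b::real_normed_vector"
  assumes "1 \<le> p" "0 \<le> t" "t \<le> 1"
  shows "norm ((1 - t) *\<^sub>R a + t *\<^sub>R b) powr p \<le> (1 - t) * norm a powr p + t * norm b powr p"
proof -
  have "norm ((1 - t) *\<^sub>R a + t *\<^sub>R b) \<le> (1 - t) * norm a + t * norm b"
    using assms norm_triangle_ineq[of "(1 - t) *\<^sub>R a" "t *\<^sub>R b"] by simp
  then have "norm ((1 - t) *\<^sub>R a + t *\<^sub>R b) powr p \<le> ((1 - t) * norm a + t * norm b) powr p"
    using assms by (intro powr_mono2) auto
  also have "\<dots> \<le> (1 - t) * norm a powr p + t * norm b powr p"
    using assms by (intro powr_convex_combination) auto
  finally show ?thesis .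
qed

lemma norm_scaleR_powr:
  fixes a :: "'b::real_normed_vector"
  shows "norm (c *\<^sub>R a) powr p = \<bar>c\<bar> powr p * norm a powr p"
  by (simp add: powr_mult)

text \<open>Write a + b as the convex combination of a / (1 - t) and b / t; homogeneity turns the
  weights into powers with exponent 1 - p. As t tends to 0 the coefficient of \<open>a\<close> tends
  to 1.\<close>

lemma norm_add_powr_le_split:
  fixes a b :: "'b::real_normed_vector"
  assumes "1 \<le> p" "0 < t" "t < 1"
  shows "norm (a + b) powr p \<le> (1 - t) powr (1 - p) * norm a powr p + t powr (1 - p) * norm b powr p"
proof -
  have s: "s * (1 / s) powr p = s powr (1 - p)" if "0 < s" for s :: real
    using that by (simp add: powr_divide powr_diff)
  have "norm ((1 - t) *\<^sub>R ((1 / (1 - t)) *\<^sub>R a) + t *\<^sub>R ((1 / t) *\<^sub>R b)) powr p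
      \<le> (1 - t) * norm ((1 / (1 - t)) *\<^sub>R a) powr p + t * norm ((1 / t) *\<^sub>R b) powr p"
    using assms by (intro norm_powr_convex_combination) auto
  also have "\<dots> = ((1 - t) * (1 / (1 - t)) powr p) * norm a powr p + (t * (1 / t) powr p) * norm b powr p"
    using assms unfolding norm_scaleR_powr by simp
  also have "\<dots> = (1 - t) powr (1 - p) * norm a powr p + t powr (1 - p) * norm b powr p"
    using assms by (subst (1 2) s) auto
  finally show ?thesis
    using assms by simp
qed

lemma norm_add_powr_le:
  fixes a b :: "'b::real_normed_vector"
  assumes "1 \<le> p"
  shows "norm (a + b) powr p \<le> 2 powr p * (norm a powr p + norm b powr p)"
proof -
  have "(1 / 2) powr (1 - p) = (2::real) powr (p - 1)"
    by (simp add: powr_divide powr_diff)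
  also have "\<dots> \<le> 2 powr p"
    by (intro powr_mono) auto
  finally have c: "(1 / 2) powr (1 - p) \<le> (2::real) powr p" .
  have "norm (a + b) powr p \<le> (1 / 2) powr (1 - p) * (norm a powr p + norm b powr p)"
    using norm_add_powr_le_split[OF assms, of "1/2" a b] by (simp add: distrib_left)
  also have "\<dots> \<le> 2 powr p * (norm a powr p + norm b powr p)"
    by (intro mult_right_mono c) auto
  finally show ?thesis .
qed

text \<open>A small splitting parameter brings the coefficient of \<open>a\<close> below 1 + e, at
  the price of a large but fixed coefficient of \<open>b\<close>. In this way cutoff errors are
  separated from gradient energies that are only known to be bounded.\<close>

lemma norm_add_powr_le_eps:
  assumes "1 \<le> p" "0 < e"
  obtains C where "0 < C"
    "\<And>a b :: 'b::real_normed_vector. norm (a + b) powr p \<le> (1 + e) * norm a powr p + C * norm b powr p"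
proof -
  have "((\<lambda>t. (1 - t) powr (1 - p)) \<longlongrightarrow> (1 - 0) powr (1 - p)) (at_right (0::real))"
    by (intro tendsto_intros) auto
  then have "\<forall>\<^sub>F t in at_right (0::real). (1 - t) powr (1 - p) < 1 + e"
    using \<open>0 < e\<close> by (auto elim: order_tendstoD)
  moreover have "\<forall>\<^sub>F t in at_right (0::real). 0 < t \<and> t < 1"
    using eventually_at_right_less[of 0] eventually_at_right_real[of 0 1] by (auto elim: eventually_mono)
  ultimately have "\<forall>\<^sub>F t in at_right (0::real). (1 - t) powr (1 - p) < 1 + e \<and> 0 < t \<and> t < 1"
    by (rule eventually_conj)
  then obtain t :: real where t: "(1 - t) powr (1 - p) < 1 + e" "0 < t" "t < 1"
    using eventually_happens by force
  show ?thesis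
  proof (rule that)
    show "0 < t powr (1 - p)" using t by simp
    fix a b :: 'b
    have "(1 - t) powr (1 - p) * norm a powr p \<le> (1 + e) * norm a powr p"
      using t by (intro mult_right_mono) auto
    then show "norm (a + b) powr p \<le> (1 + e) * norm a powr p + t powr (1 - p) * norm b powr p"
      using norm_add_powr_le_split[OF \<open>1 \<le> p\<close>, of t a b] t by linarith
  qed
qed

lemma powr_midpoint_strict:
  fixes s t p :: real
  assumes "1 < p" "0 \<le> s" "s < t"
  shows "((s + t) / 2) powr p < (s powr p + t powr p) / 2"
proof -
  define m where "m = (s + t) / 2"
  have m: "s < m" "m < t" "m - s = t - m" using assms by (auto simp: m_def field_simps)
  have cont: "continuous_on {u..v} (\<lambda>x::real. x powr p)" if "0 \<le> u" for u v
    using that assms by (intro continuous_on_powr') (auto intro!: continuous_intros)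
  have der: "((\<lambda>x. x powr p) has_derivative (\<lambda>h. h * (p * z powr (p - 1)))) (at z)" if "0 < z" for z
    using has_real_derivative_powr[OF that, of p] unfolding has_field_derivative_def
    by (rule has_derivative_eq_rhs) (rule ext, rule mult.commute)
  have "0 < p" "0 \<le> m" using assms m by auto
  obtain \<eta> where \<eta>: "s < \<eta>" "\<eta> < m" "m powr p - s powr p = (m - s) * (p * \<eta> powr (p - 1))"
    using mvt[OF \<open>s < m\<close> cont[OF \<open>0 \<le> s\<close>] der[OF order.strict_trans1[OF \<open>0 \<le> s\<close>]]] by metis
  obtain \<xi> where \<xi>: "m < \<xi>" "\<xi> < t" "t powr p - m powr p = (t - m) * (p * \<xi> powr (p - 1))"
    using mvt[OF \<open>m < t\<close> cont[OF \<open>0 \<le> m\<close>] der[OF order.strict_trans1[OF \<open>0 \<le> m\<close>]]] by metis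
  have "\<eta> powr (p - 1) < \<xi> powr (p - 1)"
    using \<eta> \<xi> assms m by (intro powr_less_mono2) auto
  then have "(m - s) * (p * \<eta> powr (p - 1)) < (t - m) * (p * \<xi> powr (p - 1))"
    unfolding m(3) using m \<open>0 < p\<close> by (intro mult_strict_left_mono) auto
  then have "m powr p - s powr p < t powr p - m powr p"
    unfolding \<eta>(3) \<xi>(3) .
  then show ?thesis
    unfolding m_def[symmetric] by argo
qed

lemma powr_le_one_plus_powr:
  fixes s p q :: real
  assumes "0 \<le> s" "0 \<le> q" "q \<le> p"
  shows "s powr q \<le> 1 + s powr p"
proof (cases "s \<le> 1")
  case True
  then have "s powr q \<le> 1" using assms by (intro powr_le1) auto
  then show ?thesis using powr_ge_zero[of s p] by linarith
next
  case False
  then have "s powr q \<le> s powr p" using assms by (intro powr_mono) auto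
  then show ?thesis by simp
qed

text \<open>The midpoint convexity defect of the p-th power of the norm. It plays the part of
  Clarkson's inequalities, uniformly for all p > 1.\<close>

definition powr_gap :: "real \<Rightarrow> 'b::real_normed_vector \<Rightarrow> 'b \<Rightarrow> real" where
  "powr_gap p a b = (norm a powr p + norm b powr p) / 2 - norm ((1/2) *\<^sub>R (a + b)) powr p"

lemma powr_gap_nonneg: "1 \<le> p \<Longrightarrow> 0 \<le> powr_gap p a b"
  using norm_powr_convex_combination[of p "1/2" a b] by (simp add: powr_gap_def scaleR_add_right)

text \<open>Strictness has two sources. For equal norms the parallelogram identity makes the
  midpoint strictly shorter; for different norms the scalar power is strictly convex.\<close>

lemma powr_gap_pos:
  fixes a b :: "'b::real_inner"
  assumes "1 < p" "a \<noteq> b"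
  shows "0 < powr_gap p a b"
proof (cases "norm a = norm b")
  case True
  have "norm ((1/2) *\<^sub>R (a + b)) < norm a"
  proof -
    have "(norm ((1/2) *\<^sub>R (a + b)))\<^sup>2 = ((norm a)\<^sup>2 + (norm b)\<^sup>2) / 2 - (norm (a - b))\<^sup>2 / 4"
      unfolding power2_norm_eq_inner
      by (simp only: inner_scaleR_left inner_scaleR_right inner_add_left inner_add_right
          inner_diff_left inner_diff_right inner_commute[of b a]) argo
    moreover have "0 < (norm (a - b))\<^sup>2" using assms by simp
    ultimately have "(norm ((1/2) *\<^sub>R (a + b)))\<^sup>2 < (norm a)\<^sup>2" using True by simp
    then show ?thesis by (rule power2_less_imp_less) simp
  qed
  then have "norm ((1/2) *\<^sub>R (a + b)) powr p < norm a powr p"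
    using assms by (intro powr_less_mono2) auto
  then show ?thesis using True by (simp add: powr_gap_def)
next
  case False
  have "norm ((1/2) *\<^sub>R (a + b)) \<le> (norm a + norm b) / 2"
    using norm_triangle_ineq[of a b] by simp
  then have "norm ((1/2) *\<^sub>R (a + b)) powr p \<le> ((norm a + norm b) / 2) powr p"
    using assms by (intro powr_mono2) auto
  also have "\<dots> < (norm a powr p + norm b powr p) / 2"
  proof (cases "norm a < norm b")
    case True
    then show ?thesis
      using powr_midpoint_strict[OF assms(1), of "norm a" "norm b"] by simp
  next
    case nless: False
    then have "norm b < norm a" using False by simp
    then have "((norm b + norm a) / 2) powr p < (norm b powr p + norm a powr p) / 2"
      using powr_midpoint_strict[OF assms(1), of "norm b" "norm a"] by simp
    then show ?thesis by (simp only: add.commute)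
  qed
  finally show ?thesis by (simp only: powr_gap_def diff_gt_0_iff_gt)
qed

lemma powr_gap_scaleR:
  "powr_gap p (c *\<^sub>R a) (c *\<^sub>R b) = \<bar>c\<bar> powr p * powr_gap p a b"
proof -
  have eq: "(1/2) *\<^sub>R (c *\<^sub>R a + c *\<^sub>R b) = c *\<^sub>R ((1/2) *\<^sub>R (a + b))"
    by (simp only: scaleR_add_right scaleR_scaleR mult.commute)
  show ?thesis
    unfolding powr_gap_def eq norm_scaleR_powr[of c] right_diff_distrib distrib_left times_divide_eq_right by (rule refl)
qed

text \<open>Both sides are homogeneous of degree \<open>p\<close>, so it suffices to treat the compact set where
  \<open>|a|\<^sup>p + |b|\<^sup>p = 1\<close> and \<open>|a - b|\<^sup>p \<ge> e\<close>, on which the gap is bounded away from zero.\<close>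

lemma norm_diff_powr_le_gap:
  assumes "1 < p" "0 < e"
  obtains C where "0 < C" "\<And>a b :: 'b::euclidean_space.
    norm (a - b) powr p \<le> e * (norm a powr p + norm b powr p) + C * powr_gap p a b"
proof -
  define S where "S = {z :: 'b \<times> 'b. norm (fst z) powr p + norm (snd z) powr p = 1
      \<and> e \<le> norm (fst z - snd z) powr p}"
  have cont: "continuous_on UNIV (\<lambda>z :: 'b \<times> 'b. norm (L z :: 'b) powr p)"
    if "continuous_on UNIV L" for L
    using assms by (intro continuous_on_powr' continuous_intros that) auto
  have c1: "continuous_on UNIV (\<lambda>z :: 'b \<times> 'b. norm (fst z) powr p)"
    and c2: "continuous_on UNIV (\<lambda>z :: 'b \<times> 'b. norm (snd z) powr p)"
    and c3: "continuous_on UNIV (\<lambda>z :: 'b \<times> 'b. norm (fst z - snd z) powr p)"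
    and c4: "continuous_on UNIV (\<lambda>z :: 'b \<times> 'b. norm ((1/2) *\<^sub>R (fst z + snd z)) powr p)"
    by (rule cont, intro continuous_intros)+
  have "closed S"
    unfolding S_def using c1 c2 c3
    by (intro closed_Collect_conj closed_Collect_eq closed_Collect_le continuous_on_add continuous_on_const)
  moreover have "bounded S"
  proof -
    have "norm z \<le> 2" if "z \<in> S" for z
    proof -
      have le1: "x \<le> 1" if "x powr p \<le> 1" "0 \<le> x" for x :: real
        using that assms powr_less_mono2[of p 1 x] by fastforce
      have "norm (fst z) powr p \<le> 1" "norm (snd z) powr p \<le> 1"
        using that powr_ge_zero[of "norm (fst z)" p] powr_ge_zero[of "norm (snd z)" p]
        by (auto simp: S_def simp del: powr_ge_zero)
      then show ?thesis
        using le1[of "norm (fst z)"] le1[of "norm (snd z)"] norm_Pair_le[of "fst z" "snd z"] by simp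
    qed
    then show ?thesis unfolding bounded_iff by blast
  qed
  ultimately have "compact S" by (simp add: compact_eq_bounded_closed)
  have c5: "continuous_on S (\<lambda>z. powr_gap p (fst z) (snd z))"
    unfolding powr_gap_def
    by (rule continuous_on_subset[OF _ subset_UNIV])
      (intro continuous_on_diff continuous_on_divide continuous_on_add c1 c2 c4 continuous_on_const; simp)+
  obtain m where m: "0 < m" "\<And>z. z \<in> S \<Longrightarrow> m \<le> powr_gap p (fst z) (snd z)"
  proof (cases "S = {}")
    case False
    then obtain z0 where z0: "z0 \<in> S" "\<And>z. z \<in> S \<Longrightarrow> powr_gap p (fst z0) (snd z0) \<le> powr_gap p (fst z) (snd z)"
      using continuous_attains_inf[OF \<open>compact S\<close> _ c5] by auto
    then have "fst z0 \<noteq> snd z0"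
      using assms by (auto simp: S_def)
    then show ?thesis
      using that[of "powr_gap p (fst z0) (snd z0)"] powr_gap_pos[OF \<open>1 < p\<close>] z0 by blast
  qed (use that[of 1] in auto)
  show ?thesis
  proof (rule that)
    \<comment> \<open>Here \<open>m\<close> bounds the gap from below on the normalized set, while
      |a - b|^p is at most 2^p (|a|^p + |b|^p) everywhere; their quotient is the constant.\<close>
    show "0 < 2 powr p / m" using m by simp
    fix a b :: 'b
    define s where "s = norm a powr p + norm b powr p"
    have gap0: "0 \<le> powr_gap p a b" using assms by (intro powr_gap_nonneg) auto
    show "norm (a - b) powr p \<le> e * (norm a powr p + norm b powr p) + 2 powr p / m * powr_gap p a b"
    proof (cases "norm (a - b) powr p \<le> e * s")
      case True
      then show ?thesis using gap0 m by (simp add: s_def add_increasing2)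
    next
      case False
      have s: "0 < s"
      proof (rule ccontr)
        assume "\<not> 0 < s"
        moreover have "0 \<le> norm a powr p" "0 \<le> norm b powr p" by auto
        ultimately have "norm a powr p = 0" "norm b powr p = 0" unfolding s_def by linarith+
        then show False using False by (auto simp: s_def)
      qed
      \<comment> \<open>The scaling factor that brings the pair to |a|^p + |b|^p = 1.\<close>
      define c where "c = s powr (- (1 / p))"
      have c: "\<bar>c\<bar> powr p = 1 / s"
        proof -
        have "c powr p = s powr (- 1)"
          unfolding c_def powr_powr using assms by simp
        then show ?thesis using s by (simp add: c_def powr_minus_divide)
      qed
      have "(c *\<^sub>R a, c *\<^sub>R b) \<in> S"
      proof -
        have "norm (c *\<^sub>R a) powr p + norm (c *\<^sub>R b) powr p = 1"
          using s unfolding norm_scaleR_powr c by (simp add: s_def[symmetric] flip: add_divide_distrib)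
        moreover have "norm (c *\<^sub>R a - c *\<^sub>R b) powr p = norm (a - b) powr p / s"
          using norm_scaleR_powr[of c "a - b" p] c by (simp add: scaleR_diff_right)
        moreover have "e \<le> norm (a - b) powr p / s"
          using False s by (simp add: field_simps)
        ultimately show ?thesis
          unfolding S_def by simp
      qed
      from m(2)[OF this] have "m * s \<le> powr_gap p a b"
        using s by (simp add: powr_gap_scaleR c field_simps)
      moreover have "norm (a - b) powr p \<le> 2 powr p * s"
        using norm_add_powr_le[of p a "-b"] assms by (simp add: s_def)
      ultimately have "norm (a - b) powr p \<le> 2 powr p / m * powr_gap p a b"
        using m mult_left_mono[of "m * s" "powr_gap p a b" "2 powr p / m"] by simp
      moreover have "0 \<le> e * s" using s assms by simp
      ultimately show ?thesis by (simp add: s_def)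
    qed
  qed
qed

text \<open>Convexity is applied twice for h \<ge> 0: a + h b lies between a and a + b, which bounds
  the increment from above, and a lies between a + h b and a - b with weight h / (1 + h), which
  bounds it from below. Negative h means a step along -b. The bound is linear in |h|, so it
  dominates difference quotients uniformly.\<close>

lemma norm_powr_diff_quotient_le:
  fixes a b :: "'b::real_normed_vector"
  assumes "1 \<le> p" "\<bar>h\<bar> \<le> 1"
  shows "\<bar>norm (a + h *\<^sub>R b) powr p - norm a powr p\<bar> \<le> \<bar>h\<bar> * (2 powr p * (norm a powr p + norm b powr p))"
proof -
  have *: "\<bar>norm (a + h *\<^sub>R b) powr p - norm a powr p\<bar> \<le> h * (2 powr p * (norm a powr p + norm b powr p))"
    if h: "0 \<le> h" "h \<le> 1" for h and b :: 'b
  proof -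
    have up: "norm (a + h *\<^sub>R b) powr p \<le> (1 - h) * norm a powr p + h * norm (a + b) powr p"
      using norm_powr_convex_combination[of p h a "a + b"] assms h by (simp add: algebra_simps)
    define t where "t = h / (1 + h)"
    have t: "0 \<le> t" "t \<le> 1" "(1 + h) * (1 - t) = 1" "(1 + h) * t = h"
      using h by (auto simp: t_def field_simps)
    have "(1 - t) * h - t = 0"
      using t(4) by (simp add: algebra_simps)
    moreover have "(1 - t) *\<^sub>R (a + h *\<^sub>R b) + t *\<^sub>R (a - b) = a + ((1 - t) * h - t) *\<^sub>R b"
      by (simp add: algebra_simps)
    ultimately have eq: "(1 - t) *\<^sub>R (a + h *\<^sub>R b) + t *\<^sub>R (a - b) = a"
      by simp
    have "norm a powr p \<le> (1 - t) * norm (a + h *\<^sub>R b) powr p + t * norm (a - b) powr p"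
      using norm_powr_convex_combination[OF assms(1) t(1,2), of "a + h *\<^sub>R b" "a - b"] unfolding eq .
    then have "(1 + h) * norm a powr p \<le> (1 + h) * ((1 - t) * norm (a + h *\<^sub>R b) powr p + t * norm (a - b) powr p)"
      using h by (intro mult_left_mono) auto
    also have "\<dots> = norm (a + h *\<^sub>R b) powr p + h * norm (a - b) powr p"
      unfolding distrib_left mult.assoc[symmetric] t by simp
    finally have lo: "norm a powr p - norm (a + h *\<^sub>R b) powr p \<le> h * norm (a - b) powr p - h * norm a powr p"
      by (simp add: algebra_simps)
    have n: "norm (a + b) powr p \<le> 2 powr p * (norm a powr p + norm b powr p)"
      "norm (a - b) powr p \<le> 2 powr p * (norm a powr p + norm b powr p)"
      using norm_add_powr_le[of p a b] norm_add_powr_le[of p a "-b"] assms by auto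
    have "h * norm (a + b) powr p \<le> h * (2 powr p * (norm a powr p + norm b powr p))"
      "h * norm (a - b) powr p \<le> h * (2 powr p * (norm a powr p + norm b powr p))"
      "0 \<le> h * norm a powr p"
      using n h by (auto intro!: mult_left_mono)
    then show ?thesis using up lo by (simp add: left_diff_distrib)
  qed
  show ?thesis
    using *[of "\<bar>h\<bar>" "if 0 \<le> h then b else - b"] assms by (auto split: if_splits)
qed

text \<open>Off the origin |x|^p = (x . x)^(p/2) and the chain rule applies. At a = 0 the function
  is |h|^p |b|^p, which is o(h) because p > 1; the stated derivative is then 0 as well, since a . b
  = 0.\<close>

lemma norm_powr_has_directional_derivative:
  fixes a b :: "'b::real_inner"
  assumes "1 < p"
  shows "((\<lambda>h. norm (a + h *\<^sub>R b) powr p) has_real_derivative p * (norm a powr (p - 2) * (a \<bullet> b))) (at 0)"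
proof (cases "a = 0")
  case True
  have "((\<lambda>h::real. \<bar>h\<bar> powr (p - 1) * norm b powr p) \<longlongrightarrow> \<bar>0\<bar> powr (p - 1) * norm b powr p) (at 0)"
    using assms by (intro tendsto_intros tendsto_powr') auto
  then have lim: "((\<lambda>h::real. \<bar>h\<bar> powr (p - 1) * norm b powr p) \<longlongrightarrow> 0) (at 0)"
    using assms by simp
  have "((\<lambda>h::real. (\<bar>h\<bar> powr p * norm b powr p) / h) \<longlongrightarrow> 0) (at 0)"
  proof (rule Lim_null_comparison[OF _ lim])
    have "norm ((\<bar>h\<bar> powr p * norm b powr p) / h) \<le> \<bar>h\<bar> powr (p - 1) * norm b powr p" for h :: real
      by (cases "h = 0") (auto simp: powr_diff)
    then show "\<forall>\<^sub>F h::real in at 0. norm ((\<bar>h\<bar> powr p * norm b powr p) / h) \<le> \<bar>h\<bar> powr (p - 1) * norm b powr p"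
      by simp
  qed
  then show ?thesis
    using True by (simp add: DERIV_def powr_mult)
next
  case False
  have np: "norm x powr q = (x \<bullet> x) powr (q / 2)" for x :: 'b and q
    by (cases "x = 0") (simp_all add: norm_eq_sqrt_inner powr_half_sqrt[symmetric] powr_powr)
  have pos: "0 < a \<bullet> a" using False by simp
  have "((\<lambda>h. (a \<bullet> a + 2 * h * (a \<bullet> b) + h\<^sup>2 * (b \<bullet> b)) powr (p / 2)) has_real_derivative
      p * ((a \<bullet> a) powr ((p - 2) / 2) * (a \<bullet> b))) (at 0)"
    using pos by (auto intro!: derivative_eq_intros simp: diff_divide_distrib)
  moreover have "(a + h *\<^sub>R b) \<bullet> (a + h *\<^sub>R b) = a \<bullet> a + 2 * h * (a \<bullet> b) + h\<^sup>2 * (b \<bullet> b)" for h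
    by (simp add: inner_simps inner_commute power2_eq_square)
  ultimately show ?thesis
    unfolding np by simp
qed

text \<open>Absorption of a lower-order term: for s > 1 dividing by s leaves s^(p-1) \<le> A + B.
  The summand 1 covers s \<le> 1.\<close>

lemma powr_le_affine_imp_bounded:
  fixes s A B p :: real
  assumes "1 < p" "0 \<le> A" "0 \<le> B" "0 \<le> s" "s powr p \<le> A + B * s"
  shows "s \<le> 1 + (A + B) powr (1 / (p - 1))"
proof (cases "s \<le> 1")
  case False
  have "s powr (p - 1) * s = s powr p"
    using False by (simp add: powr_diff)
  also have "\<dots> \<le> (A + B) * s"
    using assms False mult_left_mono[of 1 s A] by (simp add: distrib_right)
  finally have "s powr (p - 1) \<le> A + B" using False by simp
  then have "(s powr (p - 1)) powr (1 / (p - 1)) \<le> (A + B) powr (1 / (p - 1))"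
    using assms by (intro powr_mono2) auto
  then show ?thesis using assms False by (simp add: powr_powr)
next
  case True
  then show ?thesis using powr_ge_zero[of "A + B" "1 / (p - 1)"] by linarith
qed

section \<open>Smooth functions and cutoffs\<close>

text \<open>Smoothness is the largest property that implies differentiability and passes to partial
  derivatives, so a class \<open>S\<close> with both features contains only smooth
  functions.\<close>

lemma smooth_coinduct:
  assumes "u \<in> S" "\<And>v. v \<in> S \<Longrightarrow> v differentiable_on UNIV"
    "\<And>v i. v \<in> S \<Longrightarrow> partial_deriv i v \<in> S"
  shows "smooth u"
proof -
  have "iter_partial js u \<in> S" for js
    by (induction js) (auto simp: iter_partial_def assms)
  then show ?thesis using assms(2) by (simp add: smooth_def)
qed

lemma smooth_partial_deriv:
  assumes "smooth u" shows "smooth (partial_deriv i u)"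
proof -
  have "iter_partial js (partial_deriv i u) = iter_partial (js @ [i]) u" for js
    by (simp add: iter_partial_def)
  then show ?thesis using assms by (simp add: smooth_def)
qed

lemma smooth_imp_differentiable: "smooth u \<Longrightarrow> u differentiable (at x)"
  unfolding smooth_def by (drule spec[of _ "[]"]) (simp add: iter_partial_def differentiable_on_def)

lemma smooth_imp_continuous_on: "smooth u \<Longrightarrow> continuous_on S u"
  by (meson continuous_at_imp_continuous_on differentiable_imp_continuous_within smooth_imp_differentiable)

lemma partial_deriv_eqI:
  "(u has_derivative D) (at x) \<Longrightarrow> partial_deriv i u x = D (axis i 1)"
  unfolding partial_deriv_def using frechet_derivative_at by metis

lemma has_derivative_grad:
  assumes "u differentiable (at x)"
  shows "(u has_derivative (\<lambda>h. grad u x \<bullet> h)) (at x)"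
proof -
  define D where "D = frechet_derivative u (at x)"
  have D: "(u has_derivative D) (at x)"
    using assms by (simp add: D_def frechet_derivative_works[THEN iffD1])
  then interpret D: linear D by (rule has_derivative_linear)
  have "D h = grad u x \<bullet> h" for h
  proof -
    have "D h = D (\<Sum>i\<in>UNIV. h $ i *\<^sub>R axis i 1)"
      by (simp add: basis_expansion scalar_mult_eq_scaleR flip: scalar_mult_eq_scaleR)
    also have "\<dots> = grad u x \<bullet> h"
      by (simp add: D.sum D.scaleR inner_vec_def grad_def partial_deriv_def D_def[symmetric] mult.commute)
    finally show ?thesis .
  qed
  then show ?thesis using D by presburger
qed

lemma grad_eqI:
  assumes "(u has_derivative (\<lambda>h. g \<bullet> h)) (at x)" shows "grad u x = g"
  using partial_deriv_eqI[OF assms] by (simp add: grad_def vec_eq_iff inner_axis)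

lemma partial_deriv_conv_grad: "partial_deriv i u x = grad u x $ i"
  by (simp add: grad_def)

lemma smooth_has_derivative:
  "smooth u \<Longrightarrow> (u has_derivative (\<lambda>h. grad u x \<bullet> h)) (at x)"
  by (intro has_derivative_grad smooth_imp_differentiable)

lemma grad_add:
  "smooth u \<Longrightarrow> smooth v \<Longrightarrow> grad (\<lambda>x. u x + v x) x = grad u x + grad v x"
  by (rule grad_eqI) (auto intro!: derivative_eq_intros smooth_has_derivative simp: inner_simps)

lemma grad_mult:
  "smooth u \<Longrightarrow> smooth v \<Longrightarrow> grad (\<lambda>x. u x * v x) x = u x *\<^sub>R grad v x + v x *\<^sub>R grad u x"
  by (rule grad_eqI) (auto intro!: derivative_eq_intros smooth_has_derivative simp: inner_simps)

lemma grad_cmult: "smooth u \<Longrightarrow> grad (\<lambda>x. c * u x) x = c *\<^sub>R grad u x"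
  by (rule grad_eqI) (auto intro!: derivative_eq_intros smooth_has_derivative simp: inner_simps)

lemma grad_power:
  "smooth u \<Longrightarrow> grad (\<lambda>x. u x ^ k) x = (of_nat k * u x ^ (k - 1)) *\<^sub>R grad u x"
  by (rule grad_eqI) (auto intro!: derivative_eq_intros smooth_has_derivative simp: inner_simps)

lemma continuous_on_grad: "smooth u \<Longrightarrow> continuous_on S (grad u)"
  unfolding grad_def by (intro continuous_on_vec_lambda smooth_imp_continuous_on smooth_partial_deriv)

text \<open>The derivatives of \<open>exp (- 1/t)\<close>, extended by zero to \<open>t \<le> 0\<close>, are linear combinations
  of the following functions.\<close>

definition flat_exp :: "nat \<Rightarrow> real \<Rightarrow> real" where
  "flat_exp k t = (if 0 < t then inverse t ^ k * exp (- inverse t) else 0)"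

text \<open>The family in \<open>k\<close> is closed under differentiation up to linear
  combinations. Only t = 0 is delicate: there the right-hand quotient becomes x^(k+1) / exp x with x
  = 1/h, which tends to 0.\<close>

lemma flat_exp_has_derivative:
  "(flat_exp k has_real_derivative flat_exp (k + 2) t - of_nat k * flat_exp (k + 1) t) (at t)"
proof -
  consider "0 < t" | "t < 0" | "t = 0" by linarith
  then show ?thesis
  proof cases
    case 1
    have pow: "((\<lambda>t. inverse t ^ k) has_real_derivative - (of_nat k * inverse t ^ (k + 1))) (at t)"
      by (rule DERIV_cong[OF DERIV_power[OF DERIV_inverse]]) (use 1 in \<open>cases k; simp\<close>)+
    have exp: "((\<lambda>t. exp (- inverse t)) has_real_derivative exp (- inverse t) * inverse t ^ 2) (at t)"
      using 1 by (auto intro!: derivative_eq_intros simp: power2_eq_square)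
    have "((\<lambda>t. inverse t ^ k * exp (- inverse t)) has_real_derivative
        flat_exp (k + 2) t - of_nat k * flat_exp (k + 1) t) (at t)"
      by (rule DERIV_cong[OF DERIV_mult[OF pow exp]])
        (use 1 in \<open>simp add: flat_exp_def power2_eq_square\<close>)
    then show ?thesis
      by (rule has_field_derivative_transform_within_open[of _ _ _ "{0<..}"])
        (use 1 in \<open>auto simp: flat_exp_def\<close>)
  next
    case 2
    have "((\<lambda>t. 0) has_real_derivative flat_exp (k + 2) t - of_nat k * flat_exp (k + 1) t) (at t)"
      using 2 by (simp add: flat_exp_def)
    then show ?thesis
      by (rule has_field_derivative_transform_within_open[of _ _ _ "{..<0}"])
        (use 2 in \<open>auto simp: flat_exp_def\<close>)
  next
    case 3
    have "((\<lambda>h. flat_exp k h / h) \<longlongrightarrow> 0) (at_left (0::real))"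
      by (rule tendsto_eventually) (auto simp: flat_exp_def eventually_at_filter)
    moreover have "((\<lambda>h. flat_exp k h / h) \<longlongrightarrow> 0) (at_right (0::real))"
    proof -
      have "((\<lambda>h::real. inverse h ^ (k + 1) / exp (inverse h)) \<longlongrightarrow> 0) (at_right 0)"
        by (rule filterlim_compose[OF tendsto_power_div_exp_0 filterlim_inverse_at_top_right])
      moreover have "\<forall>\<^sub>F h::real in at_right 0. flat_exp k h / h = inverse h ^ (k + 1) / exp (inverse h)"
        by (auto simp: eventually_at_filter flat_exp_def exp_minus field_simps)
      ultimately show ?thesis using tendsto_cong by force
    qed
    ultimately have "((\<lambda>h. flat_exp k h / h) \<longlongrightarrow> 0) (at 0)"
      by (simp add: filterlim_at_split)
    then show ?thesis using 3 by (simp add: DERIV_def flat_exp_def)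
  qed
qed

text \<open>A class closed under partial derivatives, built for coinduction. Differentiating a
  radial bump produces the factor x - a, hence the constructors \<open>coord\<close> and
  \<open>const\<close>. The constructor \<open>smooth\<close> lets the same argument show that sums
  and products of arbitrary smooth functions are smooth.\<close>

inductive smooth_algebra :: "real^'n::finite \<Rightarrow> real \<Rightarrow> (real^'n \<Rightarrow> real) \<Rightarrow> bool"
  for a r where
  smooth: "smooth u \<Longrightarrow> smooth_algebra a r u"
| const: "smooth_algebra a r (\<lambda>x. c)"
| coord: "smooth_algebra a r (\<lambda>x. x $ i)"
| flat: "smooth_algebra a r (\<lambda>x. flat_exp k (r - (x - a) \<bullet> (x - a)))"
| add: "smooth_algebra a r u \<Longrightarrow> smooth_algebra a r v \<Longrightarrow> smooth_algebra a r (\<lambda>x. u x + v x)"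
| mult: "smooth_algebra a r u \<Longrightarrow> smooth_algebra a r v \<Longrightarrow> smooth_algebra a r (\<lambda>x. u x * v x)"

lemma flat_exp_radial_has_derivative:
  "((\<lambda>x. flat_exp k (r - (x - a) \<bullet> (x - a))) has_derivative
    (\<lambda>h. (flat_exp (k + 2) (r - (x - a) \<bullet> (x - a)) - of_nat k * flat_exp (k + 1) (r - (x - a) \<bullet> (x - a)))
      * (- (2 * ((x - a) \<bullet> h))))) (at x)"
proof -
  have "((\<lambda>x. r - (x - a) \<bullet> (x - a)) has_derivative (\<lambda>h. - (2 * ((x - a) \<bullet> h)))) (at x)"
    by (auto intro!: derivative_eq_intros simp: inner_commute)
  from has_derivative_compose[OF this flat_exp_has_derivative[unfolded has_field_derivative_def]]
  show ?thesis .
qed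

lemma smooth_algebra_differentiable_partial_deriv:
  fixes a :: "real^'n::finite"
  assumes "smooth_algebra a r u"
  shows "(\<forall>x. u differentiable (at x)) \<and> (\<forall>i. smooth_algebra a r (partial_deriv i u))"
  using assms
proof induction
  case (smooth u)
  then show ?case
    by (auto intro: smooth_imp_differentiable smooth_partial_deriv smooth_algebra.smooth)
next
  case (const c)
  have "partial_deriv i (\<lambda>x. c) = (\<lambda>x. 0)" for i :: 'n
    by (rule ext) (subst partial_deriv_eqI, auto)
  then show ?case by (simp add: smooth_algebra.const)
next
  case (coord j)
  have d: "((\<lambda>x. x $ j) has_derivative (\<lambda>h. h $ j)) (at x)" for x :: "real^'n"
    by (intro bounded_linear_imp_has_derivative bounded_linear_vec_nth)
  have "partial_deriv i (\<lambda>x. x $ j) = (\<lambda>x. axis i 1 $ j)" for i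
    by (rule ext) (rule partial_deriv_eqI[OF d])
  then show ?case using d by (auto intro: smooth_algebra.intros simp: differentiable_def)
next
  case (flat k)
  have eq: "partial_deriv i (\<lambda>x. flat_exp k (r - (x - a) \<bullet> (x - a))) =
     (\<lambda>x. (flat_exp (k + 2) (r - (x - a) \<bullet> (x - a)) + (- of_nat k) * flat_exp (k + 1) (r - (x - a) \<bullet> (x - a)))
        * ((- 2) * (x $ i + - a $ i)))" for i
    by (rule ext, subst partial_deriv_eqI[OF flat_exp_radial_has_derivative]) (simp add: inner_axis)
  have A: "smooth_algebra a r
     (\<lambda>x. (flat_exp (k + 2) (r - (x - a) \<bullet> (x - a)) + (- of_nat k) * flat_exp (k + 1) (r - (x - a) \<bullet> (x - a)))
        * ((- 2) * (x $ i + - a $ i)))" for i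
    by (intro smooth_algebra.const smooth_algebra.flat smooth_algebra.coord
        smooth_algebra.mult smooth_algebra.add)
  have B: "(\<lambda>x. flat_exp k (r - (x - a) \<bullet> (x - a))) differentiable (at x)" for x
    by (rule differentiableI[OF flat_exp_radial_has_derivative])
  show ?case
  proof (intro conjI allI)
    show "smooth_algebra a r (partial_deriv i (\<lambda>x. flat_exp k (r - (x - a) \<bullet> (x - a))))" for i
      unfolding eq by (rule A)
  qed (rule B)
next
  case (add u v)
  have d: "((\<lambda>x. u x + v x) has_derivative (\<lambda>h. grad u x \<bullet> h + grad v x \<bullet> h)) (at x)" for x
    using add by (intro has_derivative_add has_derivative_grad) auto
  have "partial_deriv i (\<lambda>x. u x + v x) = (\<lambda>x. partial_deriv i u x + partial_deriv i v x)" for i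
    using partial_deriv_eqI[OF d, of i] by (auto simp: inner_axis partial_deriv_conv_grad)
  then show ?case using add d by (auto intro: smooth_algebra.add differentiableI)
next
  case (mult u v)
  have d: "((\<lambda>x. u x * v x) has_derivative (\<lambda>h. u x * (grad v x \<bullet> h) + grad u x \<bullet> h * v x)) (at x)" for x
    using mult by (intro has_derivative_mult has_derivative_grad) auto
  have "partial_deriv i (\<lambda>x. u x * v x) = (\<lambda>x. u x * partial_deriv i v x + partial_deriv i u x * v x)" for i
    using partial_deriv_eqI[OF d, of i] by (auto simp: inner_axis partial_deriv_conv_grad)
  moreover have "smooth_algebra a r (\<lambda>x. u x * partial_deriv i v x + partial_deriv i u x * v x)" for i
    using mult by (intro smooth_algebra.add smooth_algebra.mult) auto
  ultimately show ?case
    using d by (auto intro: differentiableI)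
qed

lemma smooth_algebra_imp_smooth: "smooth_algebra a r u \<Longrightarrow> smooth u"
  by (rule smooth_coinduct[of _ "Collect (smooth_algebra a r)"])
    (auto simp: differentiable_on_def smooth_algebra_differentiable_partial_deriv
      intro: differentiable_at_withinI)

lemma smooth_const: "smooth (\<lambda>x. c)"
  by (rule smooth_algebra_imp_smooth[OF smooth_algebra.const])

lemma smooth_add: "smooth u \<Longrightarrow> smooth v \<Longrightarrow> smooth (\<lambda>x. u x + v x)"
  by (rule smooth_algebra_imp_smooth) (intro smooth_algebra.add smooth_algebra.smooth)

lemma smooth_mult: "smooth u \<Longrightarrow> smooth v \<Longrightarrow> smooth (\<lambda>x. u x * v x)"
  by (rule smooth_algebra_imp_smooth) (intro smooth_algebra.mult smooth_algebra.smooth)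

lemma smooth_power: "smooth u \<Longrightarrow> smooth (\<lambda>x. u x ^ k)"
  by (induction k) (auto intro: smooth_const smooth_mult)

lemma smooth_sum: "(\<And>i. i \<in> I \<Longrightarrow> smooth (u i)) \<Longrightarrow> smooth (\<lambda>x. \<Sum>i\<in>I. u i x)"
  by (induction I rule: infinite_finite_induct) (auto intro: smooth_const smooth_add)

section \<open>Test functions: linear structure, supports and cutoffs\<close>

lemma test_functions_smooth: "u \<in> test_functions \<Omega> \<Longrightarrow> smooth u"
  by (simp add: test_functions_def)

lemma test_functionsI:
  assumes "smooth u" "{x. u x \<noteq> 0} \<subseteq> K" "compact K" "K \<subseteq> \<Omega>"
  shows "u \<in> test_functions \<Omega>"
proof -
  have "closure {x. u x \<noteq> 0} \<subseteq> K"
    using assms by (intro closure_minimal compact_imp_closed)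
  then show ?thesis
    using assms compact_Int_closed[OF \<open>compact K\<close> closed_closure[of "{x. u x \<noteq> 0}"]]
    by (auto simp: test_functions_def Int_absorb1)
qed

lemma mem_closure_support: "u x \<noteq> 0 \<Longrightarrow> x \<in> closure {x. u x \<noteq> 0}"
  by (rule subsetD[OF closure_subset]) simp

lemma test_functions_lincomb:
  assumes "u \<in> test_functions \<Omega>" "v \<in> test_functions \<Omega>"
  shows "(\<lambda>x. a * u x + b * v x) \<in> test_functions \<Omega>"
proof (rule test_functionsI)
  show "smooth (\<lambda>x. a * u x + b * v x)"
    using assms by (intro smooth_add smooth_mult smooth_const test_functions_smooth)
  show "{x. a * u x + b * v x \<noteq> 0} \<subseteq> closure {x. u x \<noteq> 0} \<union> closure {x. v x \<noteq> 0}"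
  proof
    fix x assume "x \<in> {x. a * u x + b * v x \<noteq> 0}"
    then have "u x \<noteq> 0 \<or> v x \<noteq> 0" by auto
    then show "x \<in> closure {x. u x \<noteq> 0} \<union> closure {x. v x \<noteq> 0}"
      using mem_closure_support[of u x] mem_closure_support[of v x] by blast
  qed
qed (use assms in \<open>auto simp: test_functions_def\<close>)

lemma test_functions_mult_smooth:
  assumes "u \<in> test_functions \<Omega>" "smooth v"
  shows "(\<lambda>x. u x * v x) \<in> test_functions \<Omega>"
proof (rule test_functionsI)
  show "smooth (\<lambda>x. u x * v x)"
    using assms test_functions_smooth by (intro smooth_mult) auto
  show "{x. u x * v x \<noteq> 0} \<subseteq> closure {x. u x \<noteq> 0}"
    using closure_subset[of "{x. u x \<noteq> 0}"] by auto
qed (use assms in \<open>auto simp: test_functions_def\<close>)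

lemma zero_test_function: "(\<lambda>x. 0) \<in> test_functions \<Omega>"
  by (rule test_functionsI[where K = "{}"]) (auto intro: smooth_const)

lemma grad_eq_0_outside_support:
  assumes "x \<notin> closure {x. u x \<noteq> 0}" shows "grad u x = 0"
proof -
  have "((\<lambda>x. 0) has_derivative (\<lambda>h. 0)) (at x)" by simp
  then have "(u has_derivative (\<lambda>h. 0)) (at x)"
    by (rule has_derivative_transform_within_open[where s = "- closure {x. u x \<noteq> 0}"])
      (use assms closure_subset[of "{x. u x \<noteq> 0}"] in \<open>auto simp: open_Compl\<close>)
  then show ?thesis by (intro grad_eqI) simp
qed

text \<open>A sum of bumps on finitely many balls covering \<open>K\<close>, each with closed ball
  inside \<Omega>. It has no plateau: positivity on the compact set \<open>K\<close> gives the lower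
  bound \<open>c\<close>, and multiplying by such a function loses only a constant.\<close>

lemma ex_cutoff:
  fixes \<Omega> :: "(real^'n::finite) set"
  assumes "open \<Omega>" "compact K" "K \<subseteq> \<Omega>"
  obtains \<psi> c where "\<psi> \<in> test_functions \<Omega>" "\<And>x. 0 \<le> \<psi> x" "\<And>x. \<psi> x \<le> 1"
    "0 < c" "\<And>x. x \<in> K \<Longrightarrow> c \<le> \<psi> x"
proof -
  have "\<forall>a\<in>K. \<exists>r>0. cball a r \<subseteq> \<Omega>"
    using assms open_contains_cball by blast
  then obtain r where r: "\<And>a. a \<in> K \<Longrightarrow> 0 < r a" "\<And>a. a \<in> K \<Longrightarrow> cball a (r a) \<subseteq> \<Omega>"
    by metis
  have "K \<subseteq> (\<Union>a\<in>K. ball a (r a))"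
    using r(1) by force
  then obtain D where D: "D \<subseteq> K" "finite D" "K \<subseteq> (\<Union>a\<in>D. ball a (r a))"
    using compactE_image[OF \<open>compact K\<close>, of K "\<lambda>a. ball a (r a)"] by auto
  define b where "b a x = flat_exp 0 ((r a)\<^sup>2 - (x - a) \<bullet> (x - a))" for a x :: "real^'n"
  have b01: "0 \<le> b a x" "b a x \<le> 1" for a x
    by (auto simp: b_def flat_exp_def)
  have bpos: "0 < b a x \<longleftrightarrow> x \<in> ball a (r a)" if "a \<in> K" for a x
  proof -
    have "(x - a) \<bullet> (x - a) < (r a)\<^sup>2 \<longleftrightarrow> norm (x - a) < r a"
      using r(1)[OF that] unfolding power2_norm_eq_inner[symmetric]
      by (smt (verit) norm_ge_zero power2_less_imp_less power_strict_mono zero_less_numeral)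
    then show ?thesis by (auto simp: b_def flat_exp_def dist_norm norm_minus_commute)
  qed
  have bsm: "smooth (b a)" for a
    unfolding b_def by (rule smooth_algebra_imp_smooth[OF smooth_algebra.flat])
  \<comment> \<open>Each bump is at most 1, so dividing by more than their number keeps the sum
    below 1; the added 1 also covers an empty cover.\<close>
  define \<psi> where "\<psi> x = (1 / (1 + real (card D))) * (\<Sum>a\<in>D. b a x)" for x
  have sm: "smooth \<psi>"
    unfolding \<psi>_def by (intro smooth_mult smooth_const smooth_sum bsm)
  have nn: "0 \<le> \<psi> x" for x
    unfolding \<psi>_def by (intro mult_nonneg_nonneg sum_nonneg b01) auto
  have le: "\<psi> x \<le> 1" for x
  proof -
    have "(\<Sum>a\<in>D. b a x) \<le> real (card D)"
      using sum_mono[of D "\<lambda>a. b a x" "\<lambda>_. 1"] b01 by simp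
    then show ?thesis by (simp add: \<psi>_def field_simps)
  qed
  have pos: "0 < \<psi> x" if x: "x \<in> K" for x
  proof -
    obtain a where "a \<in> D" "x \<in> ball a (r a)" using D x by blast
    then have "0 < (\<Sum>a\<in>D. b a x)"
      using D bpos b01 by (intro sum_pos2[of D a]) auto
    then show ?thesis by (simp add: \<psi>_def)
  qed
  have "\<psi> \<in> test_functions \<Omega>"
  proof (rule test_functionsI[OF sm])
    show "{x. \<psi> x \<noteq> 0} \<subseteq> (\<Union>a\<in>D. cball a (r a))"
    proof clarify
      fix x assume "\<psi> x \<noteq> 0"
      then have "(\<Sum>a\<in>D. b a x) \<noteq> 0"
        by (simp add: \<psi>_def)
      then obtain a where a: "a \<in> D" "b a x \<noteq> 0"
        by (meson sum.neutral)
      then have "0 < b a x" using b01(1)[of a x] by simp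
      then have "x \<in> ball a (r a)" using bpos a D by blast
      then show "x \<in> (\<Union>a\<in>D. cball a (r a))"
        using a ball_subset_cball by blast
    qed
    show "(\<Union>a\<in>D. cball a (r a)) \<subseteq> \<Omega>"
      using D(1) r(2) by blast
  qed (use D in \<open>auto intro!: compact_UN\<close>)
  moreover obtain c where "0 < c" "\<And>x. x \<in> K \<Longrightarrow> c \<le> \<psi> x"
  proof (cases "K = {}")
    case False
    then obtain z where "z \<in> K" "\<And>x. x \<in> K \<Longrightarrow> \<psi> z \<le> \<psi> x"
      using continuous_attains_inf[OF \<open>compact K\<close> _ smooth_imp_continuous_on[OF sm]] by blast
    then show ?thesis using that[of "\<psi> z"] pos by blast
  qed (use that[of 1] in auto)
  ultimately show ?thesis using that nn le by blast
qed

lemma test_function_grad_bounded: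
  assumes "u \<in> test_functions \<Omega>"
  obtains B where "\<And>x. norm (grad u x) \<le> B"
proof -
  have "compact (grad u ` closure {x. u x \<noteq> 0})"
    using assms by (intro compact_continuous_image continuous_on_grad) (auto simp: test_functions_def)
  then obtain B where B: "\<And>x. x \<in> closure {x. u x \<noteq> 0} \<Longrightarrow> norm (grad u x) \<le> B"
    by (meson bounded_iff compact_imp_bounded imageI)
  have "norm (grad u x) \<le> max 0 B" for x
    using B[of x] grad_eq_0_outside_support[of x u] by (cases "x \<in> closure {x. u x \<noteq> 0}") auto
  then show ?thesis using that by blast
qed

text \<open>Taking a high power \<open>\<eta> = \<psi>\<^sup>k\<close> of a cutoff function makes \<open>|\<nabla>\<eta>|\<^sup>p \<le> B \<eta>\<^sup>p\<^sup>-\<^sup>1\<close>; here \<open>e\<close> is the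
  logarithmic gradient of \<open>\<eta>\<close>.\<close>

lemma ex_power_cutoff:
  fixes \<Omega> :: "(real^'n::finite) set"
  assumes "open \<Omega>" "compact K" "K \<subseteq> \<Omega>" "1 \<le> p"
  obtains \<eta> c B e where "\<eta> \<in> test_functions \<Omega>" "\<And>x. 0 \<le> \<eta> x" "\<And>x. \<eta> x \<le> 1"
    "0 < c" "\<And>x. x \<in> K \<Longrightarrow> c \<le> \<eta> x"
    "0 \<le> B" "\<And>x. grad \<eta> x = \<eta> x *\<^sub>R e x" "\<And>x. \<eta> x * norm (e x) powr p \<le> B"
proof -
  obtain \<psi> c where \<psi>: "\<psi> \<in> test_functions \<Omega>" "\<And>x. 0 \<le> \<psi> x" "\<And>x. \<psi> x \<le> 1"
    "0 < c" "\<And>x. x \<in> K \<Longrightarrow> c \<le> \<psi> x"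
    using ex_cutoff[OF assms(1-3)] by blast
  obtain G where G: "\<And>x. norm (grad \<psi> x) \<le> G"
    using test_function_grad_bounded[OF \<psi>(1)] by blast
  \<comment> \<open>With k \<ge> 2 the gradient of \<psi>^k vanishes wherever \<psi> does, and with
    k \<ge> p the leftover power \<psi>^(k-p) is at most 1.\<close>
  obtain k where k: "2 \<le> k" "p \<le> real k"
    by (metis add.commute le_add2 linorder_le_cases of_nat_mono order_trans real_arch_simple)
  have sm: "smooth \<psi>" by (rule test_functions_smooth[OF \<psi>(1)])
  have k1: "k = Suc (k - 1)" using k by simp
  define \<eta> where "\<eta> x = \<psi> x ^ k" for x
  \<comment> \<open>Where \<psi> vanishes, division by zero makes \<open>e\<close> zero; the
    factorization of the gradient of \<eta> survives there because both sides are 0.\<close>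
  define e where "e x = (real k / \<psi> x) *\<^sub>R grad \<psi> x" for x
  have "(\<lambda>x. \<psi> x * \<psi> x ^ (k - 1)) \<in> test_functions \<Omega>"
    by (intro test_functions_mult_smooth[OF \<psi>(1)] smooth_power sm)
  then have tf: "\<eta> \<in> test_functions \<Omega>"
    unfolding \<eta>_def by (subst k1) simp
  have gr: "grad \<eta> x = \<eta> x *\<^sub>R e x" for x
  proof -
    have "grad \<eta> x = (real k * \<psi> x ^ (k - 1)) *\<^sub>R grad \<psi> x"
      unfolding \<eta>_def by (rule grad_power[OF sm])
    also have "\<dots> = \<eta> x *\<^sub>R e x"
      using k by (cases "\<psi> x = 0") (auto simp: \<eta>_def e_def power_eq_if mult.commute)
    finally show ?thesis .
  qed
  have bd: "\<eta> x * norm (e x) powr p \<le> (real k * G) powr p" for x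
  proof (cases "\<psi> x = 0")
    case False
    then have pos: "0 < \<psi> x" using \<psi>(2)[of x] by simp
    have "\<eta> x * norm (e x) powr p = \<psi> x powr real k * (real k * norm (grad \<psi> x) / \<psi> x) powr p"
      using pos by (simp add: \<eta>_def e_def powr_realpow)
    also have "\<dots> = \<psi> x powr (real k - p) * (real k * norm (grad \<psi> x)) powr p"
      using pos by (simp add: powr_divide powr_diff)
    also have "\<dots> \<le> 1 * (real k * G) powr p"
      using pos \<psi>(3)[of x] k G[of x] assms(4)
      by (intro mult_mono powr_le1 powr_mono2 mult_left_mono) auto
    finally show ?thesis by simp
  qed (use k in \<open>simp add: \<eta>_def e_def\<close>)
  show ?thesis
  proof (rule that[of \<eta> "c ^ k" "(real k * G) powr p" e])
    show "0 \<le> \<eta> x" "\<eta> x \<le> 1" for x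
      using \<psi>(2,3)[of x] by (auto simp: \<eta>_def power_le_one)
    show "c ^ k \<le> \<eta> x" if "x \<in> K" for x
      using \<psi>(4,5) that by (auto simp: \<eta>_def intro: power_mono)
    show "0 < c ^ k" using \<psi>(4) by simp
    show "0 \<le> (real k * G) powr p" by simp
  qed (fact tf gr bd)+
qed

section \<open>Translation estimates\<close>

lemma integrable_continuous_compact_support:
  fixes F :: "'a::euclidean_space \<Rightarrow> 'b::{banach, second_countable_topology}"
  assumes "continuous_on UNIV F" "compact K" "\<And>x. x \<notin> K \<Longrightarrow> F x = 0"
  shows "integrable lborel F"
proof -
  have "F = (\<lambda>x. indicator K x *\<^sub>R F x)"
    using assms(3) by (auto simp: fun_eq_iff indicator_def)
  then show ?thesis
    using borel_integrable_compact[OF assms(2) continuous_on_subset[OF assms(1) subset_UNIV]] by metis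
qed

lemma integrable_indicator_continuous:
  fixes F :: "'a::euclidean_space \<Rightarrow> real"
  assumes "continuous_on UNIV F" "Q \<in> sets borel" "bounded Q"
  shows "integrable lborel (\<lambda>x. indicator Q x * F x)"
proof -
  obtain a where a: "Q \<subseteq> cbox (- a) a"
    using bounded_subset_cbox_symmetric[OF assms(3)] by blast
  have "integrable lborel (\<lambda>x. indicator (cbox (- a) a) x *\<^sub>R F x)"
    by (rule borel_integrable_compact) (auto intro: continuous_on_subset[OF assms(1)])
  then have "integrable lborel (\<lambda>x. indicator Q x *\<^sub>R (indicator (cbox (- a) a) x *\<^sub>R F x))"
    by (rule integrable_mult_indicator[rotated]) (use assms(2) in simp)
  moreover have "indicator Q x *\<^sub>R (indicator (cbox (- a) a) x *\<^sub>R F x) = indicator Q x * F x" for x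
    using a by (auto simp: indicator_def)
  ultimately show ?thesis by (simp only:)
qed

lemma lborel_integral_translation:
  fixes F :: "'a::euclidean_space \<Rightarrow> 'b::{banach, second_countable_topology}"
  assumes "F \<in> borel_measurable borel"
  shows "(\<integral>x. F (x + c) \<partial>lborel) = (\<integral>x. F x \<partial>lborel)"
  using integral_distr[of "(+) c" lborel borel F] assms
  by (simp add: lborel_distr_plus add.commute)

lemma nn_integral_lborel_translation:
  fixes F :: "'a::euclidean_space \<Rightarrow> ennreal"
  assumes "F \<in> borel_measurable borel"
  shows "(\<integral>\<^sup>+x. F (c + x) \<partial>lborel) = (\<integral>\<^sup>+x. F x \<partial>lborel)"
  using nn_integral_distr[of "(+) c" lborel borel F] assms
  by (simp add: lborel_distr_plus)

lemma compact_superset_closure_support: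
  fixes u :: "real^'n::finite \<Rightarrow> real"
  assumes "compact K" "\<And>x. x \<notin> K \<Longrightarrow> u x = 0"
  shows "closure {x. u x \<noteq> 0} \<subseteq> K"
  by (rule closure_minimal[OF _ compact_imp_closed[OF assms(1)]]) (use assms(2) in auto)

lemma compact_support_grad_eq_0:
  assumes "compact K" "\<And>x. x \<notin> K \<Longrightarrow> u x = 0" "x \<notin> K"
  shows "grad u x = 0"
proof -
  have "closure {x. u x \<noteq> 0} \<subseteq> K"
    by (rule compact_superset_closure_support[OF assms(1)]) (rule assms(2))
  then show ?thesis using assms(3) by (intro grad_eq_0_outside_support) blast
qed

lemma compact_support_grad_bounded:
  assumes "smooth u" "compact K" "\<And>x. x \<notin> K \<Longrightarrow> u x = 0"
  obtains B where "0 \<le> B" "\<And>x. norm (grad u x) \<le> B"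
proof -
  have "u \<in> test_functions UNIV"
    using assms by (intro test_functionsI[where K = K]) auto
  then obtain B where B: "\<And>x. norm (grad u x) \<le> B"
    using test_function_grad_bounded by blast
  moreover have "0 \<le> B" using B[of 0] norm_ge_zero order_trans by blast
  ultimately show ?thesis using that by blast
qed

lemma dyadic_quotient_tendsto:
  assumes "smooth w"
  shows "(\<lambda>n. 2 ^ n * (w (x + (1 / 2 ^ n) *\<^sub>R h) - w x)) \<longlonglongrightarrow> grad w x \<bullet> h"
proof -
  have d1: "((\<lambda>t. x + t *\<^sub>R h) has_derivative (\<lambda>t. t *\<^sub>R h)) (at 0)"
    by (auto intro!: derivative_eq_intros)
  have d2: "(w has_derivative (\<lambda>y. grad w x \<bullet> y)) (at (x + 0 *\<^sub>R h))"
    using smooth_has_derivative[OF assms, of x] by simp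
  have "((\<lambda>t. w (x + t *\<^sub>R h)) has_derivative (\<lambda>t. grad w x \<bullet> (t *\<^sub>R h))) (at 0)"
    by (rule has_derivative_compose[OF d1 d2])
  then have "((\<lambda>t. w (x + t *\<^sub>R h)) has_real_derivative grad w x \<bullet> h) (at 0)"
    unfolding has_field_derivative_def by (rule has_derivative_eq_rhs) auto
  then have lim: "((\<lambda>t. (w (x + t *\<^sub>R h) - w x) / t) \<longlongrightarrow> grad w x \<bullet> h) (at 0)"
    by (simp add: DERIV_def)
  have "(\<lambda>n. 1 / 2 ^ n :: real) \<longlonglongrightarrow> 0"
    using LIMSEQ_realpow_zero[of "1/2"] by (simp add: power_divide)
  then have "filterlim (\<lambda>n. 1 / 2 ^ n :: real) (at 0) sequentially"
    by (simp add: filterlim_at)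
  from filterlim_compose[OF lim this] show ?thesis
    by (simp add: mult.commute)
qed

text \<open>The mean value inequality gives the Lipschitz bound, with one compact support for all
  \<open>n\<close>. It is the majorant for letting the step size tend to 0 under the
  integral.\<close>

lemma dyadic_quotient_bounded:
  fixes w :: "real^'n::finite \<Rightarrow> real"
  assumes "smooth w" "compact K" "\<And>x. x \<notin> K \<Longrightarrow> w x = 0"
  obtains B K' where "compact K'" "0 \<le> B"
    "\<And>n x. \<bar>2 ^ n * (w (x + (1 / 2 ^ n) *\<^sub>R h) - w x)\<bar> \<le> B * indicator K' x"
proof -
  obtain B where B: "0 \<le> B" "\<And>x. norm (grad w x) \<le> B"
    using compact_support_grad_bounded[OF assms] by blast
  \<comment> \<open>A shift by h / 2^n moves a point by at most |h|, so this thickening of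
    \<open>K\<close> contains the supports of all quotients.\<close>
  define K' where "K' = {x - y |x y. x \<in> K \<and> y \<in> cball 0 (norm h)}"
  have K': "compact K'"
    unfolding K'_def by (intro compact_differences assms compact_cball)
  have bd: "\<bar>2 ^ n * (w (x + (1 / 2 ^ n) *\<^sub>R h) - w x)\<bar> \<le> B * norm h * indicator K' x" for n x
  proof (cases "x \<in> K'")
    case True
    have "norm (w (x + (1 / 2 ^ n) *\<^sub>R h) - w x) \<le> B * norm (x + (1 / 2 ^ n) *\<^sub>R h - x)"
    proof (rule differentiable_bound[OF convex_UNIV])
      show "(w has_derivative (\<lambda>y. grad w x \<bullet> y)) (at x within UNIV)" for x
        using smooth_has_derivative[OF assms(1)] by simp
      show "onorm (\<lambda>y. grad w x \<bullet> y) \<le> B" for x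
      proof (rule onorm_le)
        show "norm (grad w x \<bullet> y) \<le> B * norm y" for y
          using Cauchy_Schwarz_ineq2[of "grad w x" y] mult_right_mono[OF B(2)[of x] norm_ge_zero[of y]]
          by simp
      qed
    qed auto
    then have "\<bar>w (x + (1 / 2 ^ n) *\<^sub>R h) - w x\<bar> \<le> B * (norm h / 2 ^ n)" by simp
    then have "2 ^ n * \<bar>w (x + (1 / 2 ^ n) *\<^sub>R h) - w x\<bar> \<le> 2 ^ n * (B * (norm h / 2 ^ n))"
      by (intro mult_left_mono) auto
    then show ?thesis using True by (simp add: abs_mult)
  next
    case False
    have "x + (1 / 2 ^ n) *\<^sub>R h \<notin> K"
    proof
      assume "x + (1 / 2 ^ n) *\<^sub>R h \<in> K"
      moreover have "(1 / 2 ^ n) *\<^sub>R h \<in> cball 0 (norm h)"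
        by (simp add: divide_le_eq mult_left_mono[of 1 "2 ^ n" "norm h", simplified])
      moreover have "x = (x + (1 / 2 ^ n) *\<^sub>R h) - (1 / 2 ^ n) *\<^sub>R h" by simp
      ultimately show False using False unfolding K'_def by blast
    qed
    moreover have "x \<notin> K"
    proof
      assume "x \<in> K"
      moreover have "(0 :: real^'n) \<in> cball 0 (norm h)" "x = x - 0" by auto
      ultimately show False using False unfolding K'_def by blast
    qed
    ultimately show ?thesis using assms(3) False by simp
  qed
  show ?thesis
    by (rule that[OF K' _ bd]) (use B in simp)
qed

lemma continuous_on_translate:
  "continuous_on UNIV w \<Longrightarrow> continuous_on UNIV (\<lambda>x. w (x + c))"
  for w :: "'a::real_normed_vector \<Rightarrow> 'b::topological_space"
  by (rule continuous_on_compose2[of UNIV w]) (auto intro: continuous_intros)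

text \<open>By translation invariance every difference quotient has integral 0, and dominated
  convergence carries this to the derivative. Applied to a product it yields integration by
  parts.\<close>

lemma integral_partial_deriv_eq_0:
  fixes w :: "real^'n::finite \<Rightarrow> real"
  assumes "smooth w" "compact K" "\<And>x. x \<notin> K \<Longrightarrow> w x = 0"
  shows "(\<integral>x. grad w x $ i \<partial>lborel) = 0"
proof -
  define h :: "real^'n" where "h = axis i 1"
  define s where "s n x = 2 ^ n * (w (x + (1 / 2 ^ n) *\<^sub>R h) - w x)" for n x
  obtain B K' where B: "compact K'" "0 \<le> B" "\<And>n x. \<bar>s n x\<bar> \<le> B * indicator K' x"
    by (rule dyadic_quotient_bounded[OF assms(1,2), where h = h]) (erule assms(3), rule that, simp_all only: s_def)
  have cw: "continuous_on UNIV w" by (rule smooth_imp_continuous_on[OF assms(1)])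
  have iw: "integrable lborel w"
    by (rule integrable_continuous_compact_support[OF cw assms(2,3)])
  have s0: "(\<integral>x. s n x \<partial>lborel) = 0" for n
  proof -
    define c where "c = (1 / 2 ^ n) *\<^sub>R h"
    have ic: "integrable lborel (\<lambda>x. w (x + c))"
      using iw integrable_distr_eq[of "(+) c" lborel borel w]
      by (simp add: lborel_distr_plus add.commute borel_measurable_continuous_onI[OF cw])
    have "(\<integral>x. s n x \<partial>lborel) = 2 ^ n * ((\<integral>x. w (x + c) \<partial>lborel) - (\<integral>x. w x \<partial>lborel))"
      unfolding s_def c_def[symmetric] by (simp only: integral_mult_right_zero Bochner_Integration.integral_diff[OF ic iw])
    then show ?thesis
      using lborel_integral_translation[OF borel_measurable_continuous_onI[OF cw], of c] by simp
  qed
  have "(\<lambda>n. \<integral>x. s n x \<partial>lborel) \<longlonglongrightarrow> (\<integral>x. grad w x \<bullet> h \<partial>lborel)"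
  proof (rule integral_dominated_convergence)
    show "integrable lborel (\<lambda>x. B * indicator K' x)"
      using integrable_indicator_continuous[of "\<lambda>_. 1" K'] B(1)
      by (simp add: compact_imp_bounded borel_compact)
    show "(\<lambda>x. grad w x \<bullet> h) \<in> borel_measurable lborel"
      using borel_measurable_continuous_onI[OF continuous_on_inner[OF continuous_on_grad[OF assms(1)] continuous_on_const]]
      by simp
    show "s n \<in> borel_measurable lborel" for n
    proof -
      have "continuous_on UNIV (s n)"
        unfolding s_def by (intro continuous_on_mult continuous_on_const continuous_on_diff continuous_on_translate cw)
      then show ?thesis by (simp add: borel_measurable_continuous_onI)
    qed
    show "AE x in lborel. (\<lambda>n. s n x) \<longlonglongrightarrow> grad w x \<bullet> h"
      unfolding s_def using dyadic_quotient_tendsto[OF assms(1)] by simp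
    show "AE x in lborel. norm (s n x) \<le> B * indicator K' x" for n
      using B(3) by simp
  qed
  then have "(\<integral>x. grad w x \<bullet> h \<partial>lborel) = 0"
    unfolding s0 by (rule LIMSEQ_unique) (rule tendsto_const)
  then show ?thesis by (simp add: h_def inner_axis)
qed

lemma continuous_on_norm_powr:
  assumes "continuous_on S F" "0 < p"
  shows "continuous_on S (\<lambda>x. norm (F x) powr p)"
  using assms by (intro continuous_on_powr' continuous_intros) auto

text \<open>Halving \<open>h\<close> costs at most a factor \<open>2\<^sup>p\<close>, and the rescaled differences converge to the
  directional derivative.\<close>

lemma integral_translate_diff_powr_le:
  fixes w :: "real^'n::finite \<Rightarrow> real"
  assumes "smooth w" "compact K" "\<And>x. x \<notin> K \<Longrightarrow> w x = 0" "1 < p"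
  shows "(\<integral>x. \<bar>w (x + h) - w x\<bar> powr p \<partial>lborel) \<le> norm h powr p * (\<integral>x. norm (grad w x) powr p \<partial>lborel)"
proof -
  define G where "G h = (\<integral>x. \<bar>w (x + h) - w x\<bar> powr p \<partial>lborel)" for h
  have cw: "continuous_on UNIV w" by (rule smooth_imp_continuous_on[OF assms(1)])
  have cG: "continuous_on UNIV (\<lambda>x. \<bar>w (x + a) - w (x + b)\<bar> powr p)" for a b
    using assms(4) continuous_on_norm_powr[of UNIV "\<lambda>x. w (x + a) - w (x + b)" p]
    by (simp add: continuous_on_diff continuous_on_translate cw)
  have iG: "integrable lborel (\<lambda>x. \<bar>w (x + a) - w (x + b)\<bar> powr p)" for a b
  proof (rule integrable_continuous_compact_support[OF cG])
    show "compact ((\<lambda>x. x - a) ` K \<union> (\<lambda>x. x - b) ` K)"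
      using assms(2) by (intro compact_Un compact_continuous_image continuous_intros)
    fix x assume "x \<notin> (\<lambda>x. x - a) ` K \<union> (\<lambda>x. x - b) ` K"
    then have "x + a \<notin> K" "x + b \<notin> K"
      using image_eqI[of x "\<lambda>x. x - a" "x + a" K] image_eqI[of x "\<lambda>x. x - b" "x + b" K] by auto
    then show "\<bar>w (x + a) - w (x + b)\<bar> powr p = 0" using assms(3) by simp
  qed
  have half: "G h \<le> 2 powr p * G ((1/2) *\<^sub>R h)" for h
  proof -
    define k where "k = (1/2) *\<^sub>R h"
    have h: "h = k + k" by (simp add: k_def flip: scaleR_2)
    \<comment> \<open>The increment is split at x + k and midpoint convexity gives the factor 2^p /
      2. The two halves have equal integrals by translation invariance, which restores 2^p.\<close>
    have "G h \<le> (\<integral>x. 2 powr p / 2 * (\<bar>w (x + (k + k)) - w (x + k)\<bar> powr p + \<bar>w (x + k) - w (x + 0)\<bar> powr p) \<partial>lborel)"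
      unfolding G_def h
    proof (rule integral_mono)
      show "integrable lborel (\<lambda>x. \<bar>w (x + (k + k)) - w x\<bar> powr p)"
        using iG[of "k + k" 0] by simp
      fix x
      define a where "a = w (x + (k + k)) - w (x + k)"
      define b where "b = w (x + k) - w x"
      have "norm ((1/2) *\<^sub>R (a + b)) powr p \<le> (norm a powr p + norm b powr p) / 2"
        using powr_gap_nonneg[of p a b] assms(4) by (simp only: powr_gap_def) linarith
      moreover have "norm (a + b) powr p = 2 powr p * norm ((1/2) *\<^sub>R (a + b)) powr p"
        by (simp add: powr_divide)
      ultimately have "norm (a + b) powr p \<le> 2 powr p * ((norm a powr p + norm b powr p) / 2)"
        by (metis mult_left_mono powr_ge_zero)
      then show "\<bar>w (x + (k + k)) - w x\<bar> powr p \<le> 2 powr p / 2 *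
          (\<bar>w (x + (k + k)) - w (x + k)\<bar> powr p + \<bar>w (x + k) - w (x + 0)\<bar> powr p)"
        by (simp add: a_def b_def)
    qed (intro integrable_mult_right Bochner_Integration.integrable_add iG)
    also have "\<dots> = 2 powr p / 2 * ((\<integral>x. \<bar>w (x + (k + k)) - w (x + k)\<bar> powr p \<partial>lborel)
        + (\<integral>x. \<bar>w (x + k) - w (x + 0)\<bar> powr p \<partial>lborel))"
      by (subst integral_mult_right_zero, subst Bochner_Integration.integral_add[OF iG iG]) simp
    also have "(\<integral>x. \<bar>w (x + (k + k)) - w (x + k)\<bar> powr p \<partial>lborel) = G k"
    proof -
      have "(\<lambda>x. \<bar>w (x + k) - w x\<bar> powr p) \<in> borel_measurable borel"
        using borel_measurable_continuous_onI[OF cG[of k 0]] by simp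
      from lborel_integral_translation[OF this, of k] show ?thesis
        by (simp add: G_def add.assoc)
    qed
    finally show ?thesis by (simp add: G_def k_def)
  qed
  define s where "s n x = 2 ^ n * (w (x + (1 / 2 ^ n) *\<^sub>R h) - w x)" for n x
  have iter: "G h \<le> (\<integral>x. \<bar>s n x\<bar> powr p \<partial>lborel)" for n
  proof -
    have "G h \<le> (2 powr p) ^ n * G ((1 / 2 ^ n) *\<^sub>R h)"
    proof (induction n)
      case (Suc n)
      have "(2 powr p) ^ n * G ((1 / 2 ^ n) *\<^sub>R h) \<le> (2 powr p) ^ n * (2 powr p * G ((1/2) *\<^sub>R ((1 / 2 ^ n) *\<^sub>R h)))"
        by (intro mult_left_mono half) auto
      also have "\<dots> = (2 powr p) ^ Suc n * G ((1 / 2 ^ Suc n) *\<^sub>R h)"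
        by simp
      finally show ?case using Suc by linarith
    qed simp
    also have "(2 powr p) ^ n = (2 ^ n) powr p"
      by (induction n) (auto simp: powr_mult)
    finally show ?thesis
      by (simp add: G_def s_def abs_mult powr_mult flip: integral_mult_right_zero)
  qed
  obtain B K' where B: "compact K'" "0 \<le> B" "\<And>n x. \<bar>s n x\<bar> \<le> B * indicator K' x"
    by (rule dyadic_quotient_bounded[OF assms(1,2), where h = h]) (erule assms(3), rule that, simp_all only: s_def)
  have "(\<lambda>n. \<integral>x. \<bar>s n x\<bar> powr p \<partial>lborel) \<longlonglongrightarrow> (\<integral>x. \<bar>grad w x \<bullet> h\<bar> powr p \<partial>lborel)"
  proof (rule integral_dominated_convergence)
    show "integrable lborel (\<lambda>x. B powr p * indicator K' x)"
      using integrable_indicator_continuous[of "\<lambda>_. 1" K'] B(1)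
      by (simp add: compact_imp_bounded borel_compact)
    show "(\<lambda>x. \<bar>grad w x \<bullet> h\<bar> powr p) \<in> borel_measurable lborel"
      using assms(4) continuous_on_norm_powr[of UNIV "\<lambda>x. grad w x \<bullet> h" p]
      by (simp add: borel_measurable_continuous_onI continuous_on_inner continuous_on_grad assms(1))
    show "(\<lambda>x. \<bar>s n x\<bar> powr p) \<in> borel_measurable lborel" for n
    proof -
      have "continuous_on UNIV (s n)"
        unfolding s_def by (intro continuous_on_mult continuous_on_const continuous_on_diff continuous_on_translate cw)
      then show ?thesis
        using assms(4) continuous_on_norm_powr[of UNIV "s n" p] by (simp add: borel_measurable_continuous_onI)
    qed
    have "(\<lambda>n. \<bar>s n x\<bar> powr p) \<longlonglongrightarrow> \<bar>grad w x \<bullet> h\<bar> powr p" for x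
      unfolding s_def using assms(4)
      by (intro tendsto_powr' tendsto_rabs dyadic_quotient_tendsto[OF assms(1)] tendsto_const) auto
    then show "AE x in lborel. (\<lambda>n. \<bar>s n x\<bar> powr p) \<longlonglongrightarrow> \<bar>grad w x \<bullet> h\<bar> powr p" by simp
    have "norm (\<bar>s n x\<bar> powr p) \<le> B powr p * indicator K' x" for n x
      using powr_mono2[of p "\<bar>s n x\<bar>" "B * indicator K' x"] B(3)[of n x] assms(4)
      by (cases "x \<in> K'") auto
    then show "AE x in lborel. norm (\<bar>s n x\<bar> powr p) \<le> B powr p * indicator K' x" for n by simp
  qed
  then have "G h \<le> (\<integral>x. \<bar>grad w x \<bullet> h\<bar> powr p \<partial>lborel)"
    by (rule LIMSEQ_le_const) (use iter in blast)
  also have "\<dots> \<le> (\<integral>x. norm h powr p * norm (grad w x) powr p \<partial>lborel)"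
  proof (rule integral_mono)
    have g0: "grad w x = 0" if "x \<notin> K" for x
      by (rule compact_support_grad_eq_0[OF assms(2) _ that]) (rule assms(3))
    show "integrable lborel (\<lambda>x. \<bar>grad w x \<bullet> h\<bar> powr p)"
      using continuous_on_norm_powr[of UNIV "\<lambda>x. grad w x \<bullet> h" p] assms(1,4) g0
      by (intro integrable_continuous_compact_support[OF _ assms(2)])
        (auto simp: continuous_on_inner continuous_on_grad)
    have "integrable lborel (\<lambda>x. norm (grad w x) powr p)"
      using g0 assms
      by (intro integrable_continuous_compact_support[OF continuous_on_norm_powr assms(2)])
        (auto simp: continuous_on_grad)
    then show "integrable lborel (\<lambda>x. norm h powr p * norm (grad w x) powr p)" by simp
    fix x
    have "\<bar>grad w x \<bullet> h\<bar> powr p \<le> (norm h * norm (grad w x)) powr p"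
      using Cauchy_Schwarz_ineq2[of "grad w x" h] assms(4) by (intro powr_mono2) (auto simp: mult.commute)
    then show "\<bar>grad w x \<bullet> h\<bar> powr p \<le> norm h powr p * norm (grad w x) powr p"
      by (simp add: powr_mult)
  qed
  finally show ?thesis by (simp add: G_def)
qed

section \<open>Means over the cells of a cubic grid\<close>

text \<open>Integrate over \<open>Q\<close> the tangent inequality taken at the mean
  \<open>A\<close> of \<open>g\<close>; the linear term then cancels.\<close>

lemma jensen_powr_indicator:
  fixes g :: "'a \<Rightarrow> real"
  assumes "1 < p" "Q \<in> sets M" "emeasure M Q < \<infinity>" "0 < measure M Q" "\<And>y. 0 \<le> g y"
    "integrable M (\<lambda>y. indicator Q y * g y)" "integrable M (\<lambda>y. indicator Q y * g y powr p)"
  shows "((\<integral>y. indicator Q y * g y \<partial>M) / measure M Q) powr p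
    \<le> (\<integral>y. indicator Q y * g y powr p \<partial>M) / measure M Q"
proof -
  define v where "v = measure M Q"
  define A where "A = (\<integral>y. indicator Q y * g y \<partial>M) / v"
  have v: "0 < v" using assms(4) by (simp add: v_def)
  have A: "0 \<le> A" unfolding A_def using v assms(5) by (intro divide_nonneg_pos integral_nonneg) auto
  have iQ: "integrable M (\<lambda>y. indicator Q y * c)" for c :: real
    using assms(2,3) by simp
  have "(\<integral>y. indicator Q y * (A powr p - p * A powr (p - 1) * A) + p * A powr (p - 1) * (indicator Q y * g y) \<partial>M)
      \<le> (\<integral>y. indicator Q y * g y powr p \<partial>M)"
  proof (rule integral_mono)
    show "integrable M (\<lambda>y. indicator Q y * (A powr p - p * A powr (p - 1) * A) + p * A powr (p - 1) * (indicator Q y * g y))"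
      by (intro Bochner_Integration.integrable_add iQ integrable_mult_right assms(6))
    fix y
    show "indicator Q y * (A powr p - p * A powr (p - 1) * A) + p * A powr (p - 1) * (indicator Q y * g y)
        \<le> indicator Q y * g y powr p"
      using powr_tangent_le[OF assms(1,5) A, of y] by (cases "y \<in> Q") (simp_all add: algebra_simps)
  qed (rule assms(7))
  also have "(\<integral>y. indicator Q y * (A powr p - p * A powr (p - 1) * A) + p * A powr (p - 1) * (indicator Q y * g y) \<partial>M)
      = v * (A powr p - p * A powr (p - 1) * A) + p * A powr (p - 1) * (\<integral>y. indicator Q y * g y \<partial>M)"
    by (subst Bochner_Integration.integral_add[OF iQ integrable_mult_right[OF assms(6)]])
      (use assms(2) in \<open>simp add: v_def sets.Int_space_eq2\<close>)
  also have "(\<integral>y. indicator Q y * g y \<partial>M) = A * v"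
    using v by (simp add: A_def)
  finally have "v * A powr p \<le> (\<integral>y. indicator Q y * g y powr p \<partial>M)"
    by (simp add: algebra_simps)
  then show ?thesis
    using v by (simp add: A_def v_def[symmetric] field_simps)
qed

text \<open>Half-open grid cubes of side \<epsilon> labelled by integer vectors. Each point lies in
  exactly one of them, namely the one labelled by its rounded coordinates, and there are countably
  many labels, which is what diagonal extraction needs.\<close>

definition cell :: "real \<Rightarrow> ('n::finite \<Rightarrow> int) \<Rightarrow> (real^'n) set" where
  "cell \<epsilon> k = {y. \<forall>i. \<lfloor>y $ i / \<epsilon>\<rfloor> = k i}"

lemma cell_bounds:
  fixes k :: "'n::finite \<Rightarrow> int" and \<epsilon> :: real
  assumes "0 < \<epsilon>"
  shows "box (\<chi> i. \<epsilon> * real_of_int (k i)) (\<chi> i. \<epsilon> * (real_of_int (k i) + 1)) \<subseteq> cell \<epsilon> k"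
    "cell \<epsilon> k \<subseteq> cbox (\<chi> i. \<epsilon> * real_of_int (k i)) (\<chi> i. \<epsilon> * (real_of_int (k i) + 1))"
proof -
  have eq: "\<lfloor>y / \<epsilon>\<rfloor> = m \<longleftrightarrow> \<epsilon> * real_of_int m \<le> y \<and> y < \<epsilon> * (real_of_int m + 1)" for y :: real and m :: int
    using assms by (simp add: floor_eq_iff field_simps)
  show "box (\<chi> i. \<epsilon> * real_of_int (k i)) (\<chi> i. \<epsilon> * (real_of_int (k i) + 1)) \<subseteq> cell \<epsilon> k"
    unfolding cell_def eq by (auto simp: mem_box_cart less_imp_le)
  show "cell \<epsilon> k \<subseteq> cbox (\<chi> i. \<epsilon> * real_of_int (k i)) (\<chi> i. \<epsilon> * (real_of_int (k i) + 1))"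
    unfolding cell_def eq by (auto simp: mem_box_cart less_imp_le)
qed

lemma cell_measurable: "cell \<epsilon> k \<in> sets borel"
  unfolding cell_def by measurable

lemma bounded_cell: "0 < \<epsilon> \<Longrightarrow> bounded (cell \<epsilon> k)"
  using bounded_subset[OF bounded_cbox cell_bounds(2)] .

text \<open>The cell lies between an open and a closed box with the same edges, so its faces do not
  affect the volume.\<close>

lemma emeasure_cell:
  fixes k :: "'n::finite \<Rightarrow> int" and \<epsilon> :: real
  assumes "0 < \<epsilon>"
  shows "emeasure lborel (cell \<epsilon> k) = ennreal (\<epsilon> ^ CARD('n))"
proof -
  let ?a = "\<chi> i. \<epsilon> * real_of_int (k i)" and ?b = "\<chi> i. \<epsilon> * (real_of_int (k i) + 1)"
  have le: "?a \<bullet> b \<le> ?b \<bullet> b" and eq: "(?b - ?a) \<bullet> b = \<epsilon>" if "b \<in> Basis" for b :: "real^'n"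
    using that assms by (auto simp: Basis_vec_def inner_axis algebra_simps)
  have "(\<Prod>b\<in>Basis. (?b - ?a) \<bullet> b) = (\<Prod>b\<in>(Basis :: (real^'n) set). \<epsilon>)"
    by (intro prod.cong refl eq)
  also have "\<dots> = \<epsilon> ^ CARD('n)" by simp
  finally have pr: "(\<Prod>b\<in>Basis. (?b - ?a) \<bullet> b) = \<epsilon> ^ CARD('n)" .
  have "emeasure lborel (cell \<epsilon> k) \<le> emeasure lborel (cbox ?a ?b)"
    by (intro emeasure_mono cell_bounds assms) auto
  moreover have "emeasure lborel (box ?a ?b) \<le> emeasure lborel (cell \<epsilon> k)"
    by (intro emeasure_mono cell_bounds assms) (simp add: cell_measurable)
  moreover have "emeasure lborel (cbox ?a ?b) = ennreal (\<epsilon> ^ CARD('n))"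
    "emeasure lborel (box ?a ?b) = ennreal (\<epsilon> ^ CARD('n))"
    by (subst emeasure_lborel_cbox emeasure_lborel_box, erule le, rule arg_cong[OF pr])+
  ultimately show ?thesis by simp
qed

text \<open>On a cell the function is compared with its mean; by Jensen's inequality the error is
  controlled by translation differences, hence by the gradient.\<close>

lemma integral_powr_le_cell_means:
  fixes d :: "real^'n::finite \<Rightarrow> real" and \<epsilon> \<delta> :: real
  assumes "smooth d" "compact K" "\<And>x. x \<notin> K \<Longrightarrow> d x = 0" "1 < p" "0 < \<epsilon>" "0 \<le> \<delta>"
    and means: "\<And>x. x \<in> K \<Longrightarrow>
      \<bar>\<integral>y. indicator (cell \<epsilon> (\<lambda>i. \<lfloor>x $ i / \<epsilon>\<rfloor>)) y * d y \<partial>lborel\<bar> \<le> \<delta> * \<epsilon> ^ CARD('n)"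
  shows "(\<integral>x. \<bar>d x\<bar> powr p \<partial>lborel) \<le> 2 powr p *
    (2 ^ CARD('n) * (CARD('n) * \<epsilon>) powr p * (\<integral>x. norm (grad d x) powr p \<partial>lborel) + \<delta> powr p * measure lborel K)"
proof -
  define v where "v = \<epsilon> ^ CARD('n)"
  \<comment> \<open>Two points of one cell differ by a vector in this cube. Its volume (2
    \<epsilon>)^N against the cell volume \<epsilon>^N is the origin of the factor
    \<open>2 ^ CARD('n)\<close>.\<close>
  define B :: "(real^'n) set" where "B = cbox (\<chi> i. - \<epsilon>) (\<chi> i. \<epsilon>)"
  define D where "D = (\<integral>x. norm (grad d x) powr p \<partial>lborel)"
  have v: "0 < v" using assms by (simp add: v_def)
  have D: "0 \<le> D" unfolding D_def by simp
  have nn: "ennreal a * ennreal b + ennreal c * ennreal e = ennreal (a * b + c * e)"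
    if "0 \<le> a" "0 \<le> b" "0 \<le> c" "0 \<le> e" for a b c e
    using that by (simp add: ennreal_mult)
  have cd: "continuous_on UNIV d" by (rule smooth_imp_continuous_on[OF assms(1)])
  have cdp: "continuous_on UNIV (\<lambda>y. \<bar>d y - c\<bar> powr p)" for c
    using continuous_on_norm_powr[of UNIV "\<lambda>y. d y - c" p] assms(4)
    by (simp add: continuous_on_diff cd)
  have Bm: "B \<in> sets borel" "bounded B" by (auto simp: B_def)
  have emB: "emeasure lborel B = ennreal ((2 * \<epsilon>) ^ CARD('n))"
  proof -
    have "emeasure lborel B = ennreal (\<Prod>b\<in>(Basis :: (real^'n) set). ((\<chi> i. \<epsilon>) - (\<chi> i. - \<epsilon>)) \<bullet> b)"
      unfolding B_def by (rule emeasure_lborel_cbox) (use assms in \<open>auto simp: Basis_vec_def inner_axis\<close>)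
    also have "(\<Prod>b\<in>(Basis :: (real^'n) set). ((\<chi> i. \<epsilon>) - (\<chi> i. - \<epsilon>)) \<bullet> b) = (\<Prod>b\<in>(Basis :: (real^'n) set). 2 * \<epsilon>)"
      by (intro prod.cong) (auto simp: Basis_vec_def inner_axis)
    finally show ?thesis by simp
  qed
  \<comment> \<open>The value at \<open>x\<close> is split into its distance from the cell mean,
    estimated by Jensen and enlarged to an integral over \<open>B\<close>, and the mean itself,
    which is at most \<delta>. Nonnegative integrals are used so that Tonelli exchanges the order of
    integration without an integrability proof.\<close>
  have point: "ennreal (\<bar>d x\<bar> powr p) \<le> ennreal (2 powr p / v) * (\<integral>\<^sup>+h. indicator B h * ennreal (\<bar>d (x + h) - d x\<bar> powr p) \<partial>lborel)
      + ennreal (2 powr p * \<delta> powr p) * indicator K x" for x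
  proof (cases "x \<in> K")
    case True
    define Q where "Q = cell \<epsilon> (\<lambda>i. \<lfloor>x $ i / \<epsilon>\<rfloor>)"
    have Qm: "Q \<in> sets borel" "bounded Q" unfolding Q_def using assms by (auto simp: cell_measurable bounded_cell)
    have emQ: "emeasure lborel Q = ennreal v"
      unfolding Q_def v_def by (rule emeasure_cell[OF assms(5)])
    then have mQ: "measure lborel Q = v" using v by (simp add: measure_def)
    define a where "a = (\<integral>y. indicator Q y * d y \<partial>lborel) / v"
    have a: "\<bar>a\<bar> \<le> \<delta>"
      using means[OF True] v by (simp add: a_def Q_def[symmetric] v_def[symmetric] abs_mult field_simps)
    have iQ: "integrable lborel (\<lambda>y. indicator Q y * F y)" if "continuous_on UNIV F" for F :: "_ \<Rightarrow> real"
      by (rule integrable_indicator_continuous[OF that Qm])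
    have i1: "integrable lborel (\<lambda>y. indicator Q y * \<bar>d y - d x\<bar>)"
      by (rule iQ) (intro continuous_intros cd)
    have i2: "integrable lborel (\<lambda>y. indicator Q y * \<bar>d y - d x\<bar> powr p)"
      by (rule iQ[OF cdp])
    have "(\<integral>y. indicator Q y * (d y - d x) \<partial>lborel) = (\<integral>y. indicator Q y * d y - indicator Q y * d x \<partial>lborel)"
      by (simp add: right_diff_distrib)
    also have "\<dots> = a * v - v * d x"
      using Qm v mQ iQ[OF cd] iQ[of "\<lambda>_. d x"]
      by (subst Bochner_Integration.integral_diff) (auto simp: a_def)
    finally have "(\<integral>y. indicator Q y * (d y - d x) \<partial>lborel) = v * (a - d x)"
      by (simp add: algebra_simps)
    then have "\<bar>d x - a\<bar> = \<bar>\<integral>y. indicator Q y * (d y - d x) \<partial>lborel\<bar> / v"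
      using v by (simp only: abs_mult) (simp add: abs_minus_commute)
    also have "\<dots> \<le> (\<integral>y. indicator Q y * \<bar>d y - d x\<bar> \<partial>lborel) / v"
      using integral_abs_bound[of lborel "\<lambda>y. indicator Q y * (d y - d x)"] v
      by (intro divide_right_mono) (auto simp: abs_mult)
    finally have "\<bar>d x - a\<bar> powr p \<le> ((\<integral>y. indicator Q y * \<bar>d y - d x\<bar> \<partial>lborel) / v) powr p"
      using assms(4) by (intro powr_mono2) auto
    also have "\<dots> \<le> (\<integral>y. indicator Q y * \<bar>d y - d x\<bar> powr p \<partial>lborel) / v"
      using jensen_powr_indicator[of p Q lborel "\<lambda>y. \<bar>d y - d x\<bar>"] assms(4) Qm emQ mQ v i1 i2 by simp
    finally have m1: "\<bar>d x - a\<bar> powr p \<le> (\<integral>y. indicator Q y * \<bar>d y - d x\<bar> powr p \<partial>lborel) / v" .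
    have "\<bar>d x\<bar> powr p \<le> 2 powr p * (\<bar>d x - a\<bar> powr p + \<bar>a\<bar> powr p)"
      using norm_add_powr_le[of p "d x - a" a] assms(4) by simp
    also have "\<dots> \<le> 2 powr p * ((\<integral>y. indicator Q y * \<bar>d y - d x\<bar> powr p \<partial>lborel) / v + \<delta> powr p)"
      using a assms(4) by (intro mult_left_mono add_mono m1 powr_mono2) auto
    finally have "ennreal (\<bar>d x\<bar> powr p) \<le> ennreal (2 powr p * ((\<integral>y. indicator Q y * \<bar>d y - d x\<bar> powr p \<partial>lborel) / v + \<delta> powr p))"
      by (rule ennreal_leI)
    also have "\<dots> = ennreal (2 powr p / v) * ennreal (\<integral>y. indicator Q y * \<bar>d y - d x\<bar> powr p \<partial>lborel) + ennreal (2 powr p * \<delta> powr p)"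
    proof -
      define I where "I = (\<integral>y. indicator Q y * \<bar>d y - d x\<bar> powr p \<partial>lborel)"
      have "0 \<le> I" unfolding I_def by (rule Bochner_Integration.integral_nonneg) auto
      moreover have "2 powr p * (I / v + \<delta> powr p) = 2 powr p / v * I + 2 powr p * \<delta> powr p * 1"
        by (simp add: distrib_left)
      ultimately show ?thesis
        unfolding I_def[symmetric] using nn[of "2 powr p / v" I "2 powr p * \<delta> powr p" 1] v by simp
    qed
    also have "ennreal (\<integral>y. indicator Q y * \<bar>d y - d x\<bar> powr p \<partial>lborel) = (\<integral>\<^sup>+y. ennreal (indicator Q y * \<bar>d y - d x\<bar> powr p) \<partial>lborel)"
      by (rule nn_integral_eq_integral[symmetric, OF i2]) auto
    also have "\<dots> \<le> (\<integral>\<^sup>+y. indicator B (y - x) * ennreal (\<bar>d y - d x\<bar> powr p) \<partial>lborel)"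
    proof (rule nn_integral_mono)
      fix y
      have "y - x \<in> B" if "y \<in> Q"
      proof -
        have "\<bar>y $ i - x $ i\<bar> \<le> \<epsilon>" for i
        proof -
          have "\<lfloor>y $ i / \<epsilon>\<rfloor> = \<lfloor>x $ i / \<epsilon>\<rfloor>" using that by (auto simp: Q_def cell_def)
          then have "\<bar>y $ i / \<epsilon> - x $ i / \<epsilon>\<bar> \<le> 1" by linarith
          then show ?thesis using assms(5) by (simp add: divide_le_eq flip: diff_divide_distrib)
        qed
        then show ?thesis unfolding B_def by (auto simp: mem_box_cart abs_le_iff) (smt (verit))
      qed
      then show "ennreal (indicator Q y * \<bar>d y - d x\<bar> powr p) \<le> indicator B (y - x) * ennreal (\<bar>d y - d x\<bar> powr p)"
        by (auto simp: indicator_def)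
    qed
    also have "\<dots> = (\<integral>\<^sup>+h. indicator B h * ennreal (\<bar>d (x + h) - d x\<bar> powr p) \<partial>lborel)"
    proof -
      have [measurable]: "B \<in> sets borel" by (rule Bm)
      have [measurable]: "(\<lambda>y. \<bar>d y - d x\<bar> powr p) \<in> borel_measurable borel"
        by (rule borel_measurable_continuous_onI[OF cdp])
      have "(\<lambda>y. indicator B (y - x) * ennreal (\<bar>d y - d x\<bar> powr p)) \<in> borel_measurable borel"
        by measurable
      from nn_integral_lborel_translation[OF this, of x] show ?thesis by simp
    qed
    finally show ?thesis using True by (simp add: mult_left_mono)
  qed (use assms in simp)
  have cdd: "continuous_on UNIV (\<lambda>z. \<bar>d (fst z + snd z) - d (fst z)\<bar> powr p)"
  proof -
    have "continuous_on UNIV (\<lambda>z. d (fst z + snd z) - d (fst z))"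
      by (intro continuous_on_diff continuous_on_compose2[OF cd] continuous_intros) auto
    from continuous_on_norm_powr[OF this, of p] show ?thesis using assms(4) by simp
  qed
  have [measurable]: "B \<in> sets borel" by (rule Bm)
  have [measurable]: "(\<lambda>z. \<bar>d (fst z + snd z) - d (fst z)\<bar> powr p) \<in> borel_measurable (lborel \<Otimes>\<^sub>M lborel)"
    using borel_measurable_continuous_onI[OF cdd] by (simp add: lborel_prod)
  have m3: "(\<lambda>z. indicator B (snd z) * ennreal (\<bar>d (fst z + snd z) - d (fst z)\<bar> powr p)) \<in> borel_measurable (lborel \<Otimes>\<^sub>M lborel)"
    by measurable
  have m4: "(\<lambda>x. \<integral>\<^sup>+h. indicator B h * ennreal (\<bar>d (x + h) - d x\<bar> powr p) \<partial>lborel) \<in> borel_measurable lborel"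
    using lborel.borel_measurable_nn_integral_fst[OF m3] by simp
  have inner: "(\<integral>\<^sup>+x. indicator B h * ennreal (\<bar>d (x + h) - d x\<bar> powr p) \<partial>lborel) \<le> ennreal ((CARD('n) * \<epsilon>) powr p * D) * indicator B h" for h
  proof (cases "h \<in> B")
    case True
    \<comment> \<open>The Euclidean norm is estimated by the sum of the coordinates, hence the
      factor \<open>CARD('n)\<close>.\<close>
    have nh: "norm h \<le> CARD('n) * \<epsilon>"
    proof -
      have "norm h \<le> (\<Sum>i\<in>UNIV. \<bar>h $ i\<bar>)" by (rule norm_le_l1_cart)
      also have "\<dots> \<le> (\<Sum>i\<in>(UNIV :: 'n set). \<epsilon>)"
        using True by (intro sum_mono) (auto simp: B_def mem_box_cart abs_le_iff minus_le_iff)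
      finally show ?thesis by simp
    qed
    have i3: "integrable lborel (\<lambda>x. \<bar>d (x + h) - d x\<bar> powr p)"
    proof (rule integrable_continuous_compact_support)
      show "continuous_on UNIV (\<lambda>x. \<bar>d (x + h) - d x\<bar> powr p)"
        using continuous_on_norm_powr[of UNIV "\<lambda>x. d (x + h) - d x" p] assms(4)
        by (simp add: continuous_on_diff continuous_on_translate cd)
      show "compact ((\<lambda>x. x - h) ` K \<union> K)"
        using assms(2) by (intro compact_Un compact_continuous_image continuous_intros)
      fix x assume "x \<notin> (\<lambda>x. x - h) ` K \<union> K"
      then have "x + h \<notin> K" "x \<notin> K"
        using image_eqI[of x "\<lambda>x. x - h" "x + h" K] by auto
      then show "\<bar>d (x + h) - d x\<bar> powr p = 0" using assms(3) by simp
    qed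
    have "(\<integral>\<^sup>+x. ennreal (\<bar>d (x + h) - d x\<bar> powr p) \<partial>lborel) = ennreal (\<integral>x. \<bar>d (x + h) - d x\<bar> powr p \<partial>lborel)"
      by (rule nn_integral_eq_integral[OF i3]) auto
    also have "\<dots> \<le> ennreal (norm h powr p * D)"
      unfolding D_def by (intro ennreal_leI integral_translate_diff_powr_le[OF assms(1,2) _ assms(4)] assms(3))
    also have "\<dots> \<le> ennreal ((CARD('n) * \<epsilon>) powr p * D)"
      using nh assms(4) D by (intro ennreal_leI mult_right_mono powr_mono2) auto
    finally show ?thesis using True by simp
  qed simp
  have "(\<integral>\<^sup>+x. ennreal (\<bar>d x\<bar> powr p) \<partial>lborel)
      \<le> (\<integral>\<^sup>+x. ennreal (2 powr p / v) * (\<integral>\<^sup>+h. indicator B h * ennreal (\<bar>d (x + h) - d x\<bar> powr p) \<partial>lborel)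
      + ennreal (2 powr p * \<delta> powr p) * indicator K x \<partial>lborel)"
    by (rule nn_integral_mono) (rule point)
  also have "\<dots> = ennreal (2 powr p / v) * (\<integral>\<^sup>+x. \<integral>\<^sup>+h. indicator B h * ennreal (\<bar>d (x + h) - d x\<bar> powr p) \<partial>lborel \<partial>lborel)
      + ennreal (2 powr p * \<delta> powr p) * emeasure lborel K"
  proof -
    have Km: "K \<in> sets lborel" using assms(2) by (simp add: borel_compact)
    show ?thesis
      by (subst nn_integral_add)
        (use Km m4 in \<open>auto simp only: nn_integral_cmult nn_integral_cmult_indicator
          intro!: borel_measurable_times_ennreal borel_measurable_const borel_measurable_indicator\<close>)
  qed
  also have "(\<integral>\<^sup>+x. \<integral>\<^sup>+h. indicator B h * ennreal (\<bar>d (x + h) - d x\<bar> powr p) \<partial>lborel \<partial>lborel)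
      = (\<integral>\<^sup>+h. \<integral>\<^sup>+x. indicator B h * ennreal (\<bar>d (x + h) - d x\<bar> powr p) \<partial>lborel \<partial>lborel)"
    using lborel_pair.Fubini'[of "\<lambda>x h. indicator B h * ennreal (\<bar>d (x + h) - d x\<bar> powr p)"] m3
    by (simp add: split_beta')
  also have "\<dots> \<le> (\<integral>\<^sup>+h. ennreal ((CARD('n) * \<epsilon>) powr p * D) * indicator B h \<partial>lborel)"
    by (rule nn_integral_mono) (rule inner)
  also have "\<dots> = ennreal ((CARD('n) * \<epsilon>) powr p * D * (2 * \<epsilon>) ^ CARD('n))"
    using assms(5) D by (subst nn_integral_cmult_indicator) (simp_all add: emB ennreal_mult'')
  also have "emeasure lborel K = ennreal (measure lborel K)"
    using emeasure_compact_finite[OF assms(2)] by (intro emeasure_eq_ennreal_measure) simp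
  also have "ennreal (2 powr p / v) * ennreal ((CARD('n) * \<epsilon>) powr p * D * (2 * \<epsilon>) ^ CARD('n))
      + ennreal (2 powr p * \<delta> powr p) * ennreal (measure lborel K)
      = ennreal (2 powr p / v * ((CARD('n) * \<epsilon>) powr p * D * (2 * \<epsilon>) ^ CARD('n)) + 2 powr p * \<delta> powr p * measure lborel K)"
    by (rule nn) (use v D assms(5) in auto)
  also have "2 powr p / v * ((CARD('n) * \<epsilon>) powr p * D * (2 * \<epsilon>) ^ CARD('n)) + 2 powr p * \<delta> powr p * measure lborel K
      = 2 powr p * (2 ^ CARD('n) * (CARD('n) * \<epsilon>) powr p * D + \<delta> powr p * measure lborel K)" (is "_ = ?R")
    using v by (simp add: v_def power_mult_distrib distrib_left)
  finally have le: "(\<integral>\<^sup>+x. ennreal (\<bar>d x\<bar> powr p) \<partial>lborel) \<le> ennreal ?R"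
    by (simp add: mult_left_mono add_right_mono)
  have R: "0 \<le> ?R" using D by simp
  have "integrable lborel (\<lambda>x. \<bar>d x\<bar> powr p)"
    using cdp[of 0] assms by (intro integrable_continuous_compact_support[OF _ assms(2)]) auto
  then have "ennreal (\<integral>x. \<bar>d x\<bar> powr p \<partial>lborel) \<le> ennreal ?R"
    using le by (subst (asm) nn_integral_eq_integral) auto
  then show ?thesis using R unfolding D_def by (subst (asm) ennreal_le_iff) auto
qed

section \<open>Local compactness\<close>

text \<open>Dividing the i-th sequence by 1 + M i gives all of them the common bound 1, as the
  diagonal argument requires; the factors are put back in the limit.\<close>

lemma ex_subseq_all_convergent:
  fixes a :: "nat \<Rightarrow> 'i::countable \<Rightarrow> real"
  assumes "\<And>i. \<exists>M. \<forall>n. \<bar>a n i\<bar> \<le> M"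
  obtains r :: "nat \<Rightarrow> nat" where "strict_mono r" "\<And>i. convergent (\<lambda>n. a (r n) i)"
proof -
  obtain M where M: "\<And>i n. \<bar>a n i\<bar> \<le> M i" using assms by metis
  define b where "b n i = a n i / (1 + M i)" for n i
  have M0: "0 \<le> M i" for i using M[of 0 i] by linarith
  have b1: "norm (b n i) \<le> 1" for n i
    using M[of n i] M0[of i] by (simp add: b_def)
  obtain r :: "nat \<Rightarrow> nat" where r: "strict_mono r" "\<And>i. i \<in> UNIV \<Longrightarrow> \<exists>l. (\<lambda>n. b (r n) i) \<longlonglongrightarrow> l"
    by (rule function_convergent_subsequence[of UNIV b 1]) (rule countableI_type, rule b1, rule that)
  have "convergent (\<lambda>n. a (r n) i)" for i
  proof -
    obtain l where "(\<lambda>n. b (r n) i) \<longlonglongrightarrow> l" using r(2) by blast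
    then have "(\<lambda>n. (1 + M i) * b (r n) i) \<longlonglongrightarrow> (1 + M i) * l"
      by (intro tendsto_intros)
    moreover have "(1 + M i) * b n i = a n i" for n
      using M0[of i] by (simp add: b_def)
    ultimately show ?thesis by (auto simp: convergent_def)
  qed
  then show ?thesis by (rule that[OF r(1)])
qed

lemma finite_cells_meeting_bounded:
  fixes K :: "(real^'n::finite) set"
  assumes "bounded K"
  shows "finite ((\<lambda>x i. \<lfloor>x $ i / \<epsilon>\<rfloor>) ` K)"
proof -
  obtain R where R: "\<And>x. x \<in> K \<Longrightarrow> norm x \<le> R"
    using assms bounded_iff by blast
  define S where "S = {- \<lceil>\<bar>R / \<epsilon>\<bar>\<rceil> - 1 .. \<lceil>\<bar>R / \<epsilon>\<bar>\<rceil> + 1}"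
  have "\<lfloor>x $ i / \<epsilon>\<rfloor> \<in> S" if "x \<in> K" for x i
  proof -
    have "\<bar>x $ i / \<epsilon>\<bar> \<le> \<bar>R / \<epsilon>\<bar>"
      using R[OF that] component_le_norm_cart[of x i] by (auto simp: abs_divide intro!: divide_right_mono)
    then show ?thesis unfolding S_def atLeastAtMost_iff by linarith
  qed
  then have "(\<lambda>x i. \<lfloor>x $ i / \<epsilon>\<rfloor>) ` K \<subseteq> (\<Pi>\<^sub>E i\<in>UNIV. S)" by auto
  then show ?thesis
    by (rule finite_subset) (intro finite_PiE; simp add: S_def)
qed

text \<open>On a fine grid the gradient term of the cell estimate is below e / 2, uniformly in both
  functions. On that fixed grid only finitely many cells meet \<open>K\<close>, and convergence of
  the cell integrals makes the differences of the means as small as desired.\<close>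

lemma rellich_cauchy:
  fixes w :: "nat \<Rightarrow> real^'n::finite \<Rightarrow> real"
  assumes sm: "\<And>n. smooth (w n)" and K: "compact K" and w0: "\<And>n x. x \<notin> K \<Longrightarrow> w n x = 0"
    and p: "1 < p" and M: "\<And>n. (\<integral>x. norm (grad (w n) x) powr p \<partial>lborel) \<le> M"
    and conv: "\<And>l k. convergent (\<lambda>n. \<integral>x. indicator (cell (1 / real (Suc l)) k) x * w n x \<partial>lborel)"
    and e: "0 < e"
  shows "\<exists>N. \<forall>m\<ge>N. \<forall>n\<ge>N. (\<integral>x. \<bar>w m x - w n x\<bar> powr p \<partial>lborel) \<le> e"
proof -
  \<comment> \<open>The gradient of a difference has energy at most
    \<open>2 powr p * (M + M)\<close>; the other factors come from the cell estimate.\<close>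
  define c where "c = 2 powr p * (2 ^ CARD('n) * (2 powr p * (M + M)))"
  have M0: "0 \<le> M" using order_trans[OF _ M[of 0]] by simp
  have c: "0 \<le> c" using M0 by (simp add: c_def)
  obtain l where l: "c * (real CARD('n) * (1 / real (Suc l))) powr p < e / 2"
  proof -
    have "(\<lambda>l. c * (real CARD('n) * (1 / real (Suc l))) powr p) \<longlonglongrightarrow> c * (real CARD('n) * 0) powr p"
      using p by (intro tendsto_intros tendsto_powr' LIMSEQ_inverse_real_of_nat[unfolded inverse_eq_divide]) auto
    then have "\<forall>\<^sub>F l in sequentially. c * (real CARD('n) * (1 / real (Suc l))) powr p < e / 2"
      using e p by (intro order_tendstoD(2)) auto
    then obtain l where "c * (real CARD('n) * (1 / real (Suc l))) powr p < e / 2"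
      using eventually_happens'[OF sequentially_bot] by auto
    then show ?thesis by (rule that)
  qed
  define \<epsilon> where "\<epsilon> = 1 / real (Suc l)"
  have \<epsilon>: "0 < \<epsilon>" by (simp add: \<epsilon>_def)
  define \<mu> where "\<mu> = measure lborel K"
  have \<mu>: "0 \<le> \<mu>" by (simp add: \<mu>_def)
  \<comment> \<open>Solves 2^p \<delta>^p (\<mu> + 1) = e / 2; the added 1 admits a set
    \<open>K\<close> of measure zero.\<close>
  define \<delta> where "\<delta> = (e / (2 * 2 powr p * (\<mu> + 1))) powr (1 / p)"
  have \<delta>: "0 < \<delta>" using e \<mu> by (simp add: \<delta>_def)
  have \<delta>p: "2 powr p * (\<delta> powr p * \<mu>) \<le> e / 2"
  proof -
    have "\<delta> powr p = e / (2 * 2 powr p * (\<mu> + 1))"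
      using e \<mu> p by (simp add: \<delta>_def powr_powr)
    moreover have "k * (e / (2 * k * (\<mu> + 1)) * \<mu>) = e / 2 * (\<mu> / (\<mu> + 1))" if "0 < k" for k
      using that by simp
    ultimately have "2 powr p * (\<delta> powr p * \<mu>) = e / 2 * (\<mu> / (\<mu> + 1))"
      by simp
    also have "\<dots> \<le> e / 2 * 1"
      using e \<mu> by (intro mult_left_mono) auto
    finally show ?thesis by simp
  qed
  define F where "F = (\<lambda>x i. \<lfloor>x $ i / \<epsilon>\<rfloor>) ` K"
  have F: "finite F"
    unfolding F_def by (rule finite_cells_meeting_bounded[OF compact_imp_bounded[OF K]])
  define a where "a k n = (\<integral>x. indicator (cell \<epsilon> k) x * w n x \<partial>lborel)" for k n
  have "\<exists>N. \<forall>m\<ge>N. \<forall>n\<ge>N. \<bar>a k m - a k n\<bar> < \<delta> * \<epsilon> ^ CARD('n)" for k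
  proof -
    have "Cauchy (a k)"
      using conv[of l k] unfolding a_def \<epsilon>_def by (rule convergent_Cauchy)
    then show ?thesis
      using \<delta> \<epsilon> unfolding Cauchy_iff by (simp add: real_norm_def)
  qed
  then obtain g where g: "\<And>k m n. g k \<le> m \<Longrightarrow> g k \<le> n \<Longrightarrow> \<bar>a k m - a k n\<bar> < \<delta> * \<epsilon> ^ CARD('n)"
    by metis
  \<comment> \<open>The inserted 0 keeps the maximum defined when no cell meets
    \<open>K\<close>.\<close>
  define N where "N = Max (insert 0 (g ` F))"
  have gN: "g k \<le> N" if "k \<in> F" for k
    unfolding N_def using F that by simp
  have "(\<integral>x. \<bar>w m x - w n x\<bar> powr p \<partial>lborel) \<le> e" if mn: "N \<le> m" "N \<le> n" for m n
  proof -
    define d where "d x = w m x + (- 1) * w n x" for x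
    have cw: "continuous_on UNIV (w n)" for n by (rule smooth_imp_continuous_on[OF sm])
    have ig: "integrable lborel (\<lambda>x. norm (grad (w n) x) powr p)" for n
    proof (rule integrable_continuous_compact_support[OF _ K])
      show "continuous_on UNIV (\<lambda>x. norm (grad (w n) x) powr p)"
        using p by (intro continuous_on_norm_powr continuous_on_grad sm) auto
      show "norm (grad (w n) x) powr p = 0" if "x \<notin> K" for x
        using compact_support_grad_eq_0[OF K w0 that] by simp
    qed
    have gd: "grad d x = grad (w m) x + (- 1) *\<^sub>R grad (w n) x" for x
      unfolding d_def by (subst grad_add[OF sm smooth_mult[OF smooth_const sm]], subst grad_cmult[OF sm]) simp
    have "(\<integral>x. norm (grad d x) powr p \<partial>lborel)
        \<le> (\<integral>x. 2 powr p * (norm (grad (w m) x) powr p + norm (grad (w n) x) powr p) \<partial>lborel)"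
    proof (rule integral_mono')
      show "integrable lborel (\<lambda>x. 2 powr p * (norm (grad (w m) x) powr p + norm (grad (w n) x) powr p))"
        by (intro integrable_mult_right Bochner_Integration.integrable_add ig)
      show "norm (grad d x) powr p \<le> 2 powr p * (norm (grad (w m) x) powr p + norm (grad (w n) x) powr p)" for x
        unfolding gd using norm_add_powr_le[of p "grad (w m) x" "(- 1) *\<^sub>R grad (w n) x"] p by simp
    qed auto
    also have "\<dots> = 2 powr p * ((\<integral>x. norm (grad (w m) x) powr p \<partial>lborel) + (\<integral>x. norm (grad (w n) x) powr p \<partial>lborel))"
      by (simp only: integral_mult_right_zero Bochner_Integration.integral_add[OF ig ig])
    also have "\<dots> \<le> 2 powr p * (M + M)"
      by (intro mult_left_mono add_mono M) auto
    finally have gdM: "(\<integral>x. norm (grad d x) powr p \<partial>lborel) \<le> 2 powr p * (M + M)" .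
    have "(\<integral>x. \<bar>d x\<bar> powr p \<partial>lborel) \<le> 2 powr p *
        (2 ^ CARD('n) * (CARD('n) * \<epsilon>) powr p * (\<integral>x. norm (grad d x) powr p \<partial>lborel) + \<delta> powr p * \<mu>)"
      unfolding \<mu>_def
    proof (rule integral_powr_le_cell_means)
      show "smooth d" unfolding d_def by (intro smooth_add smooth_mult smooth_const sm)
      show "d x = 0" if "x \<notin> K" for x using w0[OF that] by (simp add: d_def)
      fix x assume "x \<in> K"
      define k where "k = (\<lambda>i. \<lfloor>x $ i / \<epsilon>\<rfloor>)"
      have "k \<in> F" using \<open>x \<in> K\<close> by (auto simp: F_def k_def)
      have ic: "integrable lborel (\<lambda>y. indicator (cell \<epsilon> k) y * w n y)" for n
        by (intro integrable_indicator_continuous cw cell_measurable bounded_cell \<epsilon>)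
      have "(\<integral>y. indicator (cell \<epsilon> k) y * d y \<partial>lborel) = (\<integral>y. indicator (cell \<epsilon> k) y * w m y - indicator (cell \<epsilon> k) y * w n y \<partial>lborel)"
        by (simp add: d_def algebra_simps)
      also have "\<dots> = a k m - a k n"
        unfolding a_def by (rule Bochner_Integration.integral_diff[OF ic ic])
      finally show "\<bar>\<integral>y. indicator (cell \<epsilon> (\<lambda>i. \<lfloor>x $ i / \<epsilon>\<rfloor>)) y * d y \<partial>lborel\<bar> \<le> \<delta> * \<epsilon> ^ CARD('n)"
        using g[of k m n] gN[OF \<open>k \<in> F\<close>] mn unfolding k_def[symmetric] by simp
    qed (use K p \<epsilon> \<delta> in auto)
    also have "\<dots> \<le> 2 powr p * (2 ^ CARD('n) * (CARD('n) * \<epsilon>) powr p * (2 powr p * (M + M)) + \<delta> powr p * \<mu>)"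
      by (intro mult_left_mono add_mono gdM order_refl) auto
    also have "\<dots> = c * (CARD('n) * \<epsilon>) powr p + 2 powr p * (\<delta> powr p * \<mu>)"
      by (simp add: c_def algebra_simps)
    also have "\<dots> \<le> e / 2 + e / 2"
      using l \<delta>p unfolding \<epsilon>_def by (intro add_mono) auto
    finally show ?thesis by (simp add: d_def)
  qed
  then show ?thesis by blast
qed

section \<open>Convergent subsequences in local Lebesgue spaces\<close>

lemma pointwise_convergent_of_geometric_differences:
  fixes u :: "nat \<Rightarrow> 'b::banach"
  assumes "\<And>k. j \<le> k \<Longrightarrow> norm (u (Suc k) - u k) \<le> (1/2) ^ k * B"
  shows "convergent u" "j \<le> k \<Longrightarrow> norm (u k - u j) \<le> 2 * B"
proof -
  have B: "0 \<le> B"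
    using order_trans[OF norm_ge_zero assms[OF order_refl]] mult_pos_neg[of "(1/2) ^ j" B] by force
  have sm: "summable (\<lambda>i. (1/2) ^ i * B :: real)"
    by (intro summable_mult2 summable_geometric) simp
  have le: "norm (u (Suc (i + j)) - u (i + j)) \<le> (1/2) ^ i * B" for i
  proof -
    have "norm (u (Suc (i + j)) - u (i + j)) \<le> (1/2) ^ (i + j) * B" by (rule assms) simp
    also have "\<dots> \<le> (1/2) ^ i * B"
      using B by (intro mult_right_mono power_decreasing) auto
    finally show ?thesis .
  qed
  have sum_eq: "(\<Sum>i<n. u (Suc (i + j)) - u (i + j)) = u (n + j) - u j" for n
    using sum_lessThan_telescope[of "\<lambda>i. u (i + j)" n] by simp
  have "summable (\<lambda>i. u (Suc (i + j)) - u (i + j))"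
    by (rule summable_comparison_test'[OF sm]) (rule le)
  then have "convergent (\<lambda>n. u (n + j) - u j)"
    unfolding summable_iff_convergent sum_eq .
  then have "convergent (\<lambda>n. u (n + j))"
    by (simp add: convergent_diff_const_right_iff)
  then show "convergent u"
    by (simp add: convergent_ignore_initial_segment)
  assume "j \<le> k"
  then have "norm (u k - u j) = norm (\<Sum>i<k - j. u (Suc (i + j)) - u (i + j))"
    by (simp add: sum_eq)
  also have "\<dots> \<le> (\<Sum>i<k - j. (1/2) ^ i * B)"
    by (intro sum_norm_le le)
  also have "\<dots> \<le> (\<Sum>i. (1/2) ^ i * B)"
    using B by (intro sum_le_suminf sm) auto
  also have "\<dots> = 2 * B"
    using suminf_geometric[of "1/2 :: real"] by (subst suminf_mult2[symmetric]) auto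
  finally show "norm (u k - u j) \<le> 2 * B" .
qed

text \<open>The sum of the series dominates every term, and monotone convergence bounds its integral
  by the sum of the \<open>c k\<close>. It is finite almost everywhere, so passing to real values
  affects only a null set.\<close>

lemma ex_integrable_common_bound:
  fixes f :: "nat \<Rightarrow> 'a \<Rightarrow> real"
  assumes f: "\<And>k. integrable M (f k)" and nn: "\<And>k x. 0 \<le> f k x"
    and le: "\<And>k. (\<integral>x. f k x \<partial>M) \<le> c k" and c: "summable c"
  obtains H where "integrable M H" "\<And>x. 0 \<le> H x" "AE x in M. \<forall>k. f k x \<le> H x"
proof -
  define S where "S x = (\<Sum>k. ennreal (f k x))" for x
  have fm [measurable]: "f k \<in> borel_measurable M" for k using f by auto
  have Sm [measurable]: "S \<in> borel_measurable M" unfolding S_def by measurable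
  have c0: "0 \<le> c k" for k
    using le[of k] Bochner_Integration.integral_nonneg[of M "f k"] nn order_trans by blast
  have "(\<integral>\<^sup>+x. S x \<partial>M) = (\<Sum>k. \<integral>\<^sup>+x. ennreal (f k x) \<partial>M)"
    unfolding S_def by (rule nn_integral_suminf) simp
  also have "\<dots> \<le> (\<Sum>k. ennreal (c k))"
    using le nn f by (intro suminf_le) (auto simp: nn_integral_eq_integral intro: ennreal_leI)
  also have "\<dots> = ennreal (\<Sum>k. c k)"
    by (rule suminf_ennreal2[OF c0 c])
  finally have fin: "(\<integral>\<^sup>+x. S x \<partial>M) < \<infinity>"
    by (simp add: order_le_less_trans)
  then have AE: "AE x in M. S x \<noteq> \<infinity>"
    by (intro nn_integral_PInf_AE) auto
  show ?thesis
  proof (rule that[of "\<lambda>x. enn2real (S x)"])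
    have "(\<integral>\<^sup>+x. ennreal (norm (enn2real (S x))) \<partial>M) \<le> (\<integral>\<^sup>+x. S x \<partial>M)"
      by (intro nn_integral_mono) (simp add: ennreal_enn2real_if)
    then show "integrable M (\<lambda>x. enn2real (S x))"
      using fin by (intro integrableI_bounded) auto
    show "AE x in M. \<forall>k. f k x \<le> enn2real (S x)"
      using AE
    proof eventually_elim
      case (elim x)
      show ?case
      proof
        fix k
        have "ennreal (f k x) \<le> S x"
          using sum_le_suminf[of "\<lambda>k. ennreal (f k x)" "{k}"] by (simp add: S_def)
        then show "f k x \<le> enn2real (S x)"
          using elim nn by (metis enn2real_ennreal enn2real_mono top.not_eq_extremum infinity_ennreal_def)
      qed
    qed
  qed simp
qed

text \<open>The usual proof of completeness of L^p, run on all sets \<open>C j\<close> along one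
  subsequence: the k-th step is controlled on \<open>C k\<close>, hence on every smaller
  \<open>C j\<close> once k \<ge> j. Besides the limit it returns majorants, which later serve for
  dominated convergence.\<close>

lemma local_riesz_fischer:
  fixes U :: "nat \<Rightarrow> 'a \<Rightarrow> 'b::{banach, second_countable_topology}"
  assumes p: "1 < p" and U [measurable]: "\<And>n. U n \<in> borel_measurable M"
    and C [measurable]: "\<And>j. C j \<in> sets M" and mono: "incseq C"
    and int: "\<And>n j. integrable M (\<lambda>x. indicator (C j) x * norm (U n x) powr p)"
    and cauchy: "\<And>j e. 0 < e \<Longrightarrow>
      \<exists>N. \<forall>m\<ge>N. \<forall>n\<ge>N. (\<integral>x. indicator (C j) x * norm (U m x - U n x) powr p \<partial>M) \<le> e"
  obtains r V H where "strict_mono (r :: nat \<Rightarrow> nat)" "V \<in> borel_measurable M"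
    "AE x in M. x \<in> (\<Union>j. C j) \<longrightarrow> (\<lambda>k. U (r k) x) \<longlonglongrightarrow> V x"
    "\<And>j. integrable M (H j :: 'a \<Rightarrow> real)"
    "\<And>j. AE x in M. x \<in> C j \<longrightarrow> (\<forall>k\<ge>j. norm (U (r k) x) powr p \<le> H j x)"
proof -
  have "\<exists>N. \<forall>m\<ge>N. \<forall>n\<ge>N. (\<integral>x. indicator (C j) x * norm (U m x - U n x) powr p \<partial>M) \<le> ((1/4) powr p) ^ j" for j
    by (rule cauchy) simp
  then obtain N where N: "\<And>j m n. N j \<le> m \<Longrightarrow> N j \<le> n \<Longrightarrow>
      (\<integral>x. indicator (C j) x * norm (U m x - U n x) powr p \<partial>M) \<le> ((1/4) powr p) ^ j"
    by metis
  \<comment> \<open>A running sum with increments at least 1: it is strictly increasing and exceeds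
    every \<open>N i\<close> with i \<le> k.\<close>
  define r where "r k = (\<Sum>i\<le>k. N i + 1)" for k
  have r: "strict_mono r"
    unfolding strict_mono_Suc_iff by (simp add: r_def)
  have rN: "N k \<le> r i" if "k \<le> i" for k i
  proof -
    have "N k + 1 \<le> r i"
      unfolding r_def using that by (intro member_le_sum) auto
    then show ?thesis by simp
  qed
  have intD: "integrable M (\<lambda>x. indicator (C j) x * norm (U m x - U n x) powr p)" for j m n
  proof (rule Bochner_Integration.integrable_bound)
    show "integrable M (\<lambda>x. 2 powr p * (indicator (C j) x * norm (U m x) powr p + indicator (C j) x * norm (U n x) powr p))"
      by (intro integrable_mult_right Bochner_Integration.integrable_add int)
    show "AE x in M. norm (indicator (C j) x * norm (U m x - U n x) powr p)
        \<le> norm (2 powr p * (indicator (C j) x * norm (U m x) powr p + indicator (C j) x * norm (U n x) powr p))"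
    proof (rule AE_I2)
      fix x
      show "norm (indicator (C j) x * norm (U m x - U n x) powr p)
        \<le> norm (2 powr p * (indicator (C j) x * norm (U m x) powr p + indicator (C j) x * norm (U n x) powr p))"
        using norm_add_powr_le[of p "U m x" "- U n x"] p by (cases "x \<in> C j") auto
    qed
  qed measurable
  \<comment> \<open>On \<open>C (j + k)\<close> the unweighted integral is at most (1/4)^(p (j+k)).
    The weight leaves the summable bound (1/2)^(p (j+k)), and a pointwise majorant \<open>H\<close>
    of the weighted terms means steps of size at most (1/2)^k H^(1/p).\<close>
  define f where "f j k x = (2 powr p) ^ (j + k) * (indicator (C j) x * norm (U (r (Suc (j + k))) x - U (r (j + k)) x) powr p)" for j k :: nat and x
  have f0: "0 \<le> f j k x" for j k x by (simp add: f_def)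
  have fint: "integrable M (f j k)" for j k
    unfolding f_def by (intro integrable_mult_right intD)
  have fle: "(\<integral>x. f j k x \<partial>M) \<le> ((1/2) powr p) ^ (j + k)" for j k
  proof -
    have "(\<integral>x. indicator (C j) x * norm (U (r (Suc (j + k))) x - U (r (j + k)) x) powr p \<partial>M)
        \<le> (\<integral>x. indicator (C (j + k)) x * norm (U (r (Suc (j + k))) x - U (r (j + k)) x) powr p \<partial>M)"
    proof (rule integral_mono[OF intD intD])
      fix x
      have "C j \<subseteq> C (j + k)" by (rule incseqD[OF mono]) simp
      then show "indicator (C j) x * norm (U (r (Suc (j + k))) x - U (r (j + k)) x) powr p
          \<le> indicator (C (j + k)) x * norm (U (r (Suc (j + k))) x - U (r (j + k)) x) powr p"
        by (auto simp: indicator_def)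
    qed
    also have "\<dots> \<le> ((1/4) powr p) ^ (j + k)"
      by (intro N rN) auto
    finally have "(\<integral>x. f j k x \<partial>M) \<le> (2 powr p) ^ (j + k) * ((1/4) powr p) ^ (j + k)"
      unfolding f_def integral_mult_right_zero by (intro mult_left_mono) auto
    also have "(2 powr p) ^ (j + k) * ((1/4) powr p) ^ (j + k) = (((2 * (1/4)) powr p) :: real) ^ (j + k)"
      by (simp only: power_mult_distrib powr_mult)
    finally show ?thesis by simp
  qed
  have sm: "summable (\<lambda>k. ((1/2) powr p :: real) ^ (j + k))" for j
  proof -
    have "(1/2) powr p < (1::real)" using p powr_less_mono2[of p "1/2" 1] by simp
    then have "summable (\<lambda>k. ((1/2) powr p :: real) ^ j * ((1/2) powr p) ^ k)"
      by (intro summable_mult summable_geometric) simp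
    then show ?thesis by (simp add: power_add)
  qed
  define P where "P j H \<longleftrightarrow> integrable M H \<and> (\<forall>x. 0 \<le> H x) \<and> (AE x in M. \<forall>k. f j k x \<le> H x)" for j H
  have "\<exists>H. P j H" for j
  proof -
    obtain H where "integrable M H" "\<And>x. 0 \<le> H x" "AE x in M. \<forall>k. f j k x \<le> H x"
      by (rule ex_integrable_common_bound[of M "f j", OF fint f0 fle sm]) (rule that)
    then have "P j H" unfolding P_def by blast
    then show ?thesis by (rule exI[of "P j"])
  qed
  then obtain H where PH: "\<And>j. P j (H j)"
    by metis
  have H: "integrable M (H j)" "0 \<le> H j x" "AE x in M. \<forall>k. f j k x \<le> H j x" for j x
    using PH[of j] unfolding P_def by blast+
  define V where "V x = lim (\<lambda>k. U (r k) x)" for x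
  have key: "convergent (\<lambda>k. U (r k) x) \<and>
      (\<forall>k\<ge>j. norm (U (r k) x) powr p \<le> 2 powr p * (indicator (C j) x * norm (U (r j) x) powr p + 2 powr p * H j x))"
    if x: "x \<in> C j" "\<forall>k. f j k x \<le> H j x" for j x
  proof -
    have d: "norm (U (r (Suc k)) x - U (r k) x) \<le> (1/2) ^ k * H j x powr (1 / p)" if "j \<le> k" for k
    proof -
      define i where "i = k - j"
      have i: "k = j + i" using that by (simp add: i_def)
      define D where "D = norm (U (r (Suc k)) x - U (r k) x)"
      have "(2 ^ k * D) powr p = f j i x"
      proof -
        have "(2 ^ k) powr p = (2 powr p) ^ k"
          by (induction k) (auto simp: powr_mult)
        then show ?thesis
          using x(1) by (simp add: f_def i[symmetric] D_def powr_mult)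
      qed
      also have "\<dots> \<le> H j x" using x(2) by blast
      finally have "((2 ^ k * D) powr p) powr (1 / p) \<le> H j x powr (1 / p)"
        using p by (intro powr_mono2) auto
      then have "2 ^ k * D \<le> H j x powr (1 / p)"
        using p by (simp add: powr_powr D_def)
      then show ?thesis by (simp add: D_def[symmetric] field_simps)
    qed
    have "norm (U (r k) x) powr p \<le> 2 powr p * (indicator (C j) x * norm (U (r j) x) powr p + 2 powr p * H j x)"
      if "j \<le> k" for k
    proof -
      have "norm (U (r k) x - U (r j) x) \<le> 2 * H j x powr (1 / p)"
        using pointwise_convergent_of_geometric_differences(2)[of j "\<lambda>k. U (r k) x", OF d that] by simp
      then have "norm (U (r k) x - U (r j) x) powr p \<le> (2 * H j x powr (1 / p)) powr p"
        using p by (intro powr_mono2) auto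
      also have "\<dots> = 2 powr p * H j x"
        using p H(2)[of j x] by (simp add: powr_mult powr_powr)
      finally have *: "norm (U (r k) x - U (r j) x) powr p \<le> 2 powr p * H j x" .
      have "norm (U (r k) x) powr p \<le> 2 powr p * (norm (U (r j) x) powr p + norm (U (r k) x - U (r j) x) powr p)"
        using norm_add_powr_le[of p "U (r j) x" "U (r k) x - U (r j) x"] p by simp
      also have "\<dots> \<le> 2 powr p * (norm (U (r j) x) powr p + 2 powr p * H j x)"
        by (intro mult_left_mono add_left_mono *) simp
      finally show ?thesis using x(1) by simp
    qed
    then show ?thesis
      using pointwise_convergent_of_geometric_differences(1)[of j "\<lambda>k. U (r k) x", OF d] by blast
  qed
  show ?thesis
  proof (rule that[OF r])
    show "V \<in> borel_measurable M" unfolding V_def by measurable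
    show "AE x in M. x \<in> (\<Union>j. C j) \<longrightarrow> (\<lambda>k. U (r k) x) \<longlonglongrightarrow> V x"
    proof -
      have "AE x in M. \<forall>j. \<forall>k. f j k x \<le> H j x" using H(3) by (simp add: AE_all_countable)
      then show ?thesis
      proof eventually_elim
        case (elim x)
        then show ?case using key by (auto simp: V_def convergent_LIMSEQ_iff)
      qed
    qed
    show "integrable M (\<lambda>x. 2 powr p * (indicator (C j) x * norm (U (r j) x) powr p + 2 powr p * H j x))" for j
      by (intro integrable_mult_right Bochner_Integration.integrable_add int H)
    show "AE x in M. x \<in> C j \<longrightarrow> (\<forall>k\<ge>j. norm (U (r k) x) powr p
        \<le> 2 powr p * (indicator (C j) x * norm (U (r j) x) powr p + 2 powr p * H j x))" for j
      using H(3)[of j] by eventually_elim (use key in blast)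
  qed
qed

section \<open>The energy and minimizing sequences\<close>

text \<open>Transfers results between the completed measure restricted to \<Omega>, in which the
  energy is formulated, and the Borel measure on the whole space, where translations and Fubini are
  applied.\<close>

lemma lebesgue_on_integral_eq_lborel:
  fixes F :: "'a::euclidean_space \<Rightarrow> real"
  assumes "\<Omega> \<in> sets lebesgue" "F \<in> borel_measurable borel" "\<And>x. x \<notin> \<Omega> \<Longrightarrow> F x = 0"
  shows "integrable (lebesgue_on \<Omega>) F \<longleftrightarrow> integrable lborel F"
    and "(\<integral>x. F x \<partial>lebesgue_on \<Omega>) = (\<integral>x. F x \<partial>lborel)"
proof -
  have eq: "(\<lambda>x. indicator \<Omega> x *\<^sub>R F x) = F"
    using assms(3) by (auto simp: fun_eq_iff indicator_def)
  have m: "F \<in> lborel \<rightarrow>\<^sub>M borel" using assms(2) by simp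
  show "integrable (lebesgue_on \<Omega>) F \<longleftrightarrow> integrable lborel F"
    using integrable_restrict_space[of \<Omega> lebesgue F] integrable_completion[OF m] assms(1) unfolding eq by simp
  show "(\<integral>x. F x \<partial>lebesgue_on \<Omega>) = (\<integral>x. F x \<partial>lborel)"
    using integral_restrict_space[of \<Omega> lebesgue F] integral_completion[OF m] assms(1) unfolding eq by simp
qed

lemma integrable_lebesgue_on_subset:
  fixes F :: "'a::euclidean_space \<Rightarrow> real"
  assumes "\<Omega> \<in> sets lebesgue" "K \<in> sets lebesgue" "K \<subseteq> \<Omega>"
  shows "integrable (lebesgue_on K) F \<longleftrightarrow> integrable (lebesgue_on \<Omega>) (\<lambda>x. indicator K x * F x)"
proof -
  have eq: "(\<lambda>x. indicator \<Omega> x *\<^sub>R (indicator K x * F x)) = (\<lambda>x. indicator K x *\<^sub>R F x)"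
    using assms(3) by (auto simp: fun_eq_iff indicator_def)
  show ?thesis
    using integrable_restrict_space[of \<Omega> lebesgue "\<lambda>x. indicator K x * F x"]
      integrable_restrict_space[of K lebesgue F] assms(1,2) unfolding eq by simp
qed

lemma grad_lincomb:
  assumes "smooth u" "smooth v"
  shows "grad (\<lambda>x. a * u x + b * v x) x = a *\<^sub>R grad u x + b *\<^sub>R grad v x"
  using assms by (simp add: grad_add grad_cmult smooth_mult smooth_const)

lemma test_function_support:
  assumes "u \<in> test_functions \<Omega>"
  obtains K where "compact K" "K \<subseteq> \<Omega>" "\<And>x. x \<notin> K \<Longrightarrow> u x = 0" "\<And>x. x \<notin> K \<Longrightarrow> grad u x = 0"
proof (rule that)
  show "compact (closure {x. u x \<noteq> 0})" "closure {x. u x \<noteq> 0} \<subseteq> \<Omega>"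
    using assms by (auto simp: test_functions_def)
  show "u x = 0" if "x \<notin> closure {x. u x \<noteq> 0}" for x
    using that mem_closure_support[of u x] by blast
  show "grad u x = 0" if "x \<notin> closure {x. u x \<noteq> 0}" for x
    using that by (rule grad_eq_0_outside_support)
qed

section \<open>Integrability and homogeneity of the energy on test functions\<close>

locale p_energy =
  fixes p :: real and \<Omega> :: "(real^'n::finite) set" and V :: "real^'n \<Rightarrow> real"
  assumes p: "1 < p" and opn: "open \<Omega>" and V: "V \<in> Linf_loc \<Omega>"
begin

abbreviation "M \<equiv> lebesgue_on \<Omega>"
abbreviation "\<D> \<equiv> test_functions \<Omega>"
abbreviation "Q \<equiv> Q_form \<Omega> p V"

lemma \<Omega>_lebesgue: "\<Omega> \<in> sets lebesgue"
  using opn by simp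

lemma compact_in_M: "compact K \<Longrightarrow> K \<subseteq> \<Omega> \<Longrightarrow> K \<in> sets M"
  by (simp add: sets_restrict_space_iff \<Omega>_lebesgue borel_compact)

lemma measurable_M: "continuous_on UNIV F \<Longrightarrow> F \<in> borel_measurable M"
  for F :: "real^'n \<Rightarrow> 'b::euclidean_space"
  by (intro measurable_restrict_space1 measurable_completion) (simp add: borel_measurable_continuous_onI)

lemma integrable_compact:
  fixes F :: "real^'n \<Rightarrow> real"
  assumes "continuous_on UNIV F" "compact K" "K \<subseteq> \<Omega>" "\<And>x. x \<notin> K \<Longrightarrow> F x = 0"
  shows "integrable M F"
proof -
  have "integrable lborel F"
    by (rule integrable_continuous_compact_support[OF assms(1,2)]) (rule assms(4))
  then show ?thesis
    using lebesgue_on_integral_eq_lborel(1)[OF \<Omega>_lebesgue borel_measurable_continuous_onI[OF assms(1)]] assms(3,4)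
    by blast
qed

lemma integrable_ind:
  fixes F :: "real^'n \<Rightarrow> real"
  assumes "continuous_on UNIV F" "compact K" "K \<subseteq> \<Omega>"
  shows "integrable M (\<lambda>x. indicator K x * F x)"
proof -
  have "integrable lborel (\<lambda>x. indicator K x * F x)"
    by (rule integrable_indicator_continuous[OF assms(1)]) (use assms(2) in \<open>auto simp: borel_compact compact_imp_bounded\<close>)
  moreover have "(\<lambda>x. indicator K x * F x) \<in> borel_measurable borel"
    by (intro borel_measurable_times borel_measurable_indicator borel_measurable_continuous_onI assms borel_compact)
  moreover have "indicator K x * F x = 0" if "x \<notin> \<Omega>" for x
    using that assms(3) by (auto simp: indicator_def)
  ultimately show ?thesis
    using lebesgue_on_integral_eq_lborel(1)[OF \<Omega>_lebesgue] by blast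
qed

lemma V_bound:
  assumes "compact K" "K \<subseteq> \<Omega>"
  obtains c where "0 \<le> c" "AE x in M. x \<in> K \<longrightarrow> \<bar>V x\<bar> \<le> c"
proof -
  obtain c where "AE x in lebesgue_on K. \<bar>V x\<bar> \<le> c"
    using V assms by (auto simp: Linf_loc_def)
  then have "AE x in lebesgue. x \<in> K \<longrightarrow> \<bar>V x\<bar> \<le> c"
    using assms(1) by (subst (asm) AE_restrict_space_iff) (auto simp: borel_compact)
  then have "AE x in M. x \<in> K \<longrightarrow> \<bar>V x\<bar> \<le> max 0 c"
    by (subst AE_restrict_space_iff) (auto simp: \<Omega>_lebesgue)
  then show ?thesis by (intro that[of "max 0 c"]) auto
qed

lemma V_measurable: "V \<in> borel_measurable M"
  using V by (simp add: Linf_loc_def)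

lemma V_mult_bound:
  assumes "compact K" "K \<subseteq> \<Omega>"
  obtains c where "0 \<le> c"
    "\<And>F. integrable M F \<Longrightarrow> \<forall>x. x \<notin> K \<longrightarrow> F x = 0 \<Longrightarrow> integrable M (\<lambda>x. V x * F x)"
    "\<And>F G. integrable M F \<Longrightarrow> integrable M G \<Longrightarrow> \<forall>x. x \<notin> K \<longrightarrow> F x = 0 \<Longrightarrow> \<forall>x. \<bar>F x\<bar> \<le> G x \<Longrightarrow>
      \<bar>\<integral>x. V x * F x \<partial>M\<bar> \<le> c * (\<integral>x. G x \<partial>M)"
proof -
  obtain c where c: "0 \<le> c" "AE x in M. x \<in> K \<longrightarrow> \<bar>V x\<bar> \<le> c"
    by (rule V_bound[OF assms]) (rule that)
  have ae: "AE x in M. norm (V x * F x) \<le> c * \<bar>F x\<bar>" if "\<forall>x. x \<notin> K \<longrightarrow> F x = 0" for F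
    using c(2)
  proof eventually_elim
    case (elim x)
    then show ?case
      using that mult_right_mono[of "\<bar>V x\<bar>" c "\<bar>F x\<bar>"] by (cases "x \<in> K") (auto simp: abs_mult)
  qed
  have int: "integrable M (\<lambda>x. V x * F x)" if F: "integrable M F" "\<forall>x. x \<notin> K \<longrightarrow> F x = 0" for F
  proof (rule Bochner_Integration.integrable_bound)
    show "integrable M (\<lambda>x. c * \<bar>F x\<bar>)" using F(1) by (intro integrable_mult_right integrable_abs)
    show "(\<lambda>x. V x * F x) \<in> borel_measurable M"
      by (intro borel_measurable_times V_measurable borel_measurable_integrable F(1))
    show "AE x in M. norm (V x * F x) \<le> norm (c * \<bar>F x\<bar>)"
      using ae[OF F(2)] by eventually_elim (use c(1) in \<open>simp add: abs_mult\<close>)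
  qed
  show ?thesis
  proof (rule that[OF c(1) int])
    fix F G :: "real^'n \<Rightarrow> real"
    assume F: "integrable M F" "\<forall>x. x \<notin> K \<longrightarrow> F x = 0" and G: "integrable M G" "\<forall>x. \<bar>F x\<bar> \<le> G x"
    have "\<bar>\<integral>x. V x * F x \<partial>M\<bar> \<le> (\<integral>x. \<bar>V x * F x\<bar> \<partial>M)"
      by (rule integral_abs_bound)
    also have "\<dots> \<le> (\<integral>x. c * G x \<partial>M)"
    proof (rule integral_mono_AE)
      show "integrable M (\<lambda>x. \<bar>V x * F x\<bar>)" by (intro integrable_abs int F)
      show "integrable M (\<lambda>x. c * G x)" by (intro integrable_mult_right G)
      show "AE x in M. \<bar>V x * F x\<bar> \<le> c * G x"
        using ae[OF F(2)]
      proof eventually_elim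
        case (elim x)
        also have "c * \<bar>F x\<bar> \<le> c * G x" using c(1) G(2) by (intro mult_left_mono) auto
        finally show ?case by simp
      qed
    qed
    finally show "\<bar>\<integral>x. V x * F x \<partial>M\<bar> \<le> c * (\<integral>x. G x \<partial>M)" by simp
  qed
qed

lemma cont_powr: "u \<in> \<D> \<Longrightarrow> continuous_on UNIV (\<lambda>x. \<bar>u x\<bar> powr p)"
  using continuous_on_norm_powr[of UNIV u p] p
  by (simp add: smooth_imp_continuous_on test_functions_smooth)

lemma cont_grad_powr: "u \<in> \<D> \<Longrightarrow> continuous_on UNIV (\<lambda>x. norm (grad u x) powr p)"
  using continuous_on_norm_powr[of UNIV "grad u" p] p
  by (simp add: continuous_on_grad test_functions_smooth)

lemma int_grad:
  assumes "u \<in> \<D>" shows "integrable M (\<lambda>x. norm (grad u x) powr p)"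
proof -
  obtain K where K: "compact K" "K \<subseteq> \<Omega>" "\<And>x. x \<notin> K \<Longrightarrow> grad u x = 0"
    by (rule test_function_support[OF assms]) (rule that)
  show ?thesis
    by (rule integrable_compact[OF cont_grad_powr[OF assms] K(1,2)]) (use K(3) in simp)
qed

lemma int_powr:
  assumes "u \<in> \<D>" shows "integrable M (\<lambda>x. \<bar>u x\<bar> powr p)"
proof -
  obtain K where K: "compact K" "K \<subseteq> \<Omega>" "\<And>x. x \<notin> K \<Longrightarrow> u x = 0"
    by (rule test_function_support[OF assms]) (rule that)
  show ?thesis
    by (rule integrable_compact[OF cont_powr[OF assms] K(1,2)]) (use K(3) in simp)
qed

lemma int_V_powr:
  assumes "u \<in> \<D>" shows "integrable M (\<lambda>x. V x * \<bar>u x\<bar> powr p)"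
proof -
  obtain K where K: "compact K" "K \<subseteq> \<Omega>" "\<And>x. x \<notin> K \<Longrightarrow> u x = 0"
    by (rule test_function_support[OF assms]) (rule that)
  show ?thesis
    by (rule V_mult_bound[OF K(1,2)]) (use int_powr[OF assms] K(3) in simp)
qed

text \<open>Subtracting under the integral sign is essential: if \<open>u\<close> and
  \<open>v\<close> agree off a compact set, the potential integrand vanishes there, although their
  own supports may spread over \<Omega> along a sequence.\<close>

lemma Q_diff:
  assumes "u \<in> \<D>" "v \<in> \<D>"
  shows "Q u - Q v = (\<integral>x. norm (grad u x) powr p - norm (grad v x) powr p \<partial>M)
    - (\<integral>x. V x * (\<bar>u x\<bar> powr p - \<bar>v x\<bar> powr p) \<partial>M)"
  unfolding Q_form_def right_diff_distrib
    Bochner_Integration.integral_diff[OF int_grad[OF assms(1)] int_grad[OF assms(2)]]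
    Bochner_Integration.integral_diff[OF int_V_powr[OF assms(1)] int_V_powr[OF assms(2)]]
  by simp

lemma Q_scale:
  assumes "u \<in> \<D>" shows "Q (\<lambda>x. c * u x) = \<bar>c\<bar> powr p * Q u"
proof -
  have "grad (\<lambda>x. c * u x) x = c *\<^sub>R grad u x" for x
    by (rule grad_cmult[OF test_functions_smooth[OF assms]])
  then have 1: "norm (grad (\<lambda>x. c * u x) x) powr p = \<bar>c\<bar> powr p * norm (grad u x) powr p" for x
    by (simp only: norm_scaleR_powr)
  have 2: "V x * \<bar>c * u x\<bar> powr p = \<bar>c\<bar> powr p * (V x * \<bar>u x\<bar> powr p)" for x
    by (simp add: abs_mult powr_mult)
  show ?thesis
    unfolding Q_form_def 1 2 integral_mult_right_zero by (simp only: right_diff_distrib)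
qed

end

section \<open>Coercivity and minimizing sequences\<close>

locale coercive_energy = p_energy p \<Omega> V for p and \<Omega> :: "(real^'n::finite) set" and V +
  fixes W :: "real^'n \<Rightarrow> real" and f :: "(real^'n \<Rightarrow> real) \<Rightarrow> real" and C :: real
  assumes W_cont: "continuous_on \<Omega> W" and W_pos: "\<And>x. x \<in> \<Omega> \<Longrightarrow> 0 < W x"
    and coercive: "\<And>u. u \<in> test_functions \<Omega> \<Longrightarrow>
      (\<integral>x. W x * \<bar>u x\<bar> powr p \<partial>lebesgue_on \<Omega>) \<le> Q_form \<Omega> p V u"
    and f_linear: "\<And>u v a b. u \<in> test_functions \<Omega> \<Longrightarrow> v \<in> test_functions \<Omega> \<Longrightarrow>
      f (\<lambda>x. a * u x + b * v x) = a * f u + b * f v"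
    and C: "0 \<le> C" and f_bounded: "\<And>u. u \<in> test_functions \<Omega> \<Longrightarrow> Q_form \<Omega> p V u = 1 \<Longrightarrow> f u \<le> C"
begin

lemma W_measurable: "W \<in> borel_measurable M"
  by (rule continuous_imp_measurable_on_sets_lebesgue[OF W_cont \<Omega>_lebesgue])

lemma int_W:
  assumes "u \<in> \<D>" shows "integrable M (\<lambda>x. W x * \<bar>u x\<bar> powr p)"
proof -
  obtain K where K: "compact K" "K \<subseteq> \<Omega>" "\<And>x. x \<notin> K \<Longrightarrow> u x = 0"
    by (rule test_function_support[OF assms]) (rule that)
  have "compact (W ` K)"
    using K W_cont by (intro compact_continuous_image) (auto intro: continuous_on_subset)
  then obtain c where c: "\<And>x. x \<in> K \<Longrightarrow> \<bar>W x\<bar> \<le> c"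
    by (metis bounded_iff compact_imp_bounded imageI real_norm_def)
  show ?thesis
  proof (rule Bochner_Integration.integrable_bound)
    show "integrable M (\<lambda>x. c * \<bar>u x\<bar> powr p)" by (intro integrable_mult_right int_powr assms)
    show "(\<lambda>x. W x * \<bar>u x\<bar> powr p) \<in> borel_measurable M"
      by (intro borel_measurable_times W_measurable borel_measurable_integrable[OF int_powr[OF assms]])
    have "norm (W x * \<bar>u x\<bar> powr p) \<le> norm (c * \<bar>u x\<bar> powr p)" for x
    proof (cases "x \<in> K")
      case True
      then have "\<bar>W x\<bar> * \<bar>u x\<bar> powr p \<le> \<bar>c\<bar> * \<bar>u x\<bar> powr p"
        using c[OF True] by (intro mult_right_mono) auto
      then show ?thesis by (simp add: abs_mult)
    qed (simp add: K(3))
    then show "AE x in M. norm (W x * \<bar>u x\<bar> powr p) \<le> norm (c * \<bar>u x\<bar> powr p)" by simp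
  qed
qed

lemma W_integral_nonneg: "0 \<le> (\<integral>x. W x * \<bar>u x\<bar> powr p \<partial>M)"
  by (rule integral_nonneg_AE, rule AE_I2) (auto intro!: mult_nonneg_nonneg less_imp_le[OF W_pos])

lemma Q_nonneg: "u \<in> \<D> \<Longrightarrow> 0 \<le> Q u"
  using coercive W_integral_nonneg order_trans by blast

text \<open>Positivity of \<open>W\<close> gives u = 0 almost everywhere, and by continuity the set
  where u is nonzero is open; an open negligible set is empty. This settles the case in which
  \<open>u\<close> cannot be normalized to Q = 1.\<close>

lemma Q_eq_0:
  assumes "u \<in> \<D>" "Q u = 0" shows "u = (\<lambda>x. 0)"
proof -
  have 0: "(\<integral>x. W x * \<bar>u x\<bar> powr p \<partial>M) = 0"
    using coercive[OF assms(1)] W_integral_nonneg[of u] assms(2) by linarith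
  have "AE x in M. 0 \<le> W x * \<bar>u x\<bar> powr p"
    by (rule AE_I2) (auto intro!: mult_nonneg_nonneg less_imp_le[OF W_pos])
  then have "AE x in M. W x * \<bar>u x\<bar> powr p = 0"
    using integral_nonneg_eq_0_iff_AE[OF int_W[OF assms(1)]] 0 by blast
  then have "AE x in lebesgue. x \<in> \<Omega> \<longrightarrow> W x * \<bar>u x\<bar> powr p = 0"
    by (subst (asm) AE_restrict_space_iff) (auto simp: \<Omega>_lebesgue)
  then have "AE x in lebesgue. x \<in> \<Omega> \<longrightarrow> u x = 0"
    by eventually_elim (use W_pos in force)
  then have "AE x in lebesgue. u x = 0"
  proof eventually_elim
    case (elim x)
    then show ?case
      using assms(1) mem_closure_support[of u x] by (auto simp: test_functions_def)
  qed
  moreover have "open {x. u x \<noteq> 0}"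
    using smooth_imp_continuous_on[OF test_functions_smooth[OF assms(1)], of UNIV]
    by (intro open_Collect_neq continuous_on_const) auto
  ultimately have "{x. u x \<noteq> 0} \<in> null_sets lebesgue"
    by (subst AE_iff_null_sets) auto
  then have "negligible {x. u x \<noteq> 0}" by (simp add: negligible_iff_null_sets)
  then have "{x. u x \<noteq> 0} = {}"
    using \<open>open {x. u x \<noteq> 0}\<close>
    using open_not_negligible by blast
  then show ?thesis by auto
qed

lemma f_scale: "u \<in> \<D> \<Longrightarrow> f (\<lambda>x. a * u x) = a * f u"
  using f_linear[of u u a 0] by simp

lemma scale_in: "u \<in> \<D> \<Longrightarrow> (\<lambda>x. a * u x) \<in> \<D>"
  using test_functions_lincomb[of u \<Omega> u a 0] by simp

text \<open>Apply the bound on Q = 1 to u / Q(u)^(1/p); f is homogeneous of degree 1 and Q of degree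
  p.\<close>

lemma f_le:
  assumes u: "u \<in> \<D>" shows "f u \<le> C * Q u powr (1 / p)"
proof (cases "Q u = 0")
  case True
  then have "u = (\<lambda>x. 0)" by (rule Q_eq_0[OF u])
  then have "f u = 0" using f_scale[OF u, of 0] by simp
  then show ?thesis using C by simp
next
  case False
  then have pos: "0 < Q u" using Q_nonneg[OF u] by simp
  define s where "s = Q u powr (1 / p)"
  have s: "0 < s" "s powr p = Q u" using pos p by (simp_all add: s_def powr_powr)
  have "Q (\<lambda>x. (1 / s) * u x) = 1"
    using s pos by (simp only: Q_scale[OF u]) (simp add: powr_divide)
  from f_bounded[OF scale_in[OF u] this] have "(1 / s) * f u \<le> C"
    by (simp only: f_scale[OF u])
  then show ?thesis using s(1) by (simp add: s_def[symmetric] field_simps)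
qed

text \<open>The derivative of Q along \<zeta> is p times the left-hand side of the equation tested
  with \<zeta>; the coefficient of \<open>f\<close> matches this factor.\<close>

definition J :: "(real^'n \<Rightarrow> real) \<Rightarrow> real" where
  "J u = Q u - p * f u"

lemma Q_powr: "u \<in> \<D> \<Longrightarrow> (Q u powr (1 / p)) powr p = Q u"
  using p Q_nonneg by (simp add: powr_powr)

text \<open>With s = Q(u)^(1/p) the bound on f turns J(u) \<le> A into s^p \<le> A + p C s, and p >
  1 lets the linear term be absorbed.\<close>

lemma Q_root_le:
  assumes "u \<in> \<D>" "J u \<le> A" "0 \<le> A"
  shows "Q u powr (1 / p) \<le> 1 + (A + p * C) powr (1 / (p - 1))"
proof (rule powr_le_affine_imp_bounded[OF p assms(3)])
  have "p * f u \<le> p * (C * Q u powr (1 / p))"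
    using p by (intro mult_left_mono f_le assms) auto
  then show "(Q u powr (1 / p)) powr p \<le> A + p * C * Q u powr (1 / p)"
    using assms(2) by (simp only: Q_powr[OF assms(1)]) (simp add: J_def)
qed (use p C in auto)

text \<open>Only functions with J \<le> 0 matter. For them Q is bounded by a fixed constant, hence f
  is bounded above.\<close>

lemma J_bounded_below:
  obtains L where "\<And>u. u \<in> \<D> \<Longrightarrow> L \<le> J u"
proof (rule that)
  fix u assume u: "u \<in> \<D>"
  define S where "S = 1 + (0 + p * C) powr (1 / (p - 1))"
  show "- (p * (C * (1 + (0 + p * C) powr (1 / (p - 1))))) \<le> J u"
  proof (cases "J u \<le> 0")
    case True
    have "Q u powr (1 / p) \<le> S" unfolding S_def by (rule Q_root_le[OF u True]) simp
    then have "p * f u \<le> p * (C * S)"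
      using p C order_trans[OF f_le[OF u] mult_left_mono] by (intro mult_left_mono) auto
    then show ?thesis using Q_nonneg[OF u] by (simp add: J_def S_def)
  next
    case False
    have "0 \<le> p * (C * S)" using p C by (simp add: S_def)
    then show ?thesis using False by (simp add: S_def)
  qed
qed

text \<open>The explicit error 1 / (n + 1) against every competitor replaces any reference to the
  infimum. It is inherited by subsequences because their indices only grow.\<close>

definition minimizing :: "(nat \<Rightarrow> real^'n \<Rightarrow> real) \<Rightarrow> bool" where
  "minimizing \<phi> \<longleftrightarrow> (\<forall>n. \<phi> n \<in> \<D>) \<and> (\<forall>n. \<forall>u\<in>\<D>. J (\<phi> n) \<le> J u + 1 / real (Suc n))"

lemma ex_minimizing: "\<exists>\<phi>. minimizing \<phi>"
proof -
  obtain L where L: "\<And>u. u \<in> \<D> \<Longrightarrow> L \<le> J u" by (rule J_bounded_below) (rule that)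
  have bdd: "bdd_below (J ` \<D>)" by (rule bdd_belowI2[of _ L]) (rule L)
  have ne: "J ` \<D> \<noteq> {}" using zero_test_function by auto
  have "\<exists>u\<in>\<D>. J u < Inf (J ` \<D>) + 1 / real (Suc n)" for n
  proof -
    have "Inf (J ` \<D>) < Inf (J ` \<D>) + 1 / real (Suc n)" by simp
    from cInf_lessD[OF ne this] show ?thesis by blast
  qed
  then obtain \<phi> where \<phi>: "\<And>n. \<phi> n \<in> \<D>" "\<And>n. J (\<phi> n) < Inf (J ` \<D>) + 1 / real (Suc n)"
    by metis
  have "J (\<phi> n) \<le> J u + 1 / real (Suc n)" if "u \<in> \<D>" for n u
    using \<phi>(2)[of n] cInf_lower[OF imageI[OF that, of J] bdd] by linarith
  then show ?thesis using \<phi>(1) by (auto simp: minimizing_def)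
qed

lemma minimizing_subseq:
  assumes "minimizing \<phi>" "strict_mono r" shows "minimizing (\<lambda>n. \<phi> (r n))"
proof -
  have "1 / real (Suc (r n)) \<le> 1 / real (Suc n)" for n
    using seq_suble[OF assms(2), of n] by (simp add: frac_le)
  then show ?thesis
    using assms(1) unfolding minimizing_def by (meson add_left_mono order_trans)
qed

lemma minimizing_Q_bounded:
  assumes "minimizing \<phi>" obtains q where "\<And>n. Q (\<phi> n) \<le> q"
proof -
  have D: "\<phi> n \<in> \<D>" for n using assms by (simp add: minimizing_def)
  have J: "J (\<phi> n) \<le> \<bar>J (\<phi> 0)\<bar> + 1" for n
  proof -
    have "J (\<phi> n) \<le> J (\<phi> 0) + 1 / real (Suc n)" using assms D by (simp add: minimizing_def)
    moreover have "1 / real (Suc n) \<le> 1" by simp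
    ultimately show ?thesis by linarith
  qed
  define S where "S = 1 + ((\<bar>J (\<phi> 0)\<bar> + 1) + p * C) powr (1 / (p - 1))"
  have "Q (\<phi> n) \<le> S powr p" for n
  proof -
    have "Q (\<phi> n) powr (1 / p) \<le> S" unfolding S_def by (rule Q_root_le[OF D J]) simp
    then have "(Q (\<phi> n) powr (1 / p)) powr p \<le> S powr p"
      using p by (intro powr_mono2) auto
    then show ?thesis by (simp only: Q_powr[OF D])
  qed
  then show ?thesis by (rule that)
qed

text \<open>On a compact set the continuous weight \<open>W\<close> has a positive minimum, so the
  weighted bound coming from coercivity becomes an unweighted one.\<close>

lemma minimizing_Lp_bounded:
  assumes \<phi>: "minimizing \<phi>" and K: "compact K" "K \<subseteq> \<Omega>"
  obtains A where "0 \<le> A" "\<And>n. (\<integral>x. indicator K x * \<bar>\<phi> n x\<bar> powr p \<partial>M) \<le> A"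
proof -
  have D: "\<phi> n \<in> \<D>" for n using \<phi> by (simp add: minimizing_def)
  obtain q where q: "\<And>n. Q (\<phi> n) \<le> q" by (rule minimizing_Q_bounded[OF \<phi>]) (rule that)
  obtain c where c: "0 < c" "\<And>x. x \<in> K \<Longrightarrow> c \<le> W x"
  proof (cases "K = {}")
    case False
    then obtain z where z: "z \<in> K" "\<And>x. x \<in> K \<Longrightarrow> W z \<le> W x"
      using continuous_attains_inf[OF K(1) _ continuous_on_subset[OF W_cont K(2)]] by blast
    show ?thesis by (rule that[of "W z"]) (use z W_pos K in auto)
  qed (use that[of 1] in auto)
  have "c * (\<integral>x. indicator K x * \<bar>\<phi> n x\<bar> powr p \<partial>M) \<le> q" for n
  proof -
    have "c * (\<integral>x. indicator K x * \<bar>\<phi> n x\<bar> powr p \<partial>M) = (\<integral>x. c * (indicator K x * \<bar>\<phi> n x\<bar> powr p) \<partial>M)"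
      by simp
    also have "\<dots> \<le> (\<integral>x. W x * \<bar>\<phi> n x\<bar> powr p \<partial>M)"
    proof (rule integral_mono[OF _ int_W[OF D]])
      show "integrable M (\<lambda>x. c * (indicator K x * \<bar>\<phi> n x\<bar> powr p))"
        by (intro integrable_mult_right integrable_ind cont_powr D K)
      fix x assume "x \<in> space M"
      then have "x \<in> \<Omega>" by simp
      then show "c * (indicator K x * \<bar>\<phi> n x\<bar> powr p) \<le> W x * \<bar>\<phi> n x\<bar> powr p"
        using c(2)[of x] W_pos[of x] by (cases "x \<in> K") (auto intro!: mult_right_mono)
    qed
    also have "\<dots> \<le> Q (\<phi> n)" by (rule coercive[OF D])
    finally show ?thesis using q[of n] by linarith
  qed
  then have "(\<integral>x. indicator K x * \<bar>\<phi> n x\<bar> powr p \<partial>M) \<le> \<bar>q / c\<bar>" for n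
    using c(1) by (intro order_trans[OF _ abs_ge_self]) (simp add: field_simps)
  then show ?thesis using that[of "\<bar>q / c\<bar>"] by simp
qed

end

section \<open>Local bounds for minimizing sequences\<close>

context p_energy
begin

text \<open>Bundles a cutoff with its logarithmic gradient \<open>e\<close>. The product rule then
  reads grad (w \<eta>) = \<eta> (grad w + w e), with \<eta> as a common factor that can act as a
  convexity weight; the bound on \<eta> |e|^p controls the term that remains.\<close>

definition power_cutoff ::
    "(real^'n) set \<Rightarrow> (real^'n \<Rightarrow> real) \<Rightarrow> real \<Rightarrow> real \<Rightarrow> (real^'n \<Rightarrow> real^'n) \<Rightarrow> bool" where
  "power_cutoff K \<eta> c B e \<longleftrightarrow> \<eta> \<in> \<D> \<and> (\<forall>x. 0 \<le> \<eta> x) \<and> (\<forall>x. \<eta> x \<le> 1) \<and> 0 < c \<and> (\<forall>x\<in>K. c \<le> \<eta> x)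
    \<and> 0 \<le> B \<and> (\<forall>x. grad \<eta> x = \<eta> x *\<^sub>R e x) \<and> (\<forall>x. \<eta> x * norm (e x) powr p \<le> B)"

lemma ex_power_cutoff_in_domain:
  assumes "compact K" "K \<subseteq> \<Omega>"
  shows "\<exists>\<eta> c B e. power_cutoff K \<eta> c B e"
proof -
  have "1 \<le> p" using p by simp
  then obtain \<eta> c B e where "\<eta> \<in> \<D>" "\<And>x. 0 \<le> \<eta> x" "\<And>x. \<eta> x \<le> 1"
    "0 < c" "\<And>x. x \<in> K \<Longrightarrow> c \<le> \<eta> x"
    "0 \<le> B" "\<And>x. grad \<eta> x = \<eta> x *\<^sub>R e x" "\<And>x. \<eta> x * norm (e x) powr p \<le> B"
    by (rule ex_power_cutoff[OF opn assms]) (rule that)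
  then have "power_cutoff K \<eta> c B e" unfolding power_cutoff_def by simp
  then show ?thesis by (intro exI)
qed

lemma power_cutoffD:
  assumes "power_cutoff K \<eta> c B e"
  shows "\<eta> \<in> \<D>" "0 \<le> \<eta> x" "\<eta> x \<le> 1" "0 < c" "x \<in> K \<Longrightarrow> c \<le> \<eta> x" "0 \<le> B"
    "grad \<eta> x = \<eta> x *\<^sub>R e x" "\<eta> x * norm (e x) powr p \<le> B"
  using assms by (auto simp: power_cutoff_def)

lemma int_cutoff:
  assumes "\<eta> \<in> \<D>" "continuous_on UNIV F"
  shows "integrable M (\<lambda>x. \<eta> x * F x)"
proof -
  obtain K where K: "compact K" "K \<subseteq> \<Omega>" "\<And>x. x \<notin> K \<Longrightarrow> \<eta> x = 0"
    by (rule test_function_support[OF assms(1)]) (rule that)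
  have "continuous_on UNIV (\<lambda>x. \<eta> x * F x)"
    by (intro continuous_on_mult assms smooth_imp_continuous_on[OF test_functions_smooth[OF assms(1)]])
  then show ?thesis
    by (rule integrable_compact[OF _ K(1,2)]) (use K(3) in simp)
qed

lemma grad_mult_cutoff:
  assumes "power_cutoff K \<eta> c B e" "w \<in> \<D>"
  shows "grad (\<lambda>x. w x * \<eta> x) x = \<eta> x *\<^sub>R (grad w x + w x *\<^sub>R e x)"
  using power_cutoffD[OF assms(1)] assms(2)
  by (subst grad_mult) (auto simp: test_functions_smooth algebra_simps)

lemma cutoff_powr_le:
  assumes "power_cutoff K \<eta> c B e"
  shows "\<eta> x * norm (t *\<^sub>R e x) powr p \<le> B * \<bar>t\<bar> powr p"
  unfolding norm_scaleR_powr
  using mult_right_mono[OF power_cutoffD(8)[OF assms, of x], of "\<bar>t\<bar> powr p"] by (simp add: mult_ac)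

text \<open>Since \<eta> \<le> 1 and p > 1, the factor \<eta>^p may be replaced by \<eta>. After
  splitting the sum, this factor weights |grad w|^p in one term and turns |e|^p into the constant
  \<open>B\<close> in the other.\<close>

lemma norm_grad_mult_cutoff_le:
  assumes "power_cutoff K \<eta> c B e" "w \<in> \<D>" "\<forall>x. x \<notin> S \<longrightarrow> \<eta> x = 0"
  shows "norm (grad (\<lambda>x. w x * \<eta> x) x) powr p
    \<le> 2 powr p * (\<eta> x * norm (grad w x) powr p + B * (indicator S x * \<bar>w x\<bar> powr p))"
proof (cases "x \<in> S")
  case True
  note \<eta> = power_cutoffD[OF assms(1)]
  have "norm (grad (\<lambda>x. w x * \<eta> x) x) powr p = \<eta> x powr p * norm (grad w x + w x *\<^sub>R e x) powr p"
    unfolding grad_mult_cutoff[OF assms(1,2)] norm_scaleR_powr using \<eta>(2)[of x] by simp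
  also have "\<dots> \<le> \<eta> x * norm (grad w x + w x *\<^sub>R e x) powr p"
  proof (rule mult_right_mono)
    have "\<eta> x powr p \<le> \<eta> x powr 1" using \<eta>(2,3)[of x] p by (intro powr_mono') auto
    then show "\<eta> x powr p \<le> \<eta> x" using \<eta>(2)[of x] by simp
  qed simp
  also have "\<dots> \<le> \<eta> x * (2 powr p * (norm (grad w x) powr p + norm (w x *\<^sub>R e x) powr p))"
    using p \<eta>(2)[of x] by (intro mult_left_mono norm_add_powr_le) auto
  also have "\<dots> = 2 powr p * (\<eta> x * norm (grad w x) powr p + \<eta> x * norm (w x *\<^sub>R e x) powr p)"
    by (simp only: distrib_left mult_ac)
  also have "\<dots> \<le> 2 powr p * (\<eta> x * norm (grad w x) powr p + B * \<bar>w x\<bar> powr p)"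
    by (intro mult_left_mono add_left_mono cutoff_powr_le[OF assms(1)]) simp
  finally show ?thesis using True by simp
next
  case False
  then have "grad (\<lambda>x. w x * \<eta> x) x = 0"
    unfolding grad_mult_cutoff[OF assms(1,2)] using assms(3) by simp
  then show ?thesis using False assms(3) by simp
qed

lemma integral_grad_mult_cutoff_le:
  assumes cut: "power_cutoff K \<eta> c B e" and w: "w \<in> \<D>"
    and S: "compact S" "S \<subseteq> \<Omega>" "\<And>x. x \<notin> S \<Longrightarrow> \<eta> x = 0"
  shows "(\<integral>x. norm (grad (\<lambda>x. w x * \<eta> x) x) powr p \<partial>M)
    \<le> 2 powr p * ((\<integral>x. \<eta> x * norm (grad w x) powr p \<partial>M) + B * (\<integral>x. indicator S x * \<bar>w x\<bar> powr p \<partial>M))"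
proof -
  note \<eta> = power_cutoffD[OF cut]
  have iX: "integrable M (\<lambda>x. \<eta> x * norm (grad w x) powr p)"
    by (rule int_cutoff[OF \<eta>(1) cont_grad_powr[OF w]])
  have iS: "integrable M (\<lambda>x. indicator S x * \<bar>w x\<bar> powr p)"
    by (rule integrable_ind[OF cont_powr[OF w] S(1,2)])
  have "(\<integral>x. norm (grad (\<lambda>x. w x * \<eta> x) x) powr p \<partial>M)
      \<le> (\<integral>x. 2 powr p * (\<eta> x * norm (grad w x) powr p + B * (indicator S x * \<bar>w x\<bar> powr p)) \<partial>M)"
  proof (rule integral_mono[OF int_grad])
    show "(\<lambda>x. w x * \<eta> x) \<in> \<D>"
      by (rule test_functions_mult_smooth[OF w test_functions_smooth[OF \<eta>(1)]])
    show "integrable M (\<lambda>x. 2 powr p * (\<eta> x * norm (grad w x) powr p + B * (indicator S x * \<bar>w x\<bar> powr p)))"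
      by (intro integrable_mult_right Bochner_Integration.integrable_add iX iS)
    show "norm (grad (\<lambda>x. w x * \<eta> x) x) powr p
        \<le> 2 powr p * (\<eta> x * norm (grad w x) powr p + B * (indicator S x * \<bar>w x\<bar> powr p))" for x
      by (rule norm_grad_mult_cutoff_le[OF cut w]) (use S(3) in blast)
  qed
  also have "\<dots> = 2 powr p * ((\<integral>x. \<eta> x * norm (grad w x) powr p \<partial>M) + B * (\<integral>x. indicator S x * \<bar>w x\<bar> powr p \<partial>M))"
    unfolding integral_mult_right_zero
    by (subst Bochner_Integration.integral_add[OF iX integrable_mult_right[OF iS]]) simp
  finally show ?thesis .
qed

lemma cont_gap:
  assumes "v \<in> \<D>" "w \<in> \<D>"
  shows "continuous_on UNIV (\<lambda>x. powr_gap p (grad v x) (grad w x))"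
proof -
  have "continuous_on UNIV (\<lambda>x. norm ((1/2) *\<^sub>R (grad v x + grad w x)) powr p)"
    using p assms[THEN test_functions_smooth]
    by (intro continuous_on_norm_powr continuous_on_scaleR continuous_on_add continuous_on_const continuous_on_grad) auto
  then show ?thesis
    unfolding powr_gap_def
    by (intro continuous_on_diff continuous_on_divide continuous_on_add continuous_on_const cont_grad_powr assms) auto
qed

end

context coercive_energy
begin

lemma minimizingD:
  assumes "minimizing \<phi>"
  shows "\<phi> n \<in> \<D>" "u \<in> \<D> \<Longrightarrow> J (\<phi> n) \<le> J u + 1 / real (Suc n)" "u \<in> \<D> \<Longrightarrow> J (\<phi> n) \<le> J u + 1"
proof -
  show "\<phi> n \<in> \<D>" using assms by (simp add: minimizing_def)
  show *: "J (\<phi> n) \<le> J u + 1 / real (Suc n)" if "u \<in> \<D>" using assms that unfolding minimizing_def by blast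
  show "J (\<phi> n) \<le> J u + 1" if "u \<in> \<D>"
  proof -
    have "1 / real (Suc n) \<le> 1" by simp
    then show ?thesis using *[OF that] by linarith
  qed
qed

text \<open>Comparing \<open>\<phi>\<close> with \<open>(1 - \<eta>) \<phi>\<close> bounds the gradient on the support of \<open>\<eta>\<close>, since
  convexity makes the energy of \<open>(1 - \<eta>) \<phi>\<close> smaller by \<open>\<integral> \<eta> |\<nabla>\<phi>|\<^sup>p\<close>, up to
  terms that do not contain \<open>\<nabla>\<phi>\<close>.\<close>

lemma minimizing_grad_bounded:
  assumes \<phi>: "minimizing \<phi>" and cut: "power_cutoff K \<eta> c0 B e"
  obtains X where "\<And>n. (\<integral>x. \<eta> x * norm (grad (\<phi> n) x) powr p \<partial>M) \<le> X"
proof -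
  note \<eta> = power_cutoffD[OF cut] and D = minimizingD(1)[OF \<phi>]
  obtain S where S: "compact S" "S \<subseteq> \<Omega>" "\<And>x. x \<notin> S \<Longrightarrow> \<eta> x = 0"
    by (rule test_function_support[OF \<eta>(1)]) (rule that)
  obtain A where A: "0 \<le> A" "\<And>n. (\<integral>x. indicator S x * \<bar>\<phi> n x\<bar> powr p \<partial>M) \<le> A"
    by (rule minimizing_Lp_bounded[OF \<phi> S(1,2)]) (rule that)
  obtain c where c: "0 \<le> c"
    "\<And>F G. integrable M F \<Longrightarrow> integrable M G \<Longrightarrow> \<forall>x. x \<notin> S \<longrightarrow> F x = 0 \<Longrightarrow> \<forall>x. \<bar>F x\<bar> \<le> G x \<Longrightarrow>
      \<bar>\<integral>x. V x * F x \<partial>M\<bar> \<le> c * (\<integral>x. G x \<partial>M)"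
    by (rule V_mult_bound[OF S(1,2)]) (rule that)
  \<comment> \<open>Chosen so that s = Q(\<eta> \<phi>)^(1/p) will satisfy s^p \<le> A' + 2^p p C s;
    \<open>S2\<close> is the resulting bound for s. Both are independent of the index.\<close>
  define A' where "A' = 2 powr p * (2 * B * A + c * A + 1) + c * A"
  define S2 where "S2 = 1 + (A' + 2 powr p * p * C) powr (1 / (p - 1))"
  have A': "0 \<le> A'" using A \<eta>(6) c(1) by (simp add: A'_def)
  have "(\<integral>x. \<eta> x * norm (grad (\<phi> n) x) powr p \<partial>M) \<le> B * A + c * A + 1 + p * (C * S2)" for n
  proof -
    define w where "w = \<phi> n"
    define X where "X = (\<integral>x. \<eta> x * norm (grad w x) powr p \<partial>M)"
    define u2 where "u2 x = w x * \<eta> x" for x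
    define u1 where "u1 x = 1 * w x + (- 1) * u2 x" for x
    have w: "w \<in> \<D>" unfolding w_def by (rule D)
    have u2: "u2 \<in> \<D>"
      unfolding u2_def by (rule test_functions_mult_smooth[OF w test_functions_smooth[OF \<eta>(1)]])
    have u1: "u1 \<in> \<D>" unfolding u1_def by (rule test_functions_lincomb[OF w u2])
    have iX: "integrable M (\<lambda>x. \<eta> x * norm (grad w x) powr p)"
      by (rule int_cutoff[OF \<eta>(1) cont_grad_powr[OF w]])
    have iS: "integrable M (\<lambda>x. indicator S x * \<bar>w x\<bar> powr p)"
      by (rule integrable_ind[OF cont_powr[OF w] S(1,2)])
    have AS: "(\<integral>x. indicator S x * \<bar>w x\<bar> powr p \<partial>M) \<le> A"
      unfolding w_def by (rule A(2))
    \<comment> \<open>The gradient of (1 - \<eta>) w is the convex combination of grad w and - w e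
      with weight \<eta>; the second vector contains no derivative of w.\<close>
    have pt1: "norm (grad u1 x) powr p - norm (grad w x) powr p
        \<le> B * (indicator S x * \<bar>w x\<bar> powr p) - \<eta> x * norm (grad w x) powr p" for x
    proof -
      have "grad u1 x = 1 *\<^sub>R grad w x + (- 1) *\<^sub>R grad u2 x"
        unfolding u1_def by (rule grad_lincomb[OF test_functions_smooth[OF w] test_functions_smooth[OF u2]])
      also have "grad u2 x = \<eta> x *\<^sub>R (grad w x + w x *\<^sub>R e x)"
        unfolding u2_def by (rule grad_mult_cutoff[OF cut w])
      finally have "grad u1 x = (1 - \<eta> x) *\<^sub>R grad w x + \<eta> x *\<^sub>R ((- w x) *\<^sub>R e x)"
        by (simp add: algebra_simps)
      then have "norm (grad u1 x) powr p \<le> (1 - \<eta> x) * norm (grad w x) powr p + \<eta> x * norm ((- w x) *\<^sub>R e x) powr p"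
        using norm_powr_convex_combination[of p "\<eta> x" "grad w x" "(- w x) *\<^sub>R e x"] p \<eta>(2,3)[of x] by simp
      moreover have "\<eta> x * norm ((- w x) *\<^sub>R e x) powr p \<le> B * (indicator S x * \<bar>w x\<bar> powr p)"
        using cutoff_powr_le[OF cut, of x "- w x"] S(3)[of x] by (cases "x \<in> S") auto
      ultimately show ?thesis by (simp add: left_diff_distrib)
    qed
    have "(\<integral>x. norm (grad u1 x) powr p - norm (grad w x) powr p \<partial>M)
        \<le> (\<integral>x. B * (indicator S x * \<bar>w x\<bar> powr p) - \<eta> x * norm (grad w x) powr p \<partial>M)"
    proof (rule integral_mono)
      show "integrable M (\<lambda>x. norm (grad u1 x) powr p - norm (grad w x) powr p)"
        by (intro Bochner_Integration.integrable_diff int_grad u1 w)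
      show "integrable M (\<lambda>x. B * (indicator S x * \<bar>w x\<bar> powr p) - \<eta> x * norm (grad w x) powr p)"
        by (intro Bochner_Integration.integrable_diff integrable_mult_right iS iX)
    qed (rule pt1)
    also have "\<dots> = B * (\<integral>x. indicator S x * \<bar>w x\<bar> powr p \<partial>M) - X"
      unfolding X_def by (subst Bochner_Integration.integral_diff[OF integrable_mult_right[OF iS] iX]) simp
    also have "\<dots> \<le> B * A - X"
      using AS \<eta>(6) by (intro diff_right_mono mult_left_mono) auto
    finally have G1: "(\<integral>x. norm (grad u1 x) powr p - norm (grad w x) powr p \<partial>M) \<le> B * A - X" .
    have abs_u1: "\<bar>u1 x\<bar> \<le> \<bar>w x\<bar>" and u1_out: "x \<notin> S \<Longrightarrow> u1 x = w x" and abs_u2: "\<bar>u2 x\<bar> \<le> \<bar>w x\<bar>" for x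
    proof -
      have "u1 x = (1 - \<eta> x) * w x" by (simp add: u1_def u2_def algebra_simps)
      then have "\<bar>u1 x\<bar> = (1 - \<eta> x) * \<bar>w x\<bar>"
        using \<eta>(3)[of x] by (simp add: abs_mult)
      then show "\<bar>u1 x\<bar> \<le> \<bar>w x\<bar>" using \<eta>(2,3)[of x] mult_right_mono[of "1 - \<eta> x" 1 "\<bar>w x\<bar>"] by simp
      show "u1 x = w x" if "x \<notin> S" using S(3)[OF that] by (simp add: u1_def u2_def)
      show "\<bar>u2 x\<bar> \<le> \<bar>w x\<bar>"
        using \<eta>(2,3)[of x] mult_left_mono[of "\<eta> x" 1 "\<bar>w x\<bar>"] by (simp add: u2_def abs_mult)
    qed
    have "\<bar>\<integral>x. V x * (\<bar>u1 x\<bar> powr p - \<bar>w x\<bar> powr p) \<partial>M\<bar> \<le> c * (\<integral>x. indicator S x * \<bar>w x\<bar> powr p \<partial>M)"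
    proof (rule c(2)[OF Bochner_Integration.integrable_diff[OF int_powr[OF u1] int_powr[OF w]] iS])
      show "\<forall>x. \<bar>\<bar>u1 x\<bar> powr p - \<bar>w x\<bar> powr p\<bar> \<le> indicator S x * \<bar>w x\<bar> powr p"
      proof
        fix x
        have "\<bar>u1 x\<bar> powr p \<le> \<bar>w x\<bar> powr p" "0 \<le> \<bar>u1 x\<bar> powr p"
          using p abs_u1[of x] by (auto intro!: powr_mono2)
        then have "\<bar>\<bar>u1 x\<bar> powr p - \<bar>w x\<bar> powr p\<bar> \<le> \<bar>w x\<bar> powr p" by (simp add: abs_le_iff)
        then show "\<bar>\<bar>u1 x\<bar> powr p - \<bar>w x\<bar> powr p\<bar> \<le> indicator S x * \<bar>w x\<bar> powr p"
          using u1_out[of x] by (cases "x \<in> S") auto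
      qed
    qed (use u1_out in simp)
    also have "\<dots> \<le> c * A" by (intro mult_left_mono AS c(1))
    finally have G2: "\<bar>\<integral>x. V x * (\<bar>u1 x\<bar> powr p - \<bar>w x\<bar> powr p) \<partial>M\<bar> \<le> c * A" .
    have "f u1 = 1 * f w + (- 1) * f u2" unfolding u1_def by (rule f_linear[OF w u2])
    then have fu: "f u1 = f w - f u2" by simp
    have "J w \<le> J u1 + 1" unfolding w_def by (rule minimizingD(3)[OF \<phi> u1])
    then have "0 \<le> (Q u1 - Q w) + p * f u2 + 1" unfolding J_def fu by (simp add: right_diff_distrib)
    then have X1: "X \<le> B * A + c * A + 1 + p * f u2"
      unfolding Q_diff[OF u1 w] using G1 G2 by linarith
    have "(\<integral>x. norm (grad u2 x) powr p \<partial>M) \<le> 2 powr p * (X + B * (\<integral>x. indicator S x * \<bar>w x\<bar> powr p \<partial>M))"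
      unfolding u2_def X_def by (rule integral_grad_mult_cutoff_le[OF cut w S])
    also have "\<dots> \<le> 2 powr p * (X + B * A)"
      using \<eta>(6) by (intro mult_left_mono add_left_mono AS) auto
    finally have H1: "(\<integral>x. norm (grad u2 x) powr p \<partial>M) \<le> 2 powr p * (X + B * A)" .
    have "\<bar>\<integral>x. V x * \<bar>u2 x\<bar> powr p \<partial>M\<bar> \<le> c * (\<integral>x. indicator S x * \<bar>w x\<bar> powr p \<partial>M)"
    proof (rule c(2)[OF int_powr[OF u2] iS])
      show "\<forall>x. \<bar>\<bar>u2 x\<bar> powr p\<bar> \<le> indicator S x * \<bar>w x\<bar> powr p"
      proof
        fix x
        show "\<bar>\<bar>u2 x\<bar> powr p\<bar> \<le> indicator S x * \<bar>w x\<bar> powr p"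
          using p abs_u2[of x] S(3)[of x] by (cases "x \<in> S") (auto simp: u2_def intro!: powr_mono2)
      qed
    qed (use S(3) in \<open>simp add: u2_def\<close>)
    also have "\<dots> \<le> c * A" by (intro mult_left_mono AS c(1))
    finally have H2: "\<bar>\<integral>x. V x * \<bar>u2 x\<bar> powr p \<partial>M\<bar> \<le> c * A" .
    \<comment> \<open>At this point X is bounded by f(\<eta> w), f(\<eta> w) by a multiple of s, and
      s^p again by X. The loop closes because s enters the bound for X only linearly.\<close>
    define s where "s = Q u2 powr (1 / p)"
    have fs: "p * f u2 \<le> p * (C * s)"
      unfolding s_def using p by (intro mult_left_mono f_le[OF u2]) auto
    have "s powr p = Q u2" unfolding s_def by (rule Q_powr[OF u2])
    also have "\<dots> \<le> 2 powr p * (X + B * A) + c * A"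
      unfolding Q_form_def using H1 H2 by linarith
    also have "\<dots> \<le> 2 powr p * ((B * A + c * A + 1 + p * (C * s)) + B * A) + c * A"
      using X1 fs by (intro add_right_mono mult_left_mono) auto
    also have "\<dots> = A' + 2 powr p * p * C * s"
      by (simp add: A'_def algebra_simps)
    finally have "s \<le> S2"
      unfolding S2_def using p A' C by (intro powr_le_affine_imp_bounded) (auto simp: s_def)
    then have "p * (C * s) \<le> p * (C * S2)" using p C by (intro mult_left_mono) auto
    then show ?thesis using X1 fs unfolding X_def w_def by linarith
  qed
  then show ?thesis by (rule that)
qed

lemma minimizing_cutoff_grad_bounded:
  assumes \<phi>: "minimizing \<phi>" and cut: "power_cutoff K \<eta> c0 B e"
  obtains Y where "\<And>n. (\<integral>x. norm (grad (\<lambda>x. \<phi> n x * \<eta> x) x) powr p \<partial>M) \<le> Y"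
proof -
  note \<eta> = power_cutoffD[OF cut] and D = minimizingD(1)[OF \<phi>]
  obtain S where S: "compact S" "S \<subseteq> \<Omega>" "\<And>x. x \<notin> S \<Longrightarrow> \<eta> x = 0"
    by (rule test_function_support[OF \<eta>(1)]) (rule that)
  obtain A where A: "0 \<le> A" "\<And>n. (\<integral>x. indicator S x * \<bar>\<phi> n x\<bar> powr p \<partial>M) \<le> A"
    by (rule minimizing_Lp_bounded[OF \<phi> S(1,2)]) (rule that)
  obtain X where X: "\<And>n. (\<integral>x. \<eta> x * norm (grad (\<phi> n) x) powr p \<partial>M) \<le> X"
    by (rule minimizing_grad_bounded[OF \<phi> cut]) (rule that)
  have "(\<integral>x. norm (grad (\<lambda>x. \<phi> n x * \<eta> x) x) powr p \<partial>M) \<le> 2 powr p * (X + B * A)" for n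
  proof -
    have "(\<integral>x. norm (grad (\<lambda>x. \<phi> n x * \<eta> x) x) powr p \<partial>M) \<le> 2 powr p * ((\<integral>x. \<eta> x * norm (grad (\<phi> n) x) powr p \<partial>M)
        + B * (\<integral>x. indicator S x * \<bar>\<phi> n x\<bar> powr p \<partial>M))"
      by (rule integral_grad_mult_cutoff_le[OF cut D S])
    also have "\<dots> \<le> 2 powr p * (X + B * A)"
      using \<eta>(6) by (intro mult_left_mono add_mono X A) auto
    finally show ?thesis .
  qed
  then show ?thesis by (rule that)
qed

definition Lp_cauchy :: "(nat \<Rightarrow> real^'n \<Rightarrow> real) \<Rightarrow> bool" where
  "Lp_cauchy \<phi> \<longleftrightarrow> (\<forall>K e. compact K \<and> K \<subseteq> \<Omega> \<and> 0 < e \<longrightarrow>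
    (\<exists>N. \<forall>m\<ge>N. \<forall>n\<ge>N. (\<integral>x. indicator K x * \<bar>\<phi> m x - \<phi> n x\<bar> powr p \<partial>M) \<le> e))"

text \<open>On the compact support of \<eta> one has |\<phi>| \<le> 1 + |\<phi>|^p, so the local L^p
  bound controls the integrals. Their boundedness is the input to the diagonal extraction.\<close>

lemma minimizing_cell_integrals_bounded:
  assumes \<phi>: "minimizing \<phi>" and cut: "power_cutoff K \<eta> c0 B e" and Z: "Z \<in> sets borel"
  shows "\<exists>b. \<forall>n. \<bar>\<integral>x. indicator Z x * (\<phi> n x * \<eta> x) \<partial>lborel\<bar> \<le> b"
proof -
  note \<eta> = power_cutoffD[OF cut] and D = minimizingD(1)[OF \<phi>]
  obtain S where S: "compact S" "S \<subseteq> \<Omega>" "\<And>x. x \<notin> S \<Longrightarrow> \<eta> x = 0"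
    by (rule test_function_support[OF \<eta>(1)]) (rule that)
  obtain A where A: "0 \<le> A" "\<And>n. (\<integral>x. indicator S x * \<bar>\<phi> n x\<bar> powr p \<partial>M) \<le> A"
    by (rule minimizing_Lp_bounded[OF \<phi> S(1,2)]) (rule that)
  have "\<bar>\<integral>x. indicator Z x * (\<phi> n x * \<eta> x) \<partial>lborel\<bar> \<le> (\<integral>x. indicator S x * (1::real) \<partial>M) + A" for n
  proof -
    have iS: "integrable M (\<lambda>x. indicator S x * \<bar>\<phi> n x\<bar> powr p)"
      by (rule integrable_ind[OF cont_powr[OF D] S(1,2)])
    have i1: "integrable M (\<lambda>x. indicator S x * (1::real))"
      by (rule integrable_ind[OF continuous_on_const S(1,2)])
    have "continuous_on UNIV (\<lambda>x. \<phi> n x * \<eta> x)"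
      by (intro continuous_on_mult smooth_imp_continuous_on test_functions_smooth[OF D] test_functions_smooth[OF \<eta>(1)])
    then have "(\<lambda>x. indicator Z x * (\<phi> n x * \<eta> x)) \<in> borel_measurable borel"
      using Z by (intro borel_measurable_times borel_measurable_indicator borel_measurable_continuous_onI)
    then have "(\<integral>x. indicator Z x * (\<phi> n x * \<eta> x) \<partial>lborel) = (\<integral>x. indicator Z x * (\<phi> n x * \<eta> x) \<partial>M)"
      using S by (intro lebesgue_on_integral_eq_lborel(2)[symmetric] \<Omega>_lebesgue) auto
    also have "\<bar>\<dots>\<bar> \<le> (\<integral>x. \<bar>indicator Z x * (\<phi> n x * \<eta> x)\<bar> \<partial>M)"
      by (rule integral_abs_bound)
    also have "\<dots> \<le> (\<integral>x. indicator S x * (1::real) + indicator S x * \<bar>\<phi> n x\<bar> powr p \<partial>M)"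
    proof (rule integral_mono')
      show "integrable M (\<lambda>x. indicator S x * (1::real) + indicator S x * \<bar>\<phi> n x\<bar> powr p)"
        by (intro Bochner_Integration.integrable_add i1 iS)
      fix x
      show "\<bar>indicator Z x * (\<phi> n x * \<eta> x)\<bar> \<le> indicator S x * (1::real) + indicator S x * \<bar>\<phi> n x\<bar> powr p"
      proof (cases "x \<in> S")
        case True
        have "\<bar>\<phi> n x\<bar> \<le> 1 + \<bar>\<phi> n x\<bar> powr p"
          using powr_le_one_plus_powr[of "\<bar>\<phi> n x\<bar>" 1 p] p by simp
        moreover have "\<bar>indicator Z x * (\<phi> n x * \<eta> x)\<bar> \<le> \<bar>\<phi> n x\<bar>"
          using \<eta>(2,3)[of x] mult_left_mono[of "\<eta> x" 1 "\<bar>\<phi> n x\<bar>"] by (cases "x \<in> Z") (auto simp: abs_mult)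
        ultimately show ?thesis using True by simp
      qed (simp add: S(3))
      show "0 \<le> indicator S x * (1::real) + indicator S x * \<bar>\<phi> n x\<bar> powr p" by simp
    qed
    also have "\<dots> = (\<integral>x. indicator S x * (1::real) \<partial>M) + (\<integral>x. indicator S x * \<bar>\<phi> n x\<bar> powr p \<partial>M)"
      by (rule Bochner_Integration.integral_add[OF i1 iS])
    also have "\<dots> \<le> (\<integral>x. indicator S x * (1::real) \<partial>M) + A" by (intro add_left_mono A)
    finally show ?thesis .
  qed
  then show ?thesis by blast
qed

end

section \<open>Strong convergence\<close>

context coercive_energy
begin

text \<open>Rellich applies to the compactly supported products of \<phi> with a cutoff for each
  member of an exhaustion of \<Omega>. Exhaustion index, grid size and cell label form a countable
  index set, so one subsequence makes all cell integrals converge.\<close>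

lemma ex_minimizing_Lp_cauchy: "\<exists>\<phi>. minimizing \<phi> \<and> Lp_cauchy \<phi>"
proof -
  obtain \<phi>0 where \<phi>0: "minimizing \<phi>0" using ex_minimizing by blast
  obtain Ce :: "nat \<Rightarrow> (real^'n) set" where Ce: "\<And>j. compact (Ce j)" "\<And>j. Ce j \<subseteq> \<Omega>"
    "\<And>K. compact K \<Longrightarrow> K \<subseteq> \<Omega> \<Longrightarrow> \<exists>N. \<forall>j\<ge>N. K \<subseteq> Ce j"
    by (rule open_Union_compact_subsets[OF opn]) (rule that)
  have "\<forall>j. \<exists>\<eta> c B e. power_cutoff (Ce j) \<eta> c B e"
    using ex_power_cutoff_in_domain Ce by blast
  then obtain \<eta> c B e where cut: "\<And>j. power_cutoff (Ce j) (\<eta> j) (c j) (B j) (e j)"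
    by metis
  define a where "a n i = (case i of (j, l, k) \<Rightarrow>
      \<integral>x. indicator (cell (1 / real (Suc l)) k) x * (\<phi>0 n x * \<eta> j x) \<partial>lborel)"
    for n :: nat and i :: "nat \<times> nat \<times> ('n \<Rightarrow> int)"
  have "\<exists>b. \<forall>n. \<bar>a n i\<bar> \<le> b" for i
    unfolding a_def split_def by (rule minimizing_cell_integrals_bounded[OF \<phi>0 cut cell_measurable])
  then obtain r :: "nat \<Rightarrow> nat" where r: "strict_mono r" "\<And>i. convergent (\<lambda>n. a (r n) i)"
    by (rule ex_subseq_all_convergent) (rule that)
  define \<phi> where "\<phi> n = \<phi>0 (r n)" for n
  have \<phi>: "minimizing \<phi>"
    unfolding \<phi>_def by (rule minimizing_subseq[OF \<phi>0 r(1)])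
  note D = minimizingD(1)[OF \<phi>]
  have "\<exists>N. \<forall>m\<ge>N. \<forall>n\<ge>N. (\<integral>x. indicator K x * \<bar>\<phi> m x - \<phi> n x\<bar> powr p \<partial>M) \<le> \<epsilon>"
    if K: "compact K" "K \<subseteq> \<Omega>" and \<epsilon>: "0 < \<epsilon>" for K \<epsilon>
  proof -
    obtain j where j: "K \<subseteq> Ce j" using Ce(3)[OF K] by blast
    note \<eta> = power_cutoffD[OF cut[of j]]
    obtain S where S: "compact S" "S \<subseteq> \<Omega>" "\<And>x. x \<notin> S \<Longrightarrow> \<eta> j x = 0"
      by (rule test_function_support[OF \<eta>(1)]) (rule that)
    define w where "w n x = \<phi> n x * \<eta> j x" for n x
    have wD: "w n \<in> \<D>" for n
      unfolding w_def by (rule test_functions_mult_smooth[OF D test_functions_smooth[OF \<eta>(1)]])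
    have w0: "w n x = 0" if "x \<notin> S" for n x using S(3)[OF that] by (simp add: w_def)
    have cw: "continuous_on UNIV (w n)" for n
      by (rule smooth_imp_continuous_on[OF test_functions_smooth[OF wD]])
    have weq: "w n = (\<lambda>x. \<phi> n x * \<eta> j x)" for n by (rule ext) (simp add: w_def)
    obtain Y where "\<And>n. (\<integral>x. norm (grad (\<lambda>x. \<phi> n x * \<eta> j x) x) powr p \<partial>M) \<le> Y"
      by (rule minimizing_cutoff_grad_bounded[OF \<phi> cut[of j]]) (rule that)
    then have Y: "(\<integral>x. norm (grad (w n) x) powr p \<partial>M) \<le> Y" for n
      by (simp only: weq)
    \<comment> \<open>The tolerance carries the factor \<open>c j powr p\<close> that is lost in
      returning from w = \<phi> \<eta> to \<phi>, since \<eta> \<ge> c on \<open>K\<close>.\<close>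
    have "\<exists>N. \<forall>m\<ge>N. \<forall>n\<ge>N. (\<integral>x. \<bar>w m x - w n x\<bar> powr p \<partial>lborel) \<le> c j powr p * \<epsilon>"
    proof (rule rellich_cauchy[OF _ S(1) _ p])
      show "smooth (w n)" for n by (rule test_functions_smooth[OF wD])
      show "w n x = 0" if "x \<notin> S" for n x using that by (rule w0)
      show "(\<integral>x. norm (grad (w n) x) powr p \<partial>lborel) \<le> Y" for n
      proof -
        have "norm (grad (w n) x) powr p = 0" if "x \<notin> \<Omega>" for x
        proof -
          have "x \<notin> S" using that S(2) by blast
          then have "grad (w n) x = 0"
            by (rule compact_support_grad_eq_0[OF S(1), rotated]) (rule w0)
          then show ?thesis by simp
        qed
        then have "(\<integral>x. norm (grad (w n) x) powr p \<partial>M) = (\<integral>x. norm (grad (w n) x) powr p \<partial>lborel)"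
          by (intro lebesgue_on_integral_eq_lborel(2) \<Omega>_lebesgue borel_measurable_continuous_onI cont_grad_powr wD)
        then show ?thesis using Y[of n] by simp
      qed
      show "convergent (\<lambda>n. \<integral>x. indicator (cell (1 / real (Suc l)) k) x * w n x \<partial>lborel)" for l k
        using r(2)[of "(j, l, k)"] by (simp add: a_def w_def \<phi>_def)
      show "0 < c j powr p * \<epsilon>" using \<eta>(4) \<epsilon> by simp
    qed
    then obtain N where N: "\<And>m n. N \<le> m \<Longrightarrow> N \<le> n \<Longrightarrow> (\<integral>x. \<bar>w m x - w n x\<bar> powr p \<partial>lborel) \<le> c j powr p * \<epsilon>"
      by blast
    have "(\<integral>x. indicator K x * \<bar>\<phi> m x - \<phi> n x\<bar> powr p \<partial>M) \<le> \<epsilon>" if mn: "N \<le> m" "N \<le> n" for m n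
    proof -
      have cwd: "continuous_on UNIV (\<lambda>x. \<bar>w m x - w n x\<bar> powr p)"
        using continuous_on_norm_powr[of UNIV "\<lambda>x. w m x - w n x" p] p by (simp add: continuous_on_diff cw)
      have iw: "integrable M (\<lambda>x. \<bar>w m x - w n x\<bar> powr p)"
        by (rule integrable_compact[OF cwd S(1,2)]) (simp add: w0)
      have c\<phi>: "continuous_on UNIV (\<lambda>x. \<bar>\<phi> m x - \<phi> n x\<bar> powr p)"
        using continuous_on_norm_powr[of UNIV "\<lambda>x. \<phi> m x - \<phi> n x" p] p
        by (simp add: continuous_on_diff smooth_imp_continuous_on test_functions_smooth[OF D])
      have "c j powr p * (\<integral>x. indicator K x * \<bar>\<phi> m x - \<phi> n x\<bar> powr p \<partial>M)
          = (\<integral>x. c j powr p * (indicator K x * \<bar>\<phi> m x - \<phi> n x\<bar> powr p) \<partial>M)"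
        by simp
      also have "\<dots> \<le> (\<integral>x. \<bar>w m x - w n x\<bar> powr p \<partial>M)"
      proof (rule integral_mono[OF _ iw])
        show "integrable M (\<lambda>x. c j powr p * (indicator K x * \<bar>\<phi> m x - \<phi> n x\<bar> powr p))"
          by (intro integrable_mult_right integrable_ind c\<phi> K)
        fix x
        show "c j powr p * (indicator K x * \<bar>\<phi> m x - \<phi> n x\<bar> powr p) \<le> \<bar>w m x - w n x\<bar> powr p"
        proof (cases "x \<in> K")
          case True
          then have "c j \<le> \<eta> j x" using \<eta>(5) j by blast
          then have "c j powr p \<le> \<eta> j x powr p" using \<eta>(4) p by (intro powr_mono2) auto
          then have "c j powr p * \<bar>\<phi> m x - \<phi> n x\<bar> powr p \<le> \<eta> j x powr p * \<bar>\<phi> m x - \<phi> n x\<bar> powr p"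
            by (rule mult_right_mono) simp
          also have "\<dots> = \<bar>w m x - w n x\<bar> powr p"
          proof -
            have "w m x - w n x = \<eta> j x * (\<phi> m x - \<phi> n x)" by (simp add: w_def algebra_simps)
            then show ?thesis using \<eta>(2)[of x] by (simp add: abs_mult powr_mult)
          qed
          finally show ?thesis using True by simp
        qed simp
      qed
      also have "\<dots> = (\<integral>x. \<bar>w m x - w n x\<bar> powr p \<partial>lborel)"
        using S(2) w0 by (intro lebesgue_on_integral_eq_lborel(2) \<Omega>_lebesgue borel_measurable_continuous_onI cwd)
          (metis abs_zero diff_self powr_0 subsetD)
      also have "\<dots> \<le> c j powr p * \<epsilon>" by (rule N[OF mn])
      finally show ?thesis using \<eta>(4) by simp
    qed
    then show ?thesis by blast
  qed
  then have "Lp_cauchy \<phi>" unfolding Lp_cauchy_def by blast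
  then show ?thesis using \<phi> by blast
qed

text \<open>Comparing \<open>\<phi>\<^sub>m\<close>, \<open>\<phi>\<^sub>n\<close> with \<open>\<phi>\<^sub>m - \<eta> d / 2\<close>, \<open>\<phi>\<^sub>n + \<eta> d / 2\<close>, where \<open>d = \<phi>\<^sub>m - \<phi>\<^sub>n\<close>: the sum of
  the two functions is unchanged, so the contributions of \<open>f\<close> cancel.\<close>

lemma minimizing_gap_bound:
  assumes \<phi>: "minimizing \<phi>" and cut: "power_cutoff K \<eta> c0 B e" and S: "compact S" "S \<subseteq> \<Omega>" "\<And>x. x \<notin> S \<Longrightarrow> \<eta> x = 0"
  obtains \<Lambda> where "0 \<le> \<Lambda>"
    "\<And>\<epsilon>. 0 < \<epsilon> \<Longrightarrow> \<exists>C'\<ge>0. \<forall>m n. (\<integral>x. \<eta> x * powr_gap p (grad (\<phi> m) x) (grad (\<phi> n) x) \<partial>M)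
      \<le> \<epsilon> * \<Lambda> + C' * (\<integral>x. indicator S x * \<bar>\<phi> m x - \<phi> n x\<bar> powr p \<partial>M) + 1 / real (Suc m) + 1 / real (Suc n)"
proof -
  note \<eta> = power_cutoffD[OF cut] and D = minimizingD(1)[OF \<phi>]
  obtain A where A: "0 \<le> A" "\<And>n. (\<integral>x. indicator S x * \<bar>\<phi> n x\<bar> powr p \<partial>M) \<le> A"
    by (rule minimizing_Lp_bounded[OF \<phi> S(1,2)]) (rule that)
  obtain X where X: "\<And>n. (\<integral>x. \<eta> x * norm (grad (\<phi> n) x) powr p \<partial>M) \<le> X"
    by (rule minimizing_grad_bounded[OF \<phi> cut]) (rule that)
  obtain c where c: "0 \<le> c"
    "\<And>F G. integrable M F \<Longrightarrow> integrable M G \<Longrightarrow> \<forall>x. x \<notin> S \<longrightarrow> F x = 0 \<Longrightarrow> \<forall>x. \<bar>F x\<bar> \<le> G x \<Longrightarrow>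
      \<bar>\<integral>x. V x * F x \<partial>M\<bar> \<le> c * (\<integral>x. G x \<partial>M)"
    by (rule V_mult_bound[OF S(1,2)]) (rule that)
  have X0: "0 \<le> X"
    using order_trans[OF Bochner_Integration.integral_nonneg X[of 0]] \<eta>(2) by simp
  \<comment> \<open>Collects what multiplies \<epsilon>: two weighted gradient energies of at most
    X, and two potential terms of at most \<open>c * (2 * A)\<close>.\<close>
  define \<Lambda> where "\<Lambda> = 2 * X + 2 * (c * (2 * A))"
  have \<Lambda>: "0 \<le> \<Lambda>" using X0 c(1) A(1) by (simp add: \<Lambda>_def)
  show ?thesis
  proof (rule that[OF \<Lambda>])
    fix \<epsilon> :: real assume \<epsilon>: "0 < \<epsilon>"
    have p1: "1 \<le> p" using p by simp
    obtain k1 where k1: "0 < k1" "\<And>a b :: real^'n. norm (a + b) powr p \<le> (1 + \<epsilon>) * norm a powr p + k1 * norm b powr p"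
      by (rule norm_add_powr_le_eps[OF p1 \<epsilon>]) (rule that)
    obtain k2 where k2: "0 < k2" "\<And>a b :: real. norm (a + b) powr p \<le> (1 + \<epsilon>) * norm a powr p + k2 * norm b powr p"
      by (rule norm_add_powr_le_eps[OF p1 \<epsilon>]) (rule that)
    define C' where "C' = 2 * (k1 * B) + 2 * (c * k2)"
    have C': "0 \<le> C'" using k1 k2 \<eta>(6) c(1) by (simp add: C'_def)
    have "(\<integral>x. \<eta> x * powr_gap p (grad (\<phi> m) x) (grad (\<phi> n) x) \<partial>M)
      \<le> \<epsilon> * \<Lambda> + C' * (\<integral>x. indicator S x * \<bar>\<phi> m x - \<phi> n x\<bar> powr p \<partial>M) + 1 / real (Suc m) + 1 / real (Suc n)" for m n
    proof -
      define v where "v = \<phi> m"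
      define w where "w = \<phi> n"
      have v: "v \<in> \<D>" and w: "w \<in> \<D>" unfolding v_def w_def by (rule D)+
      note sv = test_functions_smooth[OF v] and sw = test_functions_smooth[OF w]
      define I where "I = (\<integral>x. indicator S x * \<bar>v x - w x\<bar> powr p \<partial>M)"
      \<comment> \<open>Pointwise this is (1 - \<eta>/2) v + (\<eta>/2) w, and \<open>u2\<close> is
        the same with v and w exchanged. The nested linear combinations are written out so that
        linearity of f and of the gradient applies literally.\<close>
      define u1 where "u1 x = 1 * v x + (- 1 / 2) * (1 * (v x * \<eta> x) + (- 1) * (w x * \<eta> x))" for x
      define u2 where "u2 x = 1 * w x + (1 / 2) * (1 * (v x * \<eta> x) + (- 1) * (w x * \<eta> x))" for x
      have ve: "(\<lambda>x. v x * \<eta> x) \<in> \<D>" and we: "(\<lambda>x. w x * \<eta> x) \<in> \<D>"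
        by (rule test_functions_mult_smooth[OF _ test_functions_smooth[OF \<eta>(1)]], rule v w)+
      have de: "(\<lambda>x. 1 * (v x * \<eta> x) + (- 1) * (w x * \<eta> x)) \<in> \<D>"
        by (rule test_functions_lincomb[OF ve we])
      have u1: "u1 \<in> \<D>" unfolding u1_def by (rule test_functions_lincomb[OF v de])
      have u2: "u2 \<in> \<D>" unfolding u2_def by (rule test_functions_lincomb[OF w de])
      have gde: "grad (\<lambda>x. 1 * (v x * \<eta> x) + (- 1) * (w x * \<eta> x)) x
          = \<eta> x *\<^sub>R ((grad v x - grad w x) + (v x - w x) *\<^sub>R e x)" for x
        by (subst grad_lincomb[OF test_functions_smooth[OF ve] test_functions_smooth[OF we]],
            subst grad_mult_cutoff[OF cut v], subst grad_mult_cutoff[OF cut w])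
          (simp add: algebra_simps)
      \<comment> \<open>A convex combination with weight \<eta>: grad v is mixed with the mean of
        the two gradients, perturbed by a multiple of (v - w) e. Convexity thereby exchanges a
        fraction \<eta> of both energies for that of the mean.\<close>
      have gu1: "grad u1 x = (1 - \<eta> x) *\<^sub>R grad v x
          + \<eta> x *\<^sub>R ((1/2) *\<^sub>R (grad v x + grad w x) + (- (v x - w x) / 2) *\<^sub>R e x)" for x
      proof -
        have "grad u1 x = 1 *\<^sub>R grad v x + (- 1 / 2) *\<^sub>R (\<eta> x *\<^sub>R ((grad v x - grad w x) + (v x - w x) *\<^sub>R e x))"
          unfolding u1_def by (subst grad_lincomb[OF sv test_functions_smooth[OF de]], subst gde) (rule refl)
        also have "\<dots> = (1 - \<eta> x) *\<^sub>R grad v x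
          + \<eta> x *\<^sub>R ((1/2) *\<^sub>R (grad v x + grad w x) + (- (v x - w x) / 2) *\<^sub>R e x)"
          by (simp add: vec_eq_iff) (simp add: field_simps)
        finally show ?thesis .
      qed
      have gu2: "grad u2 x = (1 - \<eta> x) *\<^sub>R grad w x
          + \<eta> x *\<^sub>R ((1/2) *\<^sub>R (grad v x + grad w x) + ((v x - w x) / 2) *\<^sub>R e x)" for x
      proof -
        have "grad u2 x = 1 *\<^sub>R grad w x + (1 / 2) *\<^sub>R (\<eta> x *\<^sub>R ((grad v x - grad w x) + (v x - w x) *\<^sub>R e x))"
          unfolding u2_def by (subst grad_lincomb[OF sw test_functions_smooth[OF de]], subst gde) (rule refl)
        also have "\<dots> = (1 - \<eta> x) *\<^sub>R grad w x
          + \<eta> x *\<^sub>R ((1/2) *\<^sub>R (grad v x + grad w x) + ((v x - w x) / 2) *\<^sub>R e x)"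
          by (simp add: vec_eq_iff) (simp add: field_simps)
        finally show ?thesis .
      qed
      have half: "\<bar>t / 2\<bar> powr p \<le> \<bar>t\<bar> powr p" for t :: real
        using p by (intro powr_mono2) auto
      have conv: "norm ((1 - \<eta> x) *\<^sub>R a + \<eta> x *\<^sub>R (h + t *\<^sub>R e x)) powr p
          \<le> (1 - \<eta> x) * norm a powr p + \<eta> x * ((1 + \<epsilon>) * norm h powr p) + k1 * B * (indicator S x * \<bar>d\<bar> powr p)"
        if t: "\<bar>t\<bar> powr p \<le> \<bar>d\<bar> powr p" for x a h t d
      proof -
        have "norm ((1 - \<eta> x) *\<^sub>R a + \<eta> x *\<^sub>R (h + t *\<^sub>R e x)) powr p
            \<le> (1 - \<eta> x) * norm a powr p + \<eta> x * norm (h + t *\<^sub>R e x) powr p"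
          by (rule norm_powr_convex_combination[OF p1 \<eta>(2,3)])
        also have "\<eta> x * norm (h + t *\<^sub>R e x) powr p \<le> \<eta> x * ((1 + \<epsilon>) * norm h powr p + k1 * norm (t *\<^sub>R e x) powr p)"
          by (rule mult_left_mono[OF k1(2) \<eta>(2)])
        also have "\<dots> = \<eta> x * ((1 + \<epsilon>) * norm h powr p) + k1 * (\<eta> x * norm (t *\<^sub>R e x) powr p)"
          by (simp only: distrib_left mult_ac)
        also have "k1 * (\<eta> x * norm (t *\<^sub>R e x) powr p) \<le> k1 * (B * (indicator S x * \<bar>d\<bar> powr p))"
        proof (rule mult_left_mono)
          show "\<eta> x * norm (t *\<^sub>R e x) powr p \<le> B * (indicator S x * \<bar>d\<bar> powr p)"
          proof (cases "x \<in> S")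
            case True
            have "\<eta> x * norm (t *\<^sub>R e x) powr p \<le> B * \<bar>t\<bar> powr p" by (rule cutoff_powr_le[OF cut])
            also have "\<dots> \<le> B * \<bar>d\<bar> powr p" by (rule mult_left_mono[OF t \<eta>(6)])
            finally show ?thesis using True by simp
          qed (simp add: S(3))
        qed (use k1(1) in simp)
        finally show ?thesis by (simp add: mult.assoc)
      qed
      \<comment> \<open>With a, b, h the p-th powers belonging to grad v, grad w and their mean, the
        main terms add up to (1 - \<eta>)(a + b) + 2 \<eta> h - a - b, which is -2 \<eta> times the
        gap. In the error terms \<epsilon> h is bounded by \<epsilon> (a + b) / 2, since the gap is
        nonnegative.\<close>
      have pt: "(norm (grad u1 x) powr p - norm (grad v x) powr p) + (norm (grad u2 x) powr p - norm (grad w x) powr p)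
          \<le> \<epsilon> * (\<eta> x * norm (grad v x) powr p + \<eta> x * norm (grad w x) powr p)
            + 2 * (k1 * B) * (indicator S x * \<bar>v x - w x\<bar> powr p)
            - 2 * (\<eta> x * powr_gap p (grad v x) (grad w x))" for x
      proof -
        define a b h where "a = norm (grad v x) powr p" and "b = norm (grad w x) powr p"
          and "h = norm ((1/2) *\<^sub>R (grad v x + grad w x)) powr p"
        define g where "g = powr_gap p (grad v x) (grad w x)"
        define i where "i = k1 * B * (indicator S x * \<bar>v x - w x\<bar> powr p)"
        have g: "g = (a + b) / 2 - h" by (simp only: g_def powr_gap_def a_def b_def h_def)
        have g0: "0 \<le> g" unfolding g_def by (rule powr_gap_nonneg[OF p1])
        have t1: "\<bar>- (v x - w x) / 2\<bar> powr p \<le> \<bar>v x - w x\<bar> powr p"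
          using half[of "v x - w x"] by (simp add: abs_minus_commute)
        have 1: "norm (grad u1 x) powr p \<le> (1 - \<eta> x) * a + \<eta> x * ((1 + \<epsilon>) * h) + i"
          unfolding gu1 a_def h_def i_def by (rule conv[OF t1])
        have 2: "norm (grad u2 x) powr p \<le> (1 - \<eta> x) * b + \<eta> x * ((1 + \<epsilon>) * h) + i"
          unfolding gu2 b_def h_def i_def by (rule conv[OF half])
        have "\<eta> x * (\<epsilon> * h) \<le> \<eta> x * (\<epsilon> * ((a + b) / 2))"
          using g0 \<eta>(2)[of x] \<epsilon> unfolding g by (intro mult_left_mono) auto
        moreover have "(1 - \<eta> x) * a + \<eta> x * ((1 + \<epsilon>) * h) + i + ((1 - \<eta> x) * b + \<eta> x * ((1 + \<epsilon>) * h) + i) - a - b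
            = 2 * (\<eta> x * (\<epsilon> * h)) + 2 * i - 2 * (\<eta> x * g)"
          unfolding g by (simp add: field_simps)
        moreover have "2 * (\<eta> x * (\<epsilon> * ((a + b) / 2))) = \<epsilon> * (\<eta> x * a + \<eta> x * b)"
          by (simp add: field_simps)
        ultimately have "(r1 - a) + (r2 - b) \<le> \<epsilon> * (\<eta> x * a + \<eta> x * b) + 2 * i - 2 * (\<eta> x * g)"
          if "r1 \<le> (1 - \<eta> x) * a + \<eta> x * ((1 + \<epsilon>) * h) + i"
            "r2 \<le> (1 - \<eta> x) * b + \<eta> x * ((1 + \<epsilon>) * h) + i" for r1 r2
          using that by linarith
        from this[OF 1 2] have "(norm (grad u1 x) powr p - a) + (norm (grad u2 x) powr p - b)
            \<le> \<epsilon> * (\<eta> x * a + \<eta> x * b) + 2 * i - 2 * (\<eta> x * g)" .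
        then show ?thesis unfolding a_def b_def g_def i_def by (simp only: mult.assoc)
      qed
      have iv: "integrable M (\<lambda>x. \<eta> x * norm (grad v x) powr p)" and iw: "integrable M (\<lambda>x. \<eta> x * norm (grad w x) powr p)"
        by (rule int_cutoff[OF \<eta>(1) cont_grad_powr], rule v w)+
      have cd: "continuous_on UNIV (\<lambda>x. \<bar>v x - w x\<bar> powr p)"
        using continuous_on_norm_powr[of UNIV "\<lambda>x. v x - w x" p] p
        by (simp add: continuous_on_diff smooth_imp_continuous_on sv sw)
      have iI: "integrable M (\<lambda>x. indicator S x * \<bar>v x - w x\<bar> powr p)"
        by (rule integrable_ind[OF cd S(1,2)])
      have ig: "integrable M (\<lambda>x. \<eta> x * powr_gap p (grad v x) (grad w x))"
        by (rule int_cutoff[OF \<eta>(1) cont_gap[OF v w]])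
      define G where "G = (\<integral>x. \<eta> x * powr_gap p (grad v x) (grad w x) \<partial>M)"
      have i1: "integrable M (\<lambda>x. norm (grad u1 x) powr p - norm (grad v x) powr p)"
        and i2: "integrable M (\<lambda>x. norm (grad u2 x) powr p - norm (grad w x) powr p)"
        by (intro Bochner_Integration.integrable_diff int_grad u1 u2 v w)+
      have "(\<integral>x. norm (grad u1 x) powr p - norm (grad v x) powr p \<partial>M) + (\<integral>x. norm (grad u2 x) powr p - norm (grad w x) powr p \<partial>M)
          = (\<integral>x. (norm (grad u1 x) powr p - norm (grad v x) powr p) + (norm (grad u2 x) powr p - norm (grad w x) powr p) \<partial>M)"
        by (rule Bochner_Integration.integral_add[OF i1 i2, symmetric])
      also have "\<dots> \<le> (\<integral>x. \<epsilon> * (\<eta> x * norm (grad v x) powr p + \<eta> x * norm (grad w x) powr p)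
            + 2 * (k1 * B) * (indicator S x * \<bar>v x - w x\<bar> powr p)
            - 2 * (\<eta> x * powr_gap p (grad v x) (grad w x)) \<partial>M)"
        by (rule integral_mono[OF Bochner_Integration.integrable_add[OF i1 i2] _ pt])
          (intro Bochner_Integration.integrable_diff Bochner_Integration.integrable_add integrable_mult_right iv iw iI ig)
      also have "\<dots> = \<epsilon> * ((\<integral>x. \<eta> x * norm (grad v x) powr p \<partial>M) + (\<integral>x. \<eta> x * norm (grad w x) powr p \<partial>M))
          + 2 * (k1 * B) * I - 2 * G"
        unfolding I_def G_def
        by (simp only: integral_mult_right_zero Bochner_Integration.integral_add[OF iv iw]
            Bochner_Integration.integral_diff[OF Bochner_Integration.integrable_add[OF
              integrable_mult_right[OF Bochner_Integration.integrable_add[OF iv iw]] integrable_mult_right[OF iI]]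
              integrable_mult_right[OF ig]]
            Bochner_Integration.integral_add[OF integrable_mult_right[OF Bochner_Integration.integrable_add[OF iv iw]] integrable_mult_right[OF iI]])
      also have "\<dots> \<le> \<epsilon> * (X + X) + 2 * (k1 * B) * I - 2 * G"
        using \<epsilon> X[of m] X[of n] unfolding v_def w_def by (intro diff_right_mono add_right_mono mult_left_mono add_mono) auto
      finally have E1: "(\<integral>x. norm (grad u1 x) powr p - norm (grad v x) powr p \<partial>M)
          + (\<integral>x. norm (grad u2 x) powr p - norm (grad w x) powr p \<partial>M)
          \<le> \<epsilon> * (X + X) + 2 * (k1 * B) * I - 2 * G" .
      \<comment> \<open>Applied with (u, z, y) equal to (u1, v, w) and to (u2, w, v). An absolute
        value is to be bounded, so the \<epsilon>-inequality is used in both directions: u as a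
        perturbation of z, and z as a perturbation of u.\<close>
      have Vterm: "\<bar>\<integral>x. V x * (\<bar>u x\<bar> powr p - \<bar>z x\<bar> powr p) \<partial>M\<bar> \<le> c * (\<epsilon> * (2 * A) + k2 * I)"
        if u: "u \<in> \<D>" and z: "z \<in> \<D>" and uz: "\<And>x. u x = (1 - t x) * z x + t x * y x"
          and zy: "\<And>x. \<bar>z x - y x\<bar> = \<bar>v x - w x\<bar>" "\<And>x. \<bar>z x\<bar> powr p + \<bar>y x\<bar> powr p = \<bar>v x\<bar> powr p + \<bar>w x\<bar> powr p"
          and t: "\<And>x. t x = \<eta> x / 2" for u z y t
      proof -
        have ivS: "integrable M (\<lambda>x. indicator S x * \<bar>v x\<bar> powr p)" and iwS: "integrable M (\<lambda>x. indicator S x * \<bar>w x\<bar> powr p)"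
          by (rule integrable_ind[OF cont_powr S(1,2)], rule v w)+
        have "\<bar>\<integral>x. V x * (\<bar>u x\<bar> powr p - \<bar>z x\<bar> powr p) \<partial>M\<bar>
            \<le> c * (\<integral>x. \<epsilon> * (indicator S x * \<bar>v x\<bar> powr p + indicator S x * \<bar>w x\<bar> powr p)
              + k2 * (indicator S x * \<bar>v x - w x\<bar> powr p) \<partial>M)"
        proof (rule c(2))
          show "integrable M (\<lambda>x. \<bar>u x\<bar> powr p - \<bar>z x\<bar> powr p)"
            by (intro Bochner_Integration.integrable_diff int_powr u z)
          show "integrable M (\<lambda>x. \<epsilon> * (indicator S x * \<bar>v x\<bar> powr p + indicator S x * \<bar>w x\<bar> powr p)
              + k2 * (indicator S x * \<bar>v x - w x\<bar> powr p))"
            by (intro Bochner_Integration.integrable_add integrable_mult_right ivS iwS iI)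
          show "\<forall>x. x \<notin> S \<longrightarrow> \<bar>u x\<bar> powr p - \<bar>z x\<bar> powr p = 0"
            using S(3) by (simp add: uz t)
          show "\<forall>x. \<bar>\<bar>u x\<bar> powr p - \<bar>z x\<bar> powr p\<bar>
              \<le> \<epsilon> * (indicator S x * \<bar>v x\<bar> powr p + indicator S x * \<bar>w x\<bar> powr p)
                + k2 * (indicator S x * \<bar>v x - w x\<bar> powr p)"
          proof
            fix x
            show "\<bar>\<bar>u x\<bar> powr p - \<bar>z x\<bar> powr p\<bar>
              \<le> \<epsilon> * (indicator S x * \<bar>v x\<bar> powr p + indicator S x * \<bar>w x\<bar> powr p)
                + k2 * (indicator S x * \<bar>v x - w x\<bar> powr p)"
            proof (cases "x \<in> S")
              case True
              have t01: "0 \<le> t x" "t x \<le> 1" using \<eta>(2,3)[of x] by (auto simp: t)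
              define sm where "sm = \<bar>v x\<bar> powr p + \<bar>w x\<bar> powr p"
              have ule: "\<bar>u x\<bar> powr p \<le> sm"
              proof -
                have "\<bar>u x\<bar> powr p \<le> (1 - t x) * \<bar>z x\<bar> powr p + t x * \<bar>y x\<bar> powr p"
                  using norm_powr_convex_combination[OF p1 t01, of "z x" "y x"] by (simp add: uz)
                also have "\<dots> \<le> 1 * \<bar>z x\<bar> powr p + 1 * \<bar>y x\<bar> powr p"
                  using t01 by (intro add_mono mult_right_mono) auto
                finally show ?thesis using zy(2)[of x] by (simp add: sm_def)
              qed
              have zle: "\<bar>z x\<bar> powr p \<le> sm"
                using zy(2)[of x] powr_ge_zero[of "\<bar>y x\<bar>" p] unfolding sm_def by linarith
              have dle: "\<bar>t x * (z x - y x)\<bar> powr p \<le> \<bar>v x - w x\<bar> powr p"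
              proof (rule powr_mono2)
                show "\<bar>t x * (z x - y x)\<bar> \<le> \<bar>v x - w x\<bar>"
                  using t01 mult_right_mono[of "t x" 1 "\<bar>z x - y x\<bar>"] by (simp add: abs_mult zy(1))
              qed (use p in auto)
              have kd: "k2 * \<bar>t x * (z x - y x)\<bar> powr p \<le> k2 * \<bar>v x - w x\<bar> powr p"
                using k2(1) by (intro mult_left_mono dle) auto
              have "u x = z x + - (t x * (z x - y x))" by (simp add: uz algebra_simps)
              then have "\<bar>u x\<bar> powr p \<le> (1 + \<epsilon>) * \<bar>z x\<bar> powr p + k2 * \<bar>t x * (z x - y x)\<bar> powr p"
                using k2(2)[of "z x" "- (t x * (z x - y x))"] by simp
              moreover have "z x = u x + t x * (z x - y x)" by (simp add: uz algebra_simps)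
              then have "\<bar>z x\<bar> powr p \<le> (1 + \<epsilon>) * \<bar>u x\<bar> powr p + k2 * \<bar>t x * (z x - y x)\<bar> powr p"
                using k2(2)[of "u x" "t x * (z x - y x)"] by simp
              moreover have "\<epsilon> * \<bar>z x\<bar> powr p \<le> \<epsilon> * sm" "\<epsilon> * \<bar>u x\<bar> powr p \<le> \<epsilon> * sm"
                using \<epsilon> ule zle by (auto intro!: mult_left_mono)
              ultimately have "\<bar>\<bar>u x\<bar> powr p - \<bar>z x\<bar> powr p\<bar> \<le> \<epsilon> * sm + k2 * \<bar>v x - w x\<bar> powr p"
                using kd by (simp only: abs_le_iff distrib_right) linarith
              then show ?thesis using True by (simp add: sm_def)
            qed (use S(3) in \<open>simp add: uz t\<close>)
          qed
        qed
        also have "(\<integral>x. \<epsilon> * (indicator S x * \<bar>v x\<bar> powr p + indicator S x * \<bar>w x\<bar> powr p)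
              + k2 * (indicator S x * \<bar>v x - w x\<bar> powr p) \<partial>M)
            = \<epsilon> * ((\<integral>x. indicator S x * \<bar>v x\<bar> powr p \<partial>M) + (\<integral>x. indicator S x * \<bar>w x\<bar> powr p \<partial>M)) + k2 * I"
          unfolding I_def
          by (simp only: integral_mult_right_zero Bochner_Integration.integral_add[OF ivS iwS]
              Bochner_Integration.integral_add[OF integrable_mult_right[OF Bochner_Integration.integrable_add[OF ivS iwS]] integrable_mult_right[OF iI]])
        also have "c * \<dots> \<le> c * (\<epsilon> * (2 * A) + k2 * I)"
          using \<epsilon> A(2)[of m] A(2)[of n] unfolding v_def w_def
          by (intro mult_left_mono add_right_mono c(1)) auto
        finally show ?thesis .
      qed
      have V1: "\<bar>\<integral>x. V x * (\<bar>u1 x\<bar> powr p - \<bar>v x\<bar> powr p) \<partial>M\<bar> \<le> c * (\<epsilon> * (2 * A) + k2 * I)"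
        by (rule Vterm[OF u1 v, where t = "\<lambda>x. \<eta> x / 2" and y = w]) (simp_all add: u1_def field_simps)
      have V2: "\<bar>\<integral>x. V x * (\<bar>u2 x\<bar> powr p - \<bar>w x\<bar> powr p) \<partial>M\<bar> \<le> c * (\<epsilon> * (2 * A) + k2 * I)"
        by (rule Vterm[OF u2 w, where t = "\<lambda>x. \<eta> x / 2" and y = v]) (simp_all add: u2_def field_simps abs_minus_commute)
      have fsum: "f u1 + f u2 = f v + f w"
        unfolding u1_def u2_def by (subst f_linear[OF v de], subst f_linear[OF w de]) simp
      have "J v \<le> J u1 + 1 / real (Suc m)" "J w \<le> J u2 + 1 / real (Suc n)"
        unfolding v_def w_def by (rule minimizingD(2)[OF \<phi>], rule u1 u2)+
      then have "0 \<le> (Q u1 - Q v) + (Q u2 - Q w) - p * ((f u1 + f u2) - (f v + f w)) + 1 / real (Suc m) + 1 / real (Suc n)"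
        unfolding J_def by (simp add: algebra_simps)
      then have "0 \<le> (Q u1 - Q v) + (Q u2 - Q w) + 1 / real (Suc m) + 1 / real (Suc n)"
        unfolding fsum by simp
      then have "2 * G \<le> \<epsilon> * (X + X) + 2 * (k1 * B) * I + 2 * (c * (\<epsilon> * (2 * A) + k2 * I)) + 1 / real (Suc m) + 1 / real (Suc n)"
        unfolding Q_diff[OF u1 v] Q_diff[OF u2 w] using E1 V1 V2 by linarith
      also have "\<dots> = \<epsilon> * \<Lambda> + C' * I + 1 / real (Suc m) + 1 / real (Suc n)"
        by (simp only: \<Lambda>_def C'_def) (simp add: algebra_simps)
      finally have "2 * G \<le> \<epsilon> * \<Lambda> + C' * I + 1 / real (Suc m) + 1 / real (Suc n)" .
      moreover have "0 \<le> G"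
        unfolding G_def using \<eta>(2) powr_gap_nonneg[OF p1] by (intro Bochner_Integration.integral_nonneg mult_nonneg_nonneg)
      ultimately show ?thesis unfolding G_def I_def v_def w_def by linarith
    qed
    then show "\<exists>C'\<ge>0. \<forall>m n. (\<integral>x. \<eta> x * powr_gap p (grad (\<phi> m) x) (grad (\<phi> n) x) \<partial>M)
      \<le> \<epsilon> * \<Lambda> + C' * (\<integral>x. indicator S x * \<bar>\<phi> m x - \<phi> n x\<bar> powr p \<partial>M) + 1 / real (Suc m) + 1 / real (Suc n)"
      using C' by blast
  qed
qed

lemma Lp_cauchyD:
  assumes "Lp_cauchy \<phi>" "compact K" "K \<subseteq> \<Omega>" "0 < e"
  shows "\<exists>N. \<forall>m\<ge>N. \<forall>n\<ge>N. (\<integral>x. indicator K x * \<bar>\<phi> m x - \<phi> n x\<bar> powr p \<partial>M) \<le> e"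
  by (rule assms(1)[unfolded Lp_cauchy_def, rule_format]) (use assms in simp)

text \<open>A small weighted gap forces close gradients, up to a small multiple of their bounded
  energies. Each tolerance is fixed before the constant it produces: \<open>\<epsilon>1\<close>
  determines \<open>k\<close>, \<open>\<epsilon>2\<close> determines \<open>C'\<close>, and only
  then \<open>\<epsilon>3\<close> sets the demand on the L^p differences.\<close>

lemma minimizing_grad_cauchy:
  assumes \<phi>: "minimizing \<phi>" and cauchy: "Lp_cauchy \<phi>" and K: "compact K" "K \<subseteq> \<Omega>" and \<epsilon>: "0 < \<epsilon>"
  shows "\<exists>N. \<forall>m\<ge>N. \<forall>n\<ge>N. (\<integral>x. indicator K x * norm (grad (\<phi> m) x - grad (\<phi> n) x) powr p \<partial>M) \<le> \<epsilon>"
proof -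
  note D = minimizingD(1)[OF \<phi>]
  obtain \<eta> c0 B e where cut: "power_cutoff K \<eta> c0 B e"
    using ex_power_cutoff_in_domain[OF K] by blast
  note \<eta> = power_cutoffD[OF cut]
  obtain S where S: "compact S" "S \<subseteq> \<Omega>" "\<And>x. x \<notin> S \<Longrightarrow> \<eta> x = 0"
    by (rule test_function_support[OF \<eta>(1)]) (rule that)
  obtain X where X: "\<And>n. (\<integral>x. \<eta> x * norm (grad (\<phi> n) x) powr p \<partial>M) \<le> X"
    by (rule minimizing_grad_bounded[OF \<phi> cut]) (rule that)
  have X0: "0 \<le> X"
    using order_trans[OF Bochner_Integration.integral_nonneg X[of 0]] \<eta>(2) by simp
  obtain \<Lambda> where \<Lambda>: "0 \<le> \<Lambda>"
    "\<And>\<epsilon>. 0 < \<epsilon> \<Longrightarrow> \<exists>C'\<ge>0. \<forall>m n. (\<integral>x. \<eta> x * powr_gap p (grad (\<phi> m) x) (grad (\<phi> n) x) \<partial>M)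
      \<le> \<epsilon> * \<Lambda> + C' * (\<integral>x. indicator S x * \<bar>\<phi> m x - \<phi> n x\<bar> powr p \<partial>M) + 1 / real (Suc m) + 1 / real (Suc n)"
    by (rule minimizing_gap_bound[OF \<phi> cut S]) (assumption, rule that)
  \<comment> \<open>A quarter of the budget c0 \<epsilon>: one share each for the energies, the
    \<Lambda> term, the L^p differences, and the two minimization errors together. The factor c0
    accounts for \<eta> \<ge> c0 on \<open>K\<close>.\<close>
  define q where "q = c0 * \<epsilon> / 4"
  have q: "0 < q" using \<eta>(4) \<epsilon> by (simp add: q_def)
  define \<epsilon>1 where "\<epsilon>1 = q / (2 * (X + 1))"
  have \<epsilon>1: "0 < \<epsilon>1" "\<epsilon>1 * (X + X) \<le> q"
    using q X0 by (auto simp: \<epsilon>1_def field_simps)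
  obtain k where k: "0 < k" "\<And>a b :: real^'n. norm (a - b) powr p \<le> \<epsilon>1 * (norm a powr p + norm b powr p) + k * powr_gap p a b"
    by (rule norm_diff_powr_le_gap[OF p \<epsilon>1(1)]) (rule that)
  define \<epsilon>2 where "\<epsilon>2 = q / (k * (\<Lambda> + 1))"
  have \<epsilon>2: "0 < \<epsilon>2" "k * (\<epsilon>2 * \<Lambda>) \<le> q"
  proof -
    show "0 < \<epsilon>2" using q k(1) \<Lambda>(1) by (simp add: \<epsilon>2_def)
    have "k * (\<epsilon>2 * \<Lambda>) = q * (\<Lambda> / (\<Lambda> + 1))" using k(1) by (simp add: \<epsilon>2_def)
    also have "\<dots> \<le> q * 1" using q \<Lambda>(1) by (intro mult_left_mono) auto
    finally show "k * (\<epsilon>2 * \<Lambda>) \<le> q" by simp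
  qed
  obtain C' where C': "0 \<le> C'" "\<And>m n. (\<integral>x. \<eta> x * powr_gap p (grad (\<phi> m) x) (grad (\<phi> n) x) \<partial>M)
      \<le> \<epsilon>2 * \<Lambda> + C' * (\<integral>x. indicator S x * \<bar>\<phi> m x - \<phi> n x\<bar> powr p \<partial>M) + 1 / real (Suc m) + 1 / real (Suc n)"
    using \<Lambda>(2)[OF \<epsilon>2(1)] by blast
  define \<epsilon>3 where "\<epsilon>3 = q / (k * (C' + 1))"
  have \<epsilon>3: "0 < \<epsilon>3" "k * (C' * \<epsilon>3) \<le> q"
  proof -
    show "0 < \<epsilon>3" using q k(1) C'(1) by (simp add: \<epsilon>3_def)
    have "k * (C' * \<epsilon>3) = q * (C' / (C' + 1))" using k(1) by (simp add: \<epsilon>3_def)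
    also have "\<dots> \<le> q * 1" using q C'(1) by (intro mult_left_mono) auto
    finally show "k * (C' * \<epsilon>3) \<le> q" by simp
  qed
  obtain N1 where N1: "\<forall>m\<ge>N1. \<forall>n\<ge>N1. (\<integral>x. indicator S x * \<bar>\<phi> m x - \<phi> n x\<bar> powr p \<partial>M) \<le> \<epsilon>3"
    using Lp_cauchyD[OF cauchy S(1,2) \<epsilon>3(1)] by (rule exE)
  obtain N2 where N2: "1 / real (Suc N2) < q / (2 * k)"
    using reals_Archimedean[of "q / (2 * k)"] q k(1) by (auto simp: inverse_eq_divide)
  have "(\<integral>x. indicator K x * norm (grad (\<phi> m) x - grad (\<phi> n) x) powr p \<partial>M) \<le> \<epsilon>"
    if mn: "max N1 N2 \<le> m" "max N1 N2 \<le> n" for m n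
  proof -
    define v where "v = \<phi> m"
    define w where "w = \<phi> n"
    have v: "v \<in> \<D>" and w: "w \<in> \<D>" unfolding v_def w_def by (rule D)+
    note sv = test_functions_smooth[OF v] and sw = test_functions_smooth[OF w]
    define G where "G = (\<integral>x. \<eta> x * powr_gap p (grad v x) (grad w x) \<partial>M)"
    have cdiff: "continuous_on UNIV (\<lambda>x. norm (grad v x - grad w x) powr p)"
      using p by (intro continuous_on_norm_powr continuous_on_diff continuous_on_grad sv sw) auto
    have iv: "integrable M (\<lambda>x. \<eta> x * norm (grad v x) powr p)" and iw: "integrable M (\<lambda>x. \<eta> x * norm (grad w x) powr p)"
      by (rule int_cutoff[OF \<eta>(1) cont_grad_powr], rule v w)+
    have ig: "integrable M (\<lambda>x. \<eta> x * powr_gap p (grad v x) (grad w x))"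
      by (rule int_cutoff[OF \<eta>(1) cont_gap[OF v w]])
    have "c0 * (\<integral>x. indicator K x * norm (grad v x - grad w x) powr p \<partial>M)
        = (\<integral>x. c0 * (indicator K x * norm (grad v x - grad w x) powr p) \<partial>M)"
      by simp
    also have "\<dots> \<le> (\<integral>x. \<epsilon>1 * (\<eta> x * norm (grad v x) powr p + \<eta> x * norm (grad w x) powr p)
        + k * (\<eta> x * powr_gap p (grad v x) (grad w x)) \<partial>M)"
    proof (rule integral_mono)
      show "integrable M (\<lambda>x. c0 * (indicator K x * norm (grad v x - grad w x) powr p))"
        by (intro integrable_mult_right integrable_ind cdiff K)
      show "integrable M (\<lambda>x. \<epsilon>1 * (\<eta> x * norm (grad v x) powr p + \<eta> x * norm (grad w x) powr p)
        + k * (\<eta> x * powr_gap p (grad v x) (grad w x)))"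
        by (intro Bochner_Integration.integrable_add integrable_mult_right iv iw ig)
      fix x
      have "c0 * (indicator K x * norm (grad v x - grad w x) powr p) \<le> \<eta> x * norm (grad v x - grad w x) powr p"
        using \<eta>(2)[of x] \<eta>(5)[of x] by (cases "x \<in> K") (auto intro!: mult_right_mono)
      also have "\<dots> \<le> \<eta> x * (\<epsilon>1 * (norm (grad v x) powr p + norm (grad w x) powr p) + k * powr_gap p (grad v x) (grad w x))"
        by (rule mult_left_mono[OF k(2) \<eta>(2)])
      finally show "c0 * (indicator K x * norm (grad v x - grad w x) powr p)
          \<le> \<epsilon>1 * (\<eta> x * norm (grad v x) powr p + \<eta> x * norm (grad w x) powr p)
        + k * (\<eta> x * powr_gap p (grad v x) (grad w x))"
        by (simp only: distrib_left mult_ac)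
    qed
    also have "\<dots> = \<epsilon>1 * ((\<integral>x. \<eta> x * norm (grad v x) powr p \<partial>M) + (\<integral>x. \<eta> x * norm (grad w x) powr p \<partial>M)) + k * G"
      unfolding G_def
      by (simp only: integral_mult_right_zero Bochner_Integration.integral_add[OF iv iw]
          Bochner_Integration.integral_add[OF integrable_mult_right[OF Bochner_Integration.integrable_add[OF iv iw]] integrable_mult_right[OF ig]])
    also have "\<dots> \<le> \<epsilon>1 * (X + X) + k * (\<epsilon>2 * \<Lambda> + C' * \<epsilon>3 + q / (2 * k) + q / (2 * k))"
    proof (intro add_mono mult_left_mono)
      show "(\<integral>x. \<eta> x * norm (grad v x) powr p \<partial>M) \<le> X" "(\<integral>x. \<eta> x * norm (grad w x) powr p \<partial>M) \<le> X"
        unfolding v_def w_def by (rule X)+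
      have "1 / real (Suc m) \<le> 1 / real (Suc N2)" "1 / real (Suc n) \<le> 1 / real (Suc N2)"
        using mn by (auto intro!: frac_le)
      moreover have "C' * (\<integral>x. indicator S x * \<bar>\<phi> m x - \<phi> n x\<bar> powr p \<partial>M) \<le> C' * \<epsilon>3"
        using mn by (intro mult_left_mono N1[rule_format] C') auto
      ultimately show "G \<le> \<epsilon>2 * \<Lambda> + C' * \<epsilon>3 + q / (2 * k) + q / (2 * k)"
        using C'(2)[of m n] N2 unfolding G_def v_def w_def by linarith
    qed (use \<epsilon>1 k in auto)
    also have "\<dots> = \<epsilon>1 * (X + X) + (k * (\<epsilon>2 * \<Lambda>) + k * (C' * \<epsilon>3) + q)"
      using k(1) by (simp add: distrib_left)
    also have "\<dots> \<le> c0 * \<epsilon>"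
      using \<epsilon>1(2) \<epsilon>2(2) \<epsilon>3(2) unfolding q_def by linarith
    finally show ?thesis using \<eta>(4) unfolding v_def w_def by simp
  qed
  then show ?thesis by blast
qed

text \<open>Local L^p convergence in the form that dominated convergence consumes: convergence
  almost everywhere, and on each compact set one integrable majorant for the p-th powers of
  functions, gradients and limits, valid from some index on.\<close>

definition locally_converges ::
    "(nat \<Rightarrow> real^'n \<Rightarrow> real) \<Rightarrow> (real^'n \<Rightarrow> real) \<Rightarrow> (real^'n \<Rightarrow> real^'n) \<Rightarrow> bool" where
  "locally_converges \<phi> u g \<longleftrightarrow> u \<in> borel_measurable M \<and> g \<in> borel_measurable M
    \<and> (AE x in M. (\<lambda>k. \<phi> k x) \<longlonglongrightarrow> u x) \<and> (AE x in M. (\<lambda>k. grad (\<phi> k) x) \<longlonglongrightarrow> g x)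
    \<and> (\<forall>K. compact K \<and> K \<subseteq> \<Omega> \<longrightarrow> (\<exists>H N. integrable M H \<and>
        (AE x in M. x \<in> K \<longrightarrow> (\<forall>k\<ge>N. \<bar>\<phi> k x\<bar> powr p \<le> H x \<and> norm (grad (\<phi> k) x) powr p \<le> H x)
          \<and> \<bar>u x\<bar> powr p \<le> H x \<and> norm (g x) powr p \<le> H x)))"

lemma ex_minimizing_locally_converges: "\<exists>\<phi> u g. minimizing \<phi> \<and> locally_converges \<phi> u g"
proof -
  obtain \<phi>0 where \<phi>0: "minimizing \<phi>0" "Lp_cauchy \<phi>0" using ex_minimizing_Lp_cauchy by blast
  note D = minimizingD(1)[OF \<phi>0(1)]
  note sm = test_functions_smooth[OF D]
  obtain Ce :: "nat \<Rightarrow> (real^'n) set" where Ce: "\<And>j. compact (Ce j)" "\<And>j. Ce j \<subseteq> \<Omega>"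
    "\<And>j. Ce j \<subseteq> interior (Ce (Suc j))" "\<Union> (range Ce) = \<Omega>"
    "\<And>K. compact K \<Longrightarrow> K \<subseteq> \<Omega> \<Longrightarrow> \<exists>N. \<forall>j\<ge>N. K \<subseteq> Ce j"
    by (rule open_Union_compact_subsets[OF opn]) (rule that)
  \<comment> \<open>Function and gradient are treated as one vector-valued sequence, so that a
    single subsequence and a single majorant serve both.\<close>
  define U where "U n x = (\<phi>0 n x, grad (\<phi>0 n) x)" for n x
  have cU: "continuous_on UNIV (U n)" for n
    unfolding U_def by (intro continuous_on_Pair smooth_imp_continuous_on continuous_on_grad sm)
  have split_norm: "norm (a, b) powr p \<le> 2 powr p * (\<bar>a\<bar> powr p + norm b powr p)" for a :: real and b :: "real^'n"
    using norm_add_powr_le[of p "(a, 0)" "(0, b)"] p by (simp add: norm_Pair)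
  have fst_le: "\<bar>fst z\<bar> powr p \<le> norm z powr p" and snd_le: "norm (snd z) powr p \<le> norm z powr p" for z :: "real \<times> (real^'n)"
    using norm_fst_le[of "fst z" "snd z"] norm_snd_le[of "snd z" "fst z"] p by (auto intro!: powr_mono2)
  have iU: "integrable M (\<lambda>x. indicator (Ce j) x * norm (U n x) powr p)" for j n
    using p by (intro integrable_ind continuous_on_norm_powr cU Ce) auto
  have cauchyU: "\<exists>N. \<forall>m\<ge>N. \<forall>n\<ge>N. (\<integral>x. indicator (Ce j) x * norm (U m x - U n x) powr p \<partial>M) \<le> \<epsilon>"
    if \<epsilon>: "0 < \<epsilon>" for j \<epsilon>
  proof -
    define q where "q = \<epsilon> / (2 * 2 powr p)"
    have q: "0 < q" "2 powr p * (q + q) = \<epsilon>" using \<epsilon> by (simp_all add: q_def)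
    obtain N1 where N1: "\<forall>m\<ge>N1. \<forall>n\<ge>N1. (\<integral>x. indicator (Ce j) x * \<bar>\<phi>0 m x - \<phi>0 n x\<bar> powr p \<partial>M) \<le> q"
      using Lp_cauchyD[OF \<phi>0(2) Ce(1)[of j] Ce(2)[of j] q(1)] by (rule exE)
    obtain N2 where N2: "\<forall>m\<ge>N2. \<forall>n\<ge>N2.
        (\<integral>x. indicator (Ce j) x * norm (grad (\<phi>0 m) x - grad (\<phi>0 n) x) powr p \<partial>M) \<le> q"
      using minimizing_grad_cauchy[OF \<phi>0 Ce(1)[of j] Ce(2)[of j] q(1)] by (rule exE)
    have "(\<integral>x. indicator (Ce j) x * norm (U m x - U n x) powr p \<partial>M) \<le> \<epsilon>"
      if mn: "max N1 N2 \<le> m" "max N1 N2 \<le> n" for m n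
    proof -
      have i1: "integrable M (\<lambda>x. indicator (Ce j) x * \<bar>\<phi>0 m x - \<phi>0 n x\<bar> powr p)"
      proof (rule integrable_ind[OF _ Ce(1,2)])
        show "continuous_on UNIV (\<lambda>x. \<bar>\<phi>0 m x - \<phi>0 n x\<bar> powr p)"
          using continuous_on_norm_powr[of UNIV "\<lambda>x. \<phi>0 m x - \<phi>0 n x" p] p
          by (simp add: continuous_on_diff smooth_imp_continuous_on sm)
      qed
      have i2: "integrable M (\<lambda>x. indicator (Ce j) x * norm (grad (\<phi>0 m) x - grad (\<phi>0 n) x) powr p)"
        using p by (intro integrable_ind continuous_on_norm_powr continuous_on_diff continuous_on_grad sm Ce) auto
      have i3: "integrable M (\<lambda>x. indicator (Ce j) x * norm (U m x - U n x) powr p)"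
        using p by (intro integrable_ind continuous_on_norm_powr continuous_on_diff cU Ce) auto
      have "(\<integral>x. indicator (Ce j) x * norm (U m x - U n x) powr p \<partial>M)
          \<le> (\<integral>x. 2 powr p * (indicator (Ce j) x * \<bar>\<phi>0 m x - \<phi>0 n x\<bar> powr p
            + indicator (Ce j) x * norm (grad (\<phi>0 m) x - grad (\<phi>0 n) x) powr p) \<partial>M)"
      proof (rule integral_mono[OF i3])
        show "integrable M (\<lambda>x. 2 powr p * (indicator (Ce j) x * \<bar>\<phi>0 m x - \<phi>0 n x\<bar> powr p
            + indicator (Ce j) x * norm (grad (\<phi>0 m) x - grad (\<phi>0 n) x) powr p))"
          by (intro integrable_mult_right Bochner_Integration.integrable_add i1 i2)
        fix x
        show "indicator (Ce j) x * norm (U m x - U n x) powr p \<le> 2 powr p * (indicator (Ce j) x * \<bar>\<phi>0 m x - \<phi>0 n x\<bar> powr p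
            + indicator (Ce j) x * norm (grad (\<phi>0 m) x - grad (\<phi>0 n) x) powr p)"
          using split_norm[of "\<phi>0 m x - \<phi>0 n x" "grad (\<phi>0 m) x - grad (\<phi>0 n) x"]
          by (cases "x \<in> Ce j") (auto simp: U_def)
      qed
      also have "\<dots> = 2 powr p * ((\<integral>x. indicator (Ce j) x * \<bar>\<phi>0 m x - \<phi>0 n x\<bar> powr p \<partial>M)
          + (\<integral>x. indicator (Ce j) x * norm (grad (\<phi>0 m) x - grad (\<phi>0 n) x) powr p \<partial>M))"
        by (simp only: integral_mult_right_zero Bochner_Integration.integral_add[OF i1 i2])
      also have "\<dots> \<le> 2 powr p * (q + q)"
        using mn by (intro mult_left_mono add_mono N1[rule_format] N2[rule_format]) auto
      finally show ?thesis unfolding q(2) .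
    qed
    then show ?thesis by blast
  qed
  have incCe: "incseq Ce"
    by (rule incseq_SucI) (use Ce(3) interior_subset in blast)
  obtain r W' H where r: "strict_mono (r :: nat \<Rightarrow> nat)" and W': "W' \<in> borel_measurable M"
    "AE x in M. x \<in> (\<Union>j. Ce j) \<longrightarrow> (\<lambda>k. U (r k) x) \<longlonglongrightarrow> W' x"
    and H: "\<And>j. integrable M (H j :: real^'n \<Rightarrow> real)"
    "\<And>j. AE x in M. x \<in> Ce j \<longrightarrow> (\<forall>k\<ge>j. norm (U (r k) x) powr p \<le> H j x)"
    by (rule local_riesz_fischer[OF p measurable_M[OF cU] compact_in_M[OF Ce(1,2)] incCe iU cauchyU])
      (assumption, rule that)
  define \<phi> where "\<phi> k = \<phi>0 (r k)" for k
  define u where "u x = fst (W' x)" for x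
  define g where "g x = snd (W' x)" for x
  have "AE x in M. x \<in> \<Omega>" by (rule AE_I2) simp
  then have lim: "AE x in M. (\<lambda>k. U (r k) x) \<longlonglongrightarrow> W' x"
    using W'(2) by eventually_elim (use Ce(4) in blast)
  have "minimizing \<phi>" unfolding \<phi>_def by (rule minimizing_subseq[OF \<phi>0(1) r])
  moreover have "locally_converges \<phi> u g"
    unfolding locally_converges_def
  proof (intro conjI allI impI)
    show "u \<in> borel_measurable M" "g \<in> borel_measurable M"
      unfolding u_def g_def
      by (rule borel_measurable_continuous_on[OF _ W'(1)], intro continuous_on_fst continuous_on_snd continuous_on_id)+
    show "AE x in M. (\<lambda>k. \<phi> k x) \<longlonglongrightarrow> u x"
      using lim
    proof eventually_elim
      case (elim x)
      from tendsto_fst[OF this] show ?case by (simp add: U_def u_def \<phi>_def)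
    qed
    show "AE x in M. (\<lambda>k. grad (\<phi> k) x) \<longlonglongrightarrow> g x"
      using lim
    proof eventually_elim
      case (elim x)
      from tendsto_snd[OF this] show ?case by (simp add: U_def g_def \<phi>_def)
    qed
    fix K assume "compact K \<and> K \<subseteq> \<Omega>"
    then obtain j where j: "K \<subseteq> Ce j" using Ce(5)[of K] by blast
    have "AE x in M. x \<in> K \<longrightarrow> (\<forall>k\<ge>j. \<bar>\<phi> k x\<bar> powr p \<le> H j x \<and> norm (grad (\<phi> k) x) powr p \<le> H j x)
          \<and> \<bar>u x\<bar> powr p \<le> H j x \<and> norm (g x) powr p \<le> H j x"
      using H(2)[of j] lim
    proof eventually_elim
      case (elim x)
      show ?case
      proof
        assume "x \<in> K"
        then have b: "norm (U (r k) x) powr p \<le> H j x" if "j \<le> k" for k using elim(1) j that by blast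
        have "(\<lambda>k. norm (U (r k) x) powr p) \<longlonglongrightarrow> norm (W' x) powr p"
          using p by (intro tendsto_powr' tendsto_norm elim(2) tendsto_const) auto
        then have "norm (W' x) powr p \<le> H j x"
          by (rule LIMSEQ_le_const2) (use b in blast)
        then have "\<bar>u x\<bar> powr p \<le> H j x \<and> norm (g x) powr p \<le> H j x"
          unfolding u_def g_def using fst_le[of "W' x"] snd_le[of "W' x"] by linarith
        moreover have "\<bar>\<phi> k x\<bar> powr p \<le> H j x \<and> norm (grad (\<phi> k) x) powr p \<le> H j x" if "j \<le> k" for k
          using b[OF that] fst_le[of "U (r k) x"] snd_le[of "U (r k) x"] by (simp add: U_def \<phi>_def)
        ultimately show "(\<forall>k\<ge>j. \<bar>\<phi> k x\<bar> powr p \<le> H j x \<and> norm (grad (\<phi> k) x) powr p \<le> H j x)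
          \<and> \<bar>u x\<bar> powr p \<le> H j x \<and> norm (g x) powr p \<le> H j x" by blast
      qed
    qed
    then show "\<exists>H N. integrable M H \<and>
        (AE x in M. x \<in> K \<longrightarrow> (\<forall>k\<ge>N. \<bar>\<phi> k x\<bar> powr p \<le> H x \<and> norm (grad (\<phi> k) x) powr p \<le> H x)
          \<and> \<bar>u x\<bar> powr p \<le> H x \<and> norm (g x) powr p \<le> H x)"
      using H(1)[of j] by blast
  qed
  ultimately show ?thesis by blast
qed

end

section \<open>Passage to the limit\<close>

context p_energy
begin

text \<open>On compact sets s^q \<le> 1 + s^p is integrable. Exponent 1 is needed for the weak
  gradient, exponent p for membership in the Sobolev class.\<close>

lemma Lp_loc_of_local_bound:
  fixes v :: "real^'n \<Rightarrow> 'b::euclidean_space"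
  assumes v: "v \<in> borel_measurable M" and q: "0 \<le> q" "q \<le> p"
    and bd: "\<And>K. compact K \<Longrightarrow> K \<subseteq> \<Omega> \<Longrightarrow> \<exists>H. integrable M H \<and> (AE x in M. x \<in> K \<longrightarrow> norm (v x) powr p \<le> H x)"
  shows "v \<in> Lp_loc \<Omega> q"
  unfolding Lp_loc_def
proof (intro CollectI conjI allI impI)
  fix K assume "compact K \<and> K \<subseteq> \<Omega>"
  then have K: "compact K" "K \<subseteq> \<Omega>" by auto
  obtain H where H: "integrable M H" "AE x in M. x \<in> K \<longrightarrow> norm (v x) powr p \<le> H x"
    using bd[OF K] by blast
  have Km: "K \<in> sets M" by (rule compact_in_M[OF K])
  have "integrable M (\<lambda>x. indicator K x * norm (v x) powr q)"
  proof (rule Bochner_Integration.integrable_bound)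
    show "integrable M (\<lambda>x. indicator K x * 1 + \<bar>H x\<bar>)"
      by (intro Bochner_Integration.integrable_add integrable_abs H integrable_ind continuous_on_const K)
    show "(\<lambda>x. indicator K x * norm (v x) powr q) \<in> borel_measurable M"
      using v Km by measurable
    show "AE x in M. norm (indicator K x * norm (v x) powr q) \<le> norm (indicator K x * 1 + \<bar>H x\<bar>)"
      using H(2)
    proof eventually_elim
      case (elim x)
      show ?case
      proof (cases "x \<in> K")
        case True
        have "norm (v x) powr q \<le> 1 + norm (v x) powr p"
          using q by (intro powr_le_one_plus_powr) auto
        then show ?thesis using True elim by simp
      qed simp
    qed
  qed
  then show "integrable (lebesgue_on K) (\<lambda>x. norm (v x) powr q)"
    using K by (subst integrable_lebesgue_on_subset[OF \<Omega>_lebesgue]) (auto simp: borel_compact)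
qed (rule v)

text \<open>The derivative of the compactly supported product v w has integral zero.\<close>

lemma integration_by_parts:
  assumes v: "v \<in> \<D>" and w: "w \<in> \<D>"
  shows "(\<integral>x. v x * partial_deriv i w x \<partial>M) = - (\<integral>x. grad v x $ i * w x \<partial>M)"
proof -
  note sv = test_functions_smooth[OF v] and sw = test_functions_smooth[OF w]
  obtain K where K: "compact K" "K \<subseteq> \<Omega>" "\<And>x. x \<notin> K \<Longrightarrow> v x = 0" "\<And>x. x \<notin> K \<Longrightarrow> grad v x = 0"
    by (rule test_function_support[OF v]) (rule that)
  have g: "grad (\<lambda>x. v x * w x) x $ i = v x * (grad w x $ i) + grad v x $ i * w x" for x
    by (simp add: grad_mult[OF sv sw] mult.commute)
  have c1: "continuous_on UNIV (\<lambda>x. v x * (grad w x $ i))" and c2: "continuous_on UNIV (\<lambda>x. grad v x $ i * w x)"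
    by (intro continuous_on_mult continuous_on_component continuous_on_grad smooth_imp_continuous_on sv sw)+
  have i1: "integrable M (\<lambda>x. v x * (grad w x $ i))" by (rule integrable_compact[OF c1 K(1,2)]) (simp add: K(3))
  have i2: "integrable M (\<lambda>x. grad v x $ i * w x)" by (rule integrable_compact[OF c2 K(1,2)]) (simp add: K(4))
  have "(\<integral>x. v x * (grad w x $ i) + grad v x $ i * w x \<partial>M) = (\<integral>x. v x * (grad w x $ i) + grad v x $ i * w x \<partial>lborel)"
  proof (rule lebesgue_on_integral_eq_lborel(2)[OF \<Omega>_lebesgue])
    show "(\<lambda>x. v x * (grad w x $ i) + grad v x $ i * w x) \<in> borel_measurable borel"
      by (intro borel_measurable_continuous_onI continuous_on_add c1 c2)
    fix x assume "x \<notin> \<Omega>"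
    then have "x \<notin> K" using K(2) by blast
    then show "v x * (grad w x $ i) + grad v x $ i * w x = 0" by (simp add: K(3,4))
  qed
  also have "\<dots> = 0"
    unfolding g[symmetric]
    by (rule integral_partial_deriv_eq_0[OF smooth_mult[OF sv sw] K(1)]) (simp add: K(3))
  finally show ?thesis
    unfolding Bochner_Integration.integral_add[OF i1 i2] partial_deriv_conv_grad by simp
qed

lemma dominated_convergence_eventually:
  fixes T :: "nat \<Rightarrow> real^'n \<Rightarrow> real"
  assumes "\<And>k. T k \<in> borel_measurable M" "T0 \<in> borel_measurable M" "integrable M d"
    "AE x in M. (\<lambda>k. T k x) \<longlonglongrightarrow> T0 x" "AE x in M. \<forall>k\<ge>N. \<bar>T k x\<bar> \<le> d x"
  shows "(\<lambda>k. \<integral>x. T k x \<partial>M) \<longlonglongrightarrow> (\<integral>x. T0 x \<partial>M)"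
proof -
  have "(\<lambda>k. \<integral>x. T (k + N) x \<partial>M) \<longlonglongrightarrow> (\<integral>x. T0 x \<partial>M)"
  proof (rule integral_dominated_convergence[OF assms(2) assms(1) assms(3)])
    show "AE x in M. (\<lambda>k. T (k + N) x) \<longlonglongrightarrow> T0 x"
      using assms(4) by eventually_elim (rule LIMSEQ_ignore_initial_segment)
    show "AE x in M. norm (T (k + N) x) \<le> d x" for k
      using assms(5) by eventually_elim simp
  qed
  then show ?thesis by (rule LIMSEQ_offset)
qed

text \<open>Serves both parts of the energy: m = 1 with gradients, and m = V with the functions
  themselves. The p-th powers of the limit need not be integrable over \<Omega>, but their
  difference vanishes off the support of \<open>b\<close> and is dominated there uniformly in
  \<open>k\<close>.\<close>

lemma local_energy_difference_tendsto:
  fixes a :: "nat \<Rightarrow> real^'n \<Rightarrow> 'b::euclidean_space"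
  assumes K: "compact K" "K \<subseteq> \<Omega>" and m: "m \<in> borel_measurable M" "AE x in M. x \<in> K \<longrightarrow> \<bar>m x\<bar> \<le> c" "0 \<le> c"
    and a: "\<And>k. a k \<in> borel_measurable M" "a0 \<in> borel_measurable M" "AE x in M. (\<lambda>k. a k x) \<longlonglongrightarrow> a0 x"
    and H: "integrable M H" "AE x in M. x \<in> K \<longrightarrow> (\<forall>k\<ge>N. norm (a k x) powr p \<le> H x)"
    and b: "continuous_on UNIV b" "\<And>x. x \<notin> K \<Longrightarrow> b x = 0" and h: "\<bar>h\<bar> \<le> 1"
  shows "(\<lambda>k. \<integral>x. m x * (norm (a k x + h *\<^sub>R b x) powr p - norm (a k x) powr p) \<partial>M)
    \<longlonglongrightarrow> (\<integral>x. m x * (norm (a0 x + h *\<^sub>R b x) powr p - norm (a0 x) powr p) \<partial>M)"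
proof (rule dominated_convergence_eventually)
  have [measurable]: "b \<in> borel_measurable M" by (rule measurable_M[OF b(1)])
  note [measurable] = m(1) a(1,2)
  show "(\<lambda>x. m x * (norm (a k x + h *\<^sub>R b x) powr p - norm (a k x) powr p)) \<in> borel_measurable M" for k
    by measurable
  show "(\<lambda>x. m x * (norm (a0 x + h *\<^sub>R b x) powr p - norm (a0 x) powr p)) \<in> borel_measurable M"
    by measurable
  have "integrable M (\<lambda>x. norm (b x) powr p)"
    using p b(2) by (intro integrable_compact[OF _ K] continuous_on_norm_powr b(1)) auto
  then show "integrable M (\<lambda>x. c * (2 powr p * (\<bar>H x\<bar> + norm (b x) powr p)))"
    by (intro integrable_mult_right Bochner_Integration.integrable_add integrable_abs H(1))
  show "AE x in M. (\<lambda>k. m x * (norm (a k x + h *\<^sub>R b x) powr p - norm (a k x) powr p))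
      \<longlonglongrightarrow> m x * (norm (a0 x + h *\<^sub>R b x) powr p - norm (a0 x) powr p)"
    using a(3)
  proof eventually_elim
    case (elim x)
    show ?case
      using p by (intro tendsto_mult tendsto_diff tendsto_powr' tendsto_norm tendsto_add elim tendsto_const) auto
  qed
  show "AE x in M. \<forall>k\<ge>N. \<bar>m x * (norm (a k x + h *\<^sub>R b x) powr p - norm (a k x) powr p)\<bar>
      \<le> c * (2 powr p * (\<bar>H x\<bar> + norm (b x) powr p))"
    using m(2) H(2)
  proof eventually_elim
    case (elim x)
    show ?case
    proof (cases "x \<in> K")
      case True
      show ?thesis
      proof (intro allI impI)
        fix k assume "N \<le> k"
        then have Hk: "norm (a k x) powr p \<le> \<bar>H x\<bar>" using elim(2) True by force
        have "\<bar>norm (a k x + h *\<^sub>R b x) powr p - norm (a k x) powr p\<bar>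
            \<le> \<bar>h\<bar> * (2 powr p * (norm (a k x) powr p + norm (b x) powr p))"
          using p h by (intro norm_powr_diff_quotient_le) auto
        also have "\<dots> \<le> 1 * (2 powr p * (\<bar>H x\<bar> + norm (b x) powr p))"
          using h Hk by (intro mult_mono mult_left_mono add_right_mono) auto
        finally have "\<bar>norm (a k x + h *\<^sub>R b x) powr p - norm (a k x) powr p\<bar> \<le> 2 powr p * (\<bar>H x\<bar> + norm (b x) powr p)"
          by simp
        then show "\<bar>m x * (norm (a k x + h *\<^sub>R b x) powr p - norm (a k x) powr p)\<bar>
            \<le> c * (2 powr p * (\<bar>H x\<bar> + norm (b x) powr p))"
          unfolding abs_mult using elim(1) True m(3) by (intro mult_mono) auto
      qed
    next
      case False
      then show ?thesis using b(2)[of x] m(3) by simp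
    qed
  qed
qed

text \<open>Differentiation under the integral along the steps 1 / (n + 1). The increment bound is
  linear in the step, so dividing by it leaves a majorant independent of \<open>n\<close>.\<close>

lemma local_energy_quotient_tendsto:
  fixes a0 :: "real^'n \<Rightarrow> 'b::euclidean_space"
  assumes K: "compact K" "K \<subseteq> \<Omega>" and m: "m \<in> borel_measurable M" "AE x in M. x \<in> K \<longrightarrow> \<bar>m x\<bar> \<le> c" "0 \<le> c"
    and a: "a0 \<in> borel_measurable M"
    and H: "integrable M H" "AE x in M. x \<in> K \<longrightarrow> norm (a0 x) powr p \<le> H x"
    and b: "continuous_on UNIV b" "\<And>x. x \<notin> K \<Longrightarrow> b x = 0"
  shows "(\<lambda>n. \<integral>x. m x * ((norm (a0 x + (1 / real (Suc n)) *\<^sub>R b x) powr p - norm (a0 x) powr p) / (1 / real (Suc n))) \<partial>M)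
    \<longlonglongrightarrow> (\<integral>x. m x * (p * (norm (a0 x) powr (p - 2) * (a0 x \<bullet> b x))) \<partial>M)"
proof (rule dominated_convergence_eventually[where N = 0])
  have [measurable]: "b \<in> borel_measurable M" by (rule measurable_M[OF b(1)])
  note [measurable] = m(1) a
  show "(\<lambda>x. m x * ((norm (a0 x + (1 / real (Suc n)) *\<^sub>R b x) powr p - norm (a0 x) powr p) / (1 / real (Suc n)))) \<in> borel_measurable M" for n
    by measurable
  show "(\<lambda>x. m x * (p * (norm (a0 x) powr (p - 2) * (a0 x \<bullet> b x)))) \<in> borel_measurable M"
    by measurable
  have "integrable M (\<lambda>x. norm (b x) powr p)"
    using p b(2) by (intro integrable_compact[OF _ K] continuous_on_norm_powr b(1)) auto
  then show "integrable M (\<lambda>x. c * (2 powr p * (\<bar>H x\<bar> + norm (b x) powr p)))"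
    by (intro integrable_mult_right Bochner_Integration.integrable_add integrable_abs H(1))
  have seq: "filterlim (\<lambda>n. 1 / real (Suc n)) (at 0) sequentially"
    using LIMSEQ_inverse_real_of_nat by (simp add: filterlim_at inverse_eq_divide)
  show "AE x in M. (\<lambda>n. m x * ((norm (a0 x + (1 / real (Suc n)) *\<^sub>R b x) powr p - norm (a0 x) powr p) / (1 / real (Suc n))))
      \<longlonglongrightarrow> m x * (p * (norm (a0 x) powr (p - 2) * (a0 x \<bullet> b x)))"
  proof (rule AE_I2)
    fix x
    have "((\<lambda>h. (norm (a0 x + h *\<^sub>R b x) powr p - norm (a0 x) powr p) / h) \<longlongrightarrow> p * (norm (a0 x) powr (p - 2) * (a0 x \<bullet> b x))) (at 0)"
      using norm_powr_has_directional_derivative[OF p, of "a0 x" "b x"] by (simp add: DERIV_def)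
    from filterlim_compose[OF this seq]
    show "(\<lambda>n. m x * ((norm (a0 x + (1 / real (Suc n)) *\<^sub>R b x) powr p - norm (a0 x) powr p) / (1 / real (Suc n))))
      \<longlonglongrightarrow> m x * (p * (norm (a0 x) powr (p - 2) * (a0 x \<bullet> b x)))"
      by (intro tendsto_mult tendsto_const)
  qed
  show "AE x in M. \<forall>n\<ge>0. \<bar>m x * ((norm (a0 x + (1 / real (Suc n)) *\<^sub>R b x) powr p - norm (a0 x) powr p) / (1 / real (Suc n)))\<bar>
      \<le> c * (2 powr p * (\<bar>H x\<bar> + norm (b x) powr p))"
    using m(2) H(2)
  proof eventually_elim
    case (elim x)
    show ?case
    proof (cases "x \<in> K")
      case True
      show ?thesis
      proof (intro allI impI)
        fix n
        define h where "h = 1 / real (Suc n)"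
        have h: "0 < h" "\<bar>h\<bar> \<le> 1" by (auto simp: h_def)
        have Hk: "norm (a0 x) powr p \<le> \<bar>H x\<bar>" using elim(2) True by force
        have "\<bar>norm (a0 x + h *\<^sub>R b x) powr p - norm (a0 x) powr p\<bar>
            \<le> \<bar>h\<bar> * (2 powr p * (norm (a0 x) powr p + norm (b x) powr p))"
          using p h by (intro norm_powr_diff_quotient_le) auto
        also have "\<dots> \<le> \<bar>h\<bar> * (2 powr p * (\<bar>H x\<bar> + norm (b x) powr p))"
          using Hk by (intro mult_left_mono add_right_mono) auto
        finally have "\<bar>(norm (a0 x + h *\<^sub>R b x) powr p - norm (a0 x) powr p) / h\<bar> \<le> 2 powr p * (\<bar>H x\<bar> + norm (b x) powr p)"
          using h(1) by (simp add: abs_divide divide_le_eq mult.commute)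
        then show "\<bar>m x * ((norm (a0 x + (1 / real (Suc n)) *\<^sub>R b x) powr p - norm (a0 x) powr p) / (1 / real (Suc n)))\<bar>
            \<le> c * (2 powr p * (\<bar>H x\<bar> + norm (b x) powr p))"
          unfolding abs_mult h_def[symmetric] using elim(1) True m(3) by (intro mult_mono) auto
      qed
    next
      case False
      then show ?thesis using b(2)[of x] m(3) by simp
    qed
  qed
qed

end

context p_energy
begin

text \<open>Testing against a fixed compactly supported function: \<open>b\<close> is bounded on
  \<open>K\<close> and |a| \<le> 1 + |a|^p provides the majorant.\<close>

lemma local_product_tendsto:
  fixes a :: "nat \<Rightarrow> real^'n \<Rightarrow> real"
  assumes K: "compact K" "K \<subseteq> \<Omega>"
    and a: "\<And>k. a k \<in> borel_measurable M" "a0 \<in> borel_measurable M" "AE x in M. (\<lambda>k. a k x) \<longlonglongrightarrow> a0 x"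
    and H: "integrable M H" "AE x in M. x \<in> K \<longrightarrow> (\<forall>k\<ge>N. \<bar>a k x\<bar> powr p \<le> H x)"
    and b: "continuous_on UNIV b" "\<And>x. x \<notin> K \<Longrightarrow> b x = 0"
  shows "(\<lambda>k. \<integral>x. a k x * b x \<partial>M) \<longlonglongrightarrow> (\<integral>x. a0 x * b x \<partial>M)"
proof -
  have "compact (b ` K)"
    by (rule compact_continuous_image[OF continuous_on_subset[OF b(1)] K(1)]) simp
  then obtain B where B: "\<And>x. x \<in> K \<Longrightarrow> \<bar>b x\<bar> \<le> B"
    by (metis bounded_iff compact_imp_bounded imageI real_norm_def)
  show ?thesis
  proof (rule dominated_convergence_eventually)
    have bm: "b \<in> borel_measurable M" by (rule measurable_M[OF b(1)])
    show "(\<lambda>x. a k x * b x) \<in> borel_measurable M" for k by (intro borel_measurable_times a bm)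
    show "(\<lambda>x. a0 x * b x) \<in> borel_measurable M" by (intro borel_measurable_times a bm)
    show "integrable M (\<lambda>x. (indicator K x * 1 + \<bar>H x\<bar>) * \<bar>B\<bar>)"
      by (intro integrable_mult_left Bochner_Integration.integrable_add integrable_abs H integrable_ind continuous_on_const K)
    show "AE x in M. (\<lambda>k. a k x * b x) \<longlonglongrightarrow> a0 x * b x"
      using a(3) by eventually_elim (intro tendsto_mult tendsto_const)
    show "AE x in M. \<forall>k\<ge>N. \<bar>a k x * b x\<bar> \<le> (indicator K x * 1 + \<bar>H x\<bar>) * \<bar>B\<bar>"
      using H(2)
    proof eventually_elim
      case (elim x)
      show ?case
      proof (cases "x \<in> K")
        case True
        show ?thesis
        proof (intro allI impI)
          fix k assume "N \<le> k"
          then have Hk: "\<bar>a k x\<bar> powr p \<le> \<bar>H x\<bar>" using elim True by force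
          have "\<bar>a k x\<bar> \<le> 1 + \<bar>a k x\<bar> powr p"
            using powr_le_one_plus_powr[of "\<bar>a k x\<bar>" 1 p] p by simp
          then have "\<bar>a k x\<bar> \<le> 1 + \<bar>H x\<bar>" using Hk by linarith
          moreover have "\<bar>b x\<bar> \<le> \<bar>B\<bar>" using B[OF True] by linarith
          ultimately have "\<bar>a k x\<bar> * \<bar>b x\<bar> \<le> (1 + \<bar>H x\<bar>) * \<bar>B\<bar>" by (intro mult_mono) auto
          then show "\<bar>a k x * b x\<bar> \<le> (indicator K x * 1 + \<bar>H x\<bar>) * \<bar>B\<bar>"
            using True by (simp add: abs_mult)
        qed
      qed (simp add: b(2))
    qed
  qed
qed

end

context coercive_energy
begin

lemma locally_convergesD:
  assumes "locally_converges \<phi> u g"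
  shows "u \<in> borel_measurable M" "g \<in> borel_measurable M"
    "AE x in M. (\<lambda>k. \<phi> k x) \<longlonglongrightarrow> u x" "AE x in M. (\<lambda>k. grad (\<phi> k) x) \<longlonglongrightarrow> g x"
  using assms unfolding locally_converges_def by blast+

lemma locally_converges_bound:
  assumes "locally_converges \<phi> u g" "compact K" "K \<subseteq> \<Omega>"
  obtains H N where "integrable M H"
    "AE x in M. x \<in> K \<longrightarrow> (\<forall>k\<ge>N. \<bar>\<phi> k x\<bar> powr p \<le> H x)"
    "AE x in M. x \<in> K \<longrightarrow> (\<forall>k\<ge>N. norm (grad (\<phi> k) x) powr p \<le> H x)"
    "AE x in M. x \<in> K \<longrightarrow> \<bar>u x\<bar> powr p \<le> H x"
    "AE x in M. x \<in> K \<longrightarrow> norm (g x) powr p \<le> H x"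
proof -
  have "\<exists>H N. integrable M H \<and>
        (AE x in M. x \<in> K \<longrightarrow> (\<forall>k\<ge>N. \<bar>\<phi> k x\<bar> powr p \<le> H x \<and> norm (grad (\<phi> k) x) powr p \<le> H x)
          \<and> \<bar>u x\<bar> powr p \<le> H x \<and> norm (g x) powr p \<le> H x)"
    using assms unfolding locally_converges_def by (elim conjE allE[of _ K] impE) (intro conjI, assumption)
  then obtain H N where H: "integrable M H"
    "AE x in M. x \<in> K \<longrightarrow> (\<forall>k\<ge>N. \<bar>\<phi> k x\<bar> powr p \<le> H x \<and> norm (grad (\<phi> k) x) powr p \<le> H x)
          \<and> \<bar>u x\<bar> powr p \<le> H x \<and> norm (g x) powr p \<le> H x"
    by (elim exE conjE) (rule that)
  show ?thesis
    by (rule that[OF H(1)]; use H(2) in eventually_elim; blast)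
qed

lemma limit_Lp_loc:
  assumes conv: "locally_converges \<phi> u g" and q: "0 \<le> q" "q \<le> p"
  shows "u \<in> Lp_loc \<Omega> q" "g \<in> Lp_loc \<Omega> q"
proof -
  show "u \<in> Lp_loc \<Omega> q"
  proof (rule Lp_loc_of_local_bound[OF locally_convergesD(1)[OF conv] q])
    fix K assume K: "compact K" "K \<subseteq> \<Omega>"
    obtain H where "integrable M H" "AE x in M. x \<in> K \<longrightarrow> \<bar>u x\<bar> powr p \<le> H x"
      by (rule locally_converges_bound[OF conv K]) (rule that)
    then show "\<exists>H. integrable M H \<and> (AE x in M. x \<in> K \<longrightarrow> norm (u x) powr p \<le> H x)"
      by (intro exI[of _ H]) simp
  qed
  show "g \<in> Lp_loc \<Omega> q"
  proof (rule Lp_loc_of_local_bound[OF locally_convergesD(2)[OF conv] q])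
    fix K assume K: "compact K" "K \<subseteq> \<Omega>"
    obtain H where "integrable M H" "AE x in M. x \<in> K \<longrightarrow> norm (g x) powr p \<le> H x"
      by (rule locally_converges_bound[OF conv K]) (rule that)
    then show "\<exists>H. integrable M H \<and> (AE x in M. x \<in> K \<longrightarrow> norm (g x) powr p \<le> H x)"
      by (intro exI[of _ H]) simp
  qed
qed

lemma limit_has_weak_gradient:
  assumes \<phi>: "minimizing \<phi>" and conv: "locally_converges \<phi> u g"
  shows "has_weak_gradient \<Omega> u g"
  unfolding has_weak_gradient_def
proof (intro conjI ballI allI)
  show "u \<in> Lp_loc \<Omega> 1" "g \<in> Lp_loc \<Omega> 1"
    using limit_Lp_loc[OF conv, of 1] p by auto
  fix \<psi> i assume \<psi>: "\<psi> \<in> \<D>"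
  note D = minimizingD(1)[OF \<phi>]
  note sm = test_functions_smooth[OF D] and s\<psi> = test_functions_smooth[OF \<psi>]
  note cv = locally_convergesD[OF conv]
  obtain K where K: "compact K" "K \<subseteq> \<Omega>" "\<And>x. x \<notin> K \<Longrightarrow> \<psi> x = 0" "\<And>x. x \<notin> K \<Longrightarrow> grad \<psi> x = 0"
    by (rule test_function_support[OF \<psi>]) (rule that)
  obtain H N where H: "integrable M H"
    "AE x in M. x \<in> K \<longrightarrow> (\<forall>k\<ge>N. \<bar>\<phi> k x\<bar> powr p \<le> H x)"
    "AE x in M. x \<in> K \<longrightarrow> (\<forall>k\<ge>N. norm (grad (\<phi> k) x) powr p \<le> H x)"
    by (rule locally_converges_bound[OF conv K(1,2)]) (rule that)
  have L1: "(\<lambda>k. \<integral>x. \<phi> k x * partial_deriv i \<psi> x \<partial>M) \<longlonglongrightarrow> (\<integral>x. u x * partial_deriv i \<psi> x \<partial>M)"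
  proof (rule local_product_tendsto[OF K(1,2) _ cv(1,3) H(1,2)])
    show "\<phi> k \<in> borel_measurable M" for k by (rule measurable_M[OF smooth_imp_continuous_on[OF sm]])
    show "continuous_on UNIV (partial_deriv i \<psi>)"
      by (rule smooth_imp_continuous_on[OF smooth_partial_deriv[OF s\<psi>]])
    show "partial_deriv i \<psi> x = 0" if "x \<notin> K" for x using K(4)[OF that] by (simp add: partial_deriv_conv_grad)
  qed
  have L2: "(\<lambda>k. \<integral>x. grad (\<phi> k) x $ i * \<psi> x \<partial>M) \<longlonglongrightarrow> (\<integral>x. g x $ i * \<psi> x \<partial>M)"
  proof (rule local_product_tendsto[OF K(1,2) _ _ _ H(1)])
    show "(\<lambda>x. grad (\<phi> k) x $ i) \<in> borel_measurable M" for k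
      by (rule measurable_M) (intro continuous_on_component continuous_on_grad sm)
    show "(\<lambda>x. g x $ i) \<in> borel_measurable M"
      by (rule borel_measurable_continuous_on[OF _ cv(2)]) (intro continuous_on_component continuous_on_id)
    show "AE x in M. (\<lambda>k. grad (\<phi> k) x $ i) \<longlonglongrightarrow> g x $ i"
      using cv(4) by eventually_elim (rule tendsto_vec_nth)
    show "AE x in M. x \<in> K \<longrightarrow> (\<forall>k\<ge>N. \<bar>grad (\<phi> k) x $ i\<bar> powr p \<le> H x)"
      using H(3)
    proof eventually_elim
      case (elim x)
      have "\<bar>grad (\<phi> k) x $ i\<bar> powr p \<le> norm (grad (\<phi> k) x) powr p" for k
        using p by (intro powr_mono2 component_le_norm_cart) auto
      then show ?case using elim order_trans by blast
    qed
    show "continuous_on UNIV \<psi>" by (rule smooth_imp_continuous_on[OF s\<psi>])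
  qed (rule K(3))
  have "(\<integral>x. \<phi> k x * partial_deriv i \<psi> x \<partial>M) = - (\<integral>x. grad (\<phi> k) x $ i * \<psi> x \<partial>M)" for k
    by (rule integration_by_parts[OF D \<psi>])
  then have "(\<lambda>k. \<integral>x. \<phi> k x * partial_deriv i \<psi> x \<partial>M) \<longlonglongrightarrow> - (\<integral>x. g x $ i * \<psi> x \<partial>M)"
    using tendsto_minus[OF L2] by simp
  then show "(\<integral>x. u x * partial_deriv i \<psi> x \<partial>M) = - (\<integral>x. g x $ i * \<psi> x \<partial>M)"
    by (rule LIMSEQ_unique[OF L1])
qed

text \<open>Minimality of the sequence is tested with \<phi> k + h \<zeta> at fixed h. Linearity
  leaves only f(\<zeta>) on the left, so f is never evaluated at the limit; on the right only
  differences supported by \<zeta> remain. The factor 1 matches the weight \<open>m\<close> of the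
  convergence lemma.\<close>

lemma limit_variational_inequality:
  assumes \<phi>: "minimizing \<phi>" and conv: "locally_converges \<phi> u g" and \<zeta>: "\<zeta> \<in> \<D>" and h: "\<bar>h\<bar> \<le> 1"
  shows "p * (h * f \<zeta>) \<le> (\<integral>x. 1 * (norm (g x + h *\<^sub>R grad \<zeta> x) powr p - norm (g x) powr p) \<partial>M)
    - (\<integral>x. V x * (norm (u x + h *\<^sub>R \<zeta> x) powr p - norm (u x) powr p) \<partial>M)"
proof -
  note D = minimizingD(1)[OF \<phi>]
  note sm = test_functions_smooth[OF D] and s\<zeta> = test_functions_smooth[OF \<zeta>]
  note cv = locally_convergesD[OF conv]
  obtain K where K: "compact K" "K \<subseteq> \<Omega>" "\<And>x. x \<notin> K \<Longrightarrow> \<zeta> x = 0" "\<And>x. x \<notin> K \<Longrightarrow> grad \<zeta> x = 0"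
    by (rule test_function_support[OF \<zeta>]) (rule that)
  obtain H N where H: "integrable M H"
    "AE x in M. x \<in> K \<longrightarrow> (\<forall>k\<ge>N. \<bar>\<phi> k x\<bar> powr p \<le> H x)"
    "AE x in M. x \<in> K \<longrightarrow> (\<forall>k\<ge>N. norm (grad (\<phi> k) x) powr p \<le> H x)"
    by (rule locally_converges_bound[OF conv K(1,2)]) (rule that)
  obtain c where c: "0 \<le> c" "AE x in M. x \<in> K \<longrightarrow> \<bar>V x\<bar> \<le> c"
    by (rule V_bound[OF K(1,2)]) (rule that)
  have L1: "(\<lambda>k. \<integral>x. 1 * (norm (grad (\<phi> k) x + h *\<^sub>R grad \<zeta> x) powr p - norm (grad (\<phi> k) x) powr p) \<partial>M)
    \<longlonglongrightarrow> (\<integral>x. 1 * (norm (g x + h *\<^sub>R grad \<zeta> x) powr p - norm (g x) powr p) \<partial>M)"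
    by (rule local_energy_difference_tendsto[OF K(1,2) _ _ _ _ cv(2,4) H(1,3) continuous_on_grad[OF s\<zeta>] K(4) h, where c = 1])
      (auto intro: measurable_M continuous_on_grad sm)
  have L2: "(\<lambda>k. \<integral>x. V x * (norm (\<phi> k x + h *\<^sub>R \<zeta> x) powr p - norm (\<phi> k x) powr p) \<partial>M)
    \<longlonglongrightarrow> (\<integral>x. V x * (norm (u x + h *\<^sub>R \<zeta> x) powr p - norm (u x) powr p) \<partial>M)"
    by (rule local_energy_difference_tendsto[OF K(1,2) V_measurable c(2,1) _ cv(1,3) H(1) _ smooth_imp_continuous_on[OF s\<zeta>] K(3) h])
      (use H(2) in \<open>auto intro: measurable_M smooth_imp_continuous_on sm\<close>)
  have L3: "(\<lambda>k. p * (h * f \<zeta>) - 1 / real (Suc k)) \<longlonglongrightarrow> p * (h * f \<zeta>) - 0"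
    by (intro tendsto_diff tendsto_const LIMSEQ_inverse_real_of_nat[unfolded inverse_eq_divide])
  have "p * (h * f \<zeta>) - 1 / real (Suc k)
      \<le> (\<integral>x. 1 * (norm (grad (\<phi> k) x + h *\<^sub>R grad \<zeta> x) powr p - norm (grad (\<phi> k) x) powr p) \<partial>M)
       - (\<integral>x. V x * (norm (\<phi> k x + h *\<^sub>R \<zeta> x) powr p - norm (\<phi> k x) powr p) \<partial>M)" for k
  proof -
    define v where "v x = 1 * \<phi> k x + h * \<zeta> x" for x
    have v: "v \<in> \<D>" unfolding v_def by (rule test_functions_lincomb[OF D \<zeta>])
    have gv: "grad v x = grad (\<phi> k) x + h *\<^sub>R grad \<zeta> x" for x
      unfolding v_def by (subst grad_lincomb[OF sm s\<zeta>]) simp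
    have fv: "f v = f (\<phi> k) + h * f \<zeta>"
      unfolding v_def by (subst f_linear[OF D \<zeta>]) simp
    have "J (\<phi> k) \<le> J v + 1 / real (Suc k)" by (rule minimizingD(2)[OF \<phi> v])
    then have "p * (h * f \<zeta>) - 1 / real (Suc k) \<le> Q v - Q (\<phi> k)"
      unfolding J_def fv by (simp add: algebra_simps)
    also have "\<dots> = (\<integral>x. norm (grad v x) powr p - norm (grad (\<phi> k) x) powr p \<partial>M)
       - (\<integral>x. V x * (\<bar>v x\<bar> powr p - \<bar>\<phi> k x\<bar> powr p) \<partial>M)"
      by (rule Q_diff[OF v D])
    finally show ?thesis by (simp add: gv v_def)
  qed
  then have "p * (h * f \<zeta>) - 0 \<le> (\<integral>x. 1 * (norm (g x + h *\<^sub>R grad \<zeta> x) powr p - norm (g x) powr p) \<partial>M)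
    - (\<integral>x. V x * (norm (u x + h *\<^sub>R \<zeta> x) powr p - norm (u x) powr p) \<partial>M)"
    by (intro LIMSEQ_le[OF L3 tendsto_diff[OF L1 L2]]) blast
  then show ?thesis by simp
qed

text \<open>Positive steps give one inequality, which is linear in \<zeta>; the reverse one follows
  by inserting the negative of \<zeta>.\<close>

lemma limit_Euler_Lagrange_le:
  assumes \<phi>: "minimizing \<phi>" and conv: "locally_converges \<phi> u g" and \<zeta>: "\<zeta> \<in> \<D>"
  shows "f \<zeta> \<le> (\<integral>x. norm (g x) powr (p - 2) * (g x \<bullet> grad \<zeta> x) \<partial>M)
    - (\<integral>x. V x * \<bar>u x\<bar> powr (p - 2) * u x * \<zeta> x \<partial>M)"
proof -
  note s\<zeta> = test_functions_smooth[OF \<zeta>]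
  note cv = locally_convergesD[OF conv]
  obtain K where K: "compact K" "K \<subseteq> \<Omega>" "\<And>x. x \<notin> K \<Longrightarrow> \<zeta> x = 0" "\<And>x. x \<notin> K \<Longrightarrow> grad \<zeta> x = 0"
    by (rule test_function_support[OF \<zeta>]) (rule that)
  obtain H where H: "integrable M H"
    "AE x in M. x \<in> K \<longrightarrow> \<bar>u x\<bar> powr p \<le> H x"
    "AE x in M. x \<in> K \<longrightarrow> norm (g x) powr p \<le> H x"
    by (rule locally_converges_bound[OF conv K(1,2)]) (rule that)
  obtain c where c: "0 \<le> c" "AE x in M. x \<in> K \<longrightarrow> \<bar>V x\<bar> \<le> c"
    by (rule V_bound[OF K(1,2)]) (rule that)
  let ?h = "\<lambda>n. 1 / real (Suc n)"
  have L1: "(\<lambda>n. \<integral>x. 1 * ((norm (g x + ?h n *\<^sub>R grad \<zeta> x) powr p - norm (g x) powr p) / ?h n) \<partial>M)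
    \<longlonglongrightarrow> (\<integral>x. 1 * (p * (norm (g x) powr (p - 2) * (g x \<bullet> grad \<zeta> x))) \<partial>M)"
    by (rule local_energy_quotient_tendsto[OF K(1,2) _ _ _ cv(2) H(1,3) continuous_on_grad[OF s\<zeta>] K(4), where c = 1]) auto
  have L2: "(\<lambda>n. \<integral>x. V x * ((norm (u x + ?h n *\<^sub>R \<zeta> x) powr p - norm (u x) powr p) / ?h n) \<partial>M)
    \<longlonglongrightarrow> (\<integral>x. V x * (p * (norm (u x) powr (p - 2) * (u x \<bullet> \<zeta> x))) \<partial>M)"
    by (rule local_energy_quotient_tendsto[OF K(1,2) V_measurable c(2,1) cv(1) H(1) _ smooth_imp_continuous_on[OF s\<zeta>] K(3)])
      (use H(2) in auto)
  have "p * f \<zeta> \<le> (\<integral>x. 1 * ((norm (g x + ?h n *\<^sub>R grad \<zeta> x) powr p - norm (g x) powr p) / ?h n) \<partial>M)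
      - (\<integral>x. V x * ((norm (u x + ?h n *\<^sub>R \<zeta> x) powr p - norm (u x) powr p) / ?h n) \<partial>M)" for n
  proof -
    define t where "t = ?h n"
    have t: "0 < t" "\<bar>t\<bar> \<le> 1" by (auto simp: t_def)
    have "p * f \<zeta> = p * (t * f \<zeta>) / t" using t(1) by simp
    also have "\<dots> \<le> ((\<integral>x. 1 * (norm (g x + t *\<^sub>R grad \<zeta> x) powr p - norm (g x) powr p) \<partial>M)
        - (\<integral>x. V x * (norm (u x + t *\<^sub>R \<zeta> x) powr p - norm (u x) powr p) \<partial>M)) / t"
      using t by (intro divide_right_mono limit_variational_inequality[OF \<phi> conv \<zeta>]) auto
    finally show ?thesis
      unfolding t_def[symmetric]
      by (simp only: times_divide_eq_right integral_divide_zero diff_divide_distrib[symmetric])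
  qed
  then have "p * f \<zeta> \<le> (\<integral>x. 1 * (p * (norm (g x) powr (p - 2) * (g x \<bullet> grad \<zeta> x))) \<partial>M)
      - (\<integral>x. V x * (p * (norm (u x) powr (p - 2) * (u x \<bullet> \<zeta> x))) \<partial>M)"
    by (intro LIMSEQ_le_const[OF tendsto_diff[OF L1 L2]]) blast
  also have "(\<lambda>x. V x * (p * (norm (u x) powr (p - 2) * (u x \<bullet> \<zeta> x)))) = (\<lambda>x. p * (V x * \<bar>u x\<bar> powr (p - 2) * u x * \<zeta> x))"
    by (simp add: fun_eq_iff)
  finally have "p * f \<zeta> \<le> p * ((\<integral>x. norm (g x) powr (p - 2) * (g x \<bullet> grad \<zeta> x) \<partial>M)
    - (\<integral>x. V x * \<bar>u x\<bar> powr (p - 2) * u x * \<zeta> x \<partial>M))"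
    by (simp only: mult_1 integral_mult_right_zero right_diff_distrib)
  then show ?thesis using p by simp
qed

lemma ex_distributional_solution: "\<exists>u\<in>W1p_loc \<Omega> p. distributional_solution \<Omega> p V f u"
proof -
  obtain \<phi> u g where \<phi>: "minimizing \<phi>" and conv: "locally_converges \<phi> u g"
    using ex_minimizing_locally_converges by blast
  have wg: "has_weak_gradient \<Omega> u g" by (rule limit_has_weak_gradient[OF \<phi> conv])
  have "u \<in> W1p_loc \<Omega> p"
    using wg limit_Lp_loc[OF conv, of p] p by (auto simp: W1p_loc_def)
  moreover have "(\<integral>x. norm (g x) powr (p - 2) * (g x \<bullet> grad \<zeta> x) \<partial>M)
    - (\<integral>x. V x * \<bar>u x\<bar> powr (p - 2) * u x * \<zeta> x \<partial>M) = f \<zeta>" if \<zeta>: "\<zeta> \<in> \<D>" for \<zeta>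
  proof (rule antisym)
    \<comment> \<open>Testing with the negative of \<zeta> reverses the inequality.\<close>
    define \<zeta>' where "\<zeta>' x = (- 1) * \<zeta> x" for x
    have \<zeta>': "\<zeta>' \<in> \<D>" unfolding \<zeta>'_def by (rule scale_in[OF \<zeta>])
    have "grad \<zeta>' x = - grad \<zeta> x" for x
      unfolding \<zeta>'_def by (subst grad_cmult[OF test_functions_smooth[OF \<zeta>]]) simp
    moreover have "f \<zeta>' = - f \<zeta>" unfolding \<zeta>'_def by (subst f_scale[OF \<zeta>]) simp
    ultimately show "(\<integral>x. norm (g x) powr (p - 2) * (g x \<bullet> grad \<zeta> x) \<partial>M)
      - (\<integral>x. V x * \<bar>u x\<bar> powr (p - 2) * u x * \<zeta> x \<partial>M) \<le> f \<zeta>"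
      using limit_Euler_Lagrange_le[OF \<phi> conv \<zeta>'] by (simp add: \<zeta>'_def)
    show "f \<zeta> \<le> (\<integral>x. norm (g x) powr (p - 2) * (g x \<bullet> grad \<zeta> x) \<partial>M)
      - (\<integral>x. V x * \<bar>u x\<bar> powr (p - 2) * u x * \<zeta> x \<partial>M)"
      by (rule limit_Euler_Lagrange_le[OF \<phi> conv \<zeta>])
  qed
  ultimately show ?thesis
    using wg unfolding distributional_solution_def by blast
qed

end

theorem theorem6p2:
  fixes p :: real and \<Omega> :: "(real^'n::finite) set" and V :: "real^'n \<Rightarrow> real"
  assumes "1 < p"
    and "open \<Omega>" and "connected \<Omega>"
    and "V \<in> Linf_loc \<Omega>" and "AE x in lebesgue_on \<Omega>. 0 \<le> V x"
    and "\<exists>W. continuous_on \<Omega> W \<and> (\<forall>x\<in>\<Omega>. 0 < W x) \<and>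
           (\<forall>u\<in>test_functions \<Omega>.
              Q_form \<Omega> p V u \<ge> (LINT x|lebesgue_on \<Omega>. W x * \<bar>u x\<bar> powr p))"
  shows "\<forall>f\<in>distributions \<Omega>.
           (SUP u\<in>{u \<in> test_functions \<Omega>. Q_form \<Omega> p V u = 1}. ereal (f u)) < \<infinity> \<longrightarrow>
           (\<exists>u\<in>W1p_loc \<Omega> p. distributional_solution \<Omega> p V f u)"
proof (intro ballI impI)
  fix f assume f: "f \<in> distributions \<Omega>"
    and sup: "(SUP u\<in>{u \<in> test_functions \<Omega>. Q_form \<Omega> p V u = 1}. ereal (f u)) < \<infinity>"
  obtain W where W: "continuous_on \<Omega> W" "\<forall>x\<in>\<Omega>. 0 < W x"
    "\<forall>u\<in>test_functions \<Omega>. Q_form \<Omega> p V u \<ge> (LINT x|lebesgue_on \<Omega>. W x * \<bar>u x\<bar> powr p)"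
    using assms(6) by (elim exE conjE) (rule that)
  \<comment> \<open>A natural number above the supremum is a real upper bound that is also
    nonnegative, as the locale requires.\<close>
  obtain n :: nat where n: "(SUP u\<in>{u \<in> test_functions \<Omega>. Q_form \<Omega> p V u = 1}. ereal (f u)) < ereal (real n)"
    using less_PInf_Ex_of_nat[of "SUP u\<in>{u \<in> test_functions \<Omega>. Q_form \<Omega> p V u = 1}. ereal (f u)"] sup by auto
  interpret coercive_energy p \<Omega> V W f "real n"
  proof
    show "f u \<le> real n" if "u \<in> test_functions \<Omega>" "Q_form \<Omega> p V u = 1" for u
    proof -
      have "ereal (f u) \<le> (SUP u\<in>{u \<in> test_functions \<Omega>. Q_form \<Omega> p V u = 1}. ereal (f u))"
        using that by (intro SUP_upper) simp
      then have "ereal (f u) < ereal (real n)" using n by (rule order_le_less_trans)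
      then show ?thesis by simp
    qed
    show "f (\<lambda>x. a * u x + b * v x) = a * f u + b * f v"
      if "u \<in> test_functions \<Omega>" "v \<in> test_functions \<Omega>" for u v a b
      using f that unfolding distributions_def by blast
  qed (use assms W in auto)
  show "\<exists>u\<in>W1p_loc \<Omega> p. distributional_solution \<Omega> p V f u"
    by (rule ex_distributional_solution)
qed

end
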